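(* Let $(n_j)_{j\ge1}$ (with $n_1=1$) be a sequence of Beurling generalized integers and let $N(x)=\#\{j:n_j\le x\}$. Suppose there is $\theta\in[0,1)$ such that $N(x+x^{\theta})-N(x-x^{\theta})\ll_{\varepsilon} x^{\theta+\varepsilon}$ for every $\varepsilon>0$. Let \[ F(s)=1+\sum_{j=2}^{\infty}\frac{a_j}{n_j^{s}},\qquad G(s)=\frac{1}{F(s)}=1+\sum_{j=2}^{\infty}\frac{b_j}{n_j^{s}} \] be general Dirichlet series with $a_j\ge0$ and $a_j\ll_{\varepsilon} n_j^{\varepsilon}$, $|b_j|\ll_\varepsilon n_j^{\varepsilon}$ for every $\varepsilon>0$. Suppose further that \[ A(x)\coloneqq\sum_{n_j\le x}a_j = xP(\log x)+O\bigl(x^{\theta}(\log x)^{q}\bigr) \] for some polynomial $P$ of degree $d$ and some $q\in\mathbb{R}$. Then $F(s)$ has meromorphic continuation to $\Re s>\theta$ whose only singularity is a pole of order $d+1$ at $s=1$, and for every $\varepsilon>0$, \[ N(F;\alpha,T)\ll_{\varepsilon} T^{\frac{4(1-\alpha)}{3-2\alpha-\theta}+\varepsilon} \] uniformly for $\alpha\ge\frac{1+\theta}{2}$ and $T\ge2$ (the implied constant depending on $\varepsilon$ and on $F$).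
   Context: A sequence of Beurling generalized integers is the non-decreasing sequence (with multiplicity) of all finite products (including $1$) of a sequence of generalized primes $1<p_1\le p_2\le\dots$, $p_j\to\infty$. $G=1/F$ means that $G$ is the general Dirichlet series over the same sequence $(n_j)$ whose formal product with $F$ (Dirichlet convolution over the multiplicative semigroup generated by the primes) is $1$. For $\alpha>\theta$, $T>0$, $N(F;\alpha,T)$ is the number of zeros $\rho=\beta+\mathrm{i}\gamma$ of the continuation of $F$ with $\beta\ge\alpha$, $|\gamma|\le T$, counted with multiplicity. *)

theory Defs
  imports "HOL-Complex_Analysis.Complex_Analysis" "HOL-Library.Multiset"
    "HOL-Library.Landau_Symbols"
begin

definition beurling_primes :: "(nat \<Rightarrow> real) \<Rightarrow> bool" where
  "beurling_primes p \<longleftrightarrow> 1 < p 0 \<and> mono p \<and> filterlim p at_top sequentially"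

text \<open>
  Sequences are indexed from 0, so the generalized integer \<open>1\<close> is \<open>n 0\<close>. The bijection with the
  finite multisets of prime indices makes \<open>n\<close> list every product with its multiplicity: distinct
  factorizations with the same real value occupy distinct indices.
\<close>

definition beurling_integers :: "(nat \<Rightarrow> real) \<Rightarrow> (nat \<Rightarrow> real) \<Rightarrow> bool" where
  "beurling_integers p n \<longleftrightarrow> beurling_primes p \<and> mono n \<and>
     (\<exists>e :: nat \<Rightarrow> nat multiset. bij e \<and> (\<forall>j. n j = (\<Prod>i\<in>#e j. p i)))"

definition counting :: "(nat \<Rightarrow> real) \<Rightarrow> real \<Rightarrow> nat" where
  "counting n x = card {j. n j \<le> x}"

definition summatory :: "(nat \<Rightarrow> real) \<Rightarrow> (nat \<Rightarrow> real) \<Rightarrow> real \<Rightarrow> real" where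
  "summatory n a x = (\<Sum>j | n j \<le> x. a j)"

text \<open>
  The coefficient at frequency \<open>\<nu>\<close> of the formal product of two general Dirichlet series over
  \<open>n\<close>. Products are compared as real numbers, so this is the multiplicative convolution of the
  measures with masses \<open>a j\<close> and \<open>b j\<close> at the points \<open>n j\<close>. A convolution identity indexed by
  factorizations implies the one below, by summing over all factorizations of value \<open>\<nu>\<close>.
\<close>

definition dirichlet_conv ::
    "(nat \<Rightarrow> real) \<Rightarrow> (nat \<Rightarrow> complex) \<Rightarrow> (nat \<Rightarrow> complex) \<Rightarrow> real \<Rightarrow> complex" where
  "dirichlet_conv n a b \<nu> = (\<Sum>(j, k) \<in> {(j, k). n j * n k = \<nu>}. a j * b k)"

definition formal_inverse ::
    "(nat \<Rightarrow> real) \<Rightarrow> (nat \<Rightarrow> complex) \<Rightarrow> (nat \<Rightarrow> complex) \<Rightarrow> bool" where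
  "formal_inverse n a b \<longleftrightarrow> (\<forall>\<nu>. dirichlet_conv n a b \<nu> = (if \<nu> = 1 then 1 else 0))"

text \<open>
  The condition \<open>f analytic_on {\<rho>}\<close> discards poles, at which the value of \<open>f\<close> is arbitrary.
\<close>

definition zeros_in :: "(complex \<Rightarrow> complex) \<Rightarrow> real \<Rightarrow> real \<Rightarrow> complex set" where
  "zeros_in f \<alpha> T = {\<rho>. f analytic_on {\<rho>} \<and> f \<rho> = 0 \<and> \<alpha> \<le> Re \<rho> \<and> \<bar>Im \<rho>\<bar> \<le> T}"

definition zero_count :: "(complex \<Rightarrow> complex) \<Rightarrow> real \<Rightarrow> real \<Rightarrow> nat" where
  "zero_count f \<alpha> T = (\<Sum>\<rho>\<in>zeros_in f \<alpha> T. nat (zorder f \<rho>))"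

lemma prod_mset_ge_power:
  assumes "beurling_primes p"
  shows "p 0 ^ size M \<le> (\<Prod>i\<in>#M. p i)"
proof (induction M)
  case (add i M)
  have "p 0 \<le> p i" "1 < p 0"
    using assms by (auto simp: beurling_primes_def mono_def)
  with add show ?case by (auto intro!: mult_mono)
qed auto

lemma beurling_integers_ge_1:
  assumes "beurling_integers p n"
  shows "1 \<le> n j"
proof -
  from assms obtain e where p: "beurling_primes p"
    and n: "n j = (\<Prod>i\<in>#e j. p i)" for j
    by (auto simp: beurling_integers_def)
  have "1 \<le> p 0 ^ size (e j)"
    using p by (simp add: beurling_primes_def one_le_power)
  also have "\<dots> \<le> n j" unfolding n by (rule prod_mset_ge_power[OF p])
  finally show ?thesis .
qed

lemma beurling_integers_0:
  assumes "beurling_integers p n"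
  shows "n 0 = 1"
proof -
  from assms obtain e :: "nat \<Rightarrow> nat multiset" where e: "bij e"
    and n: "\<And>j. n j = (\<Prod>i\<in>#e j. p i)" and m: "mono n"
    by (auto simp: beurling_integers_def)
  obtain j where "e j = {#}" using e by (metis bij_pointE)
  then have "n j = 1" by (simp add: n)
  moreover have "n 0 \<le> n j" using m by (simp add: mono_def)
  ultimately show ?thesis using beurling_integers_ge_1[OF assms, of 0] by simp
qed

lemma beurling_integers_finite:
  assumes "beurling_integers p n"
  shows "finite {j. n j \<le> x}"
proof -
  from assms obtain e :: "nat \<Rightarrow> nat multiset" where e: "bij e" and p: "beurling_primes p"
    and n: "\<And>j. n j = (\<Prod>i\<in>#e j. p i)"
    by (auto simp: beurling_integers_def)
  have p1: "1 < p 0" "p 0 \<le> p i" for i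
    using p by (auto simp: beurling_primes_def mono_def)
  obtain K where K: "x < p 0 ^ K" using real_arch_pow[OF p1(1)] by blast
  have "eventually (\<lambda>i. x < p i) sequentially"
    using p by (auto simp: beurling_primes_def filterlim_at_top_dense)
  then obtain I where I: "\<And>i. I \<le> i \<Longrightarrow> x < p i"
    by (auto simp: eventually_sequentially)
  have "e ` {j. n j \<le> x} \<subseteq> mset ` {xs. set xs \<subseteq> {..<I} \<and> length xs \<le> K}"
  proof clarify
    fix j assume j: "n j \<le> x"
    have "size (e j) \<le> K"
    proof (rule ccontr)
      assume "\<not> size (e j) \<le> K"
      then have "p 0 ^ K \<le> p 0 ^ size (e j)" using p1 by (intro power_increasing) auto
      also have "\<dots> \<le> n j" unfolding n by (rule prod_mset_ge_power[OF p])
      finally show False using j K by simp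
    qed
    moreover have "set_mset (e j) \<subseteq> {..<I}"
    proof
      fix i assume "i \<in># e j"
      then obtain M where M: "e j = add_mset i M" by (metis mset_add)
      have "1 \<le> p 0 ^ size M" using p1(1) by (simp add: one_le_power)
      also have "\<dots> \<le> (\<Prod>i\<in>#M. p i)" by (rule prod_mset_ge_power[OF p])
      finally have "p i * 1 \<le> p i * (\<Prod>i\<in>#M. p i)"
        using p1(1) p1(2)[of i] by (intro mult_left_mono) auto
      then have "p i \<le> x" using j by (simp add: n M)
      then show "i \<in> {..<I}" using I[of i] by (meson lessThan_iff not_le)
    qed
    moreover obtain xs where "e j = mset xs" by (metis ex_mset)
    ultimately show "e j \<in> mset ` {xs. set xs \<subseteq> {..<I} \<and> length xs \<le> K}"
      by auto
  qed
  then have "finite (e ` {j. n j \<le> x})"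
    by (rule finite_subset) (intro finite_imageI finite_lists_length_le finite_lessThan)
  then show ?thesis
    using e by (meson bij_is_inj finite_imageD inj_on_subset subset_UNIV)
qed

text \<open>Only finitely many terms contribute to \<^const>\<open>dirichlet_conv\<close>.\<close>

lemma beurling_integers_finite_pairs:
  assumes "beurling_integers p n"
  shows "finite {(j, k). n j * n k = \<nu>}"
proof (rule finite_subset)
  have "n j \<le> n j * n k \<and> n k \<le> n j * n k" for j k
    using beurling_integers_ge_1[OF assms, of j] beurling_integers_ge_1[OF assms, of k] by simp
  then show "{(j, k). n j * n k = \<nu>} \<subseteq> {j. n j \<le> \<nu>} \<times> {k. n k \<le> \<nu>}"
    by blast
  show "finite ({j. n j \<le> \<nu>} \<times> {k. n k \<le> \<nu>})"
    by (intro finite_cartesian_product beurling_integers_finite[OF assms])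
qed

end

theory Submission imports Defs "HOL-Probability.Probability" "HOL-Real_Asymp.Real_Asymp"
begin

text \<open>
  A zero \<open>\<rho>\<close> of \<open>F\<close> is a point where \<open>H = F M - 1\<close> equals \<open>-1\<close>, where the mollifier \<open>M\<close> is the partial sum of \<open>1/F\<close>
  over \<open>n\<^sub>j \<le> X\<close>. Cauchy's formula for \<open>H(s) Y\<^bsup>s - \<rho>\<^esup> exp((s - \<rho>)\<^sup>2)\<close> on a rectangle between the lines
  \<open>Re s = (1 + \<theta>)/2 - \<delta>\<close> and \<open>Re s = 1 + \<delta>\<close> shows that \<open>|H|\<close> is large near height \<open>Im \<rho>\<close> on one of the two lines.
  On the right line \<open>H\<close> is an absolutely convergent series over frequencies larger than \<open>X\<close>, and a mean value theorem
  for general Dirichlet series bounds its mean square by \<open>T\<^sup>\<epsilon> (1 + T X\<^bsup>\<theta> - 1\<^esup>)\<close>. On the left line \<open>|F M|\<close> is at most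
  \<open>|F|\<^sup>2 + |M|\<^sup>2\<close>, and both mean squares are \<open>O(T\<^bsup>1 + \<epsilon>\<^esup>)\<close> for \<open>X = T\<^bsup>1/(1 - \<theta>)\<^esup>\<close>. The number of zeros is therefore
  \<open>T\<^sup>\<epsilon> (Y\<^bsup>2 - 2\<alpha>\<^esup> + T Y\<^bsup>(1 + \<theta>)/2 - \<alpha>\<^esup>)\<close>, and \<open>Y = T\<^bsup>2/(3 - 2\<alpha> - \<theta>)\<^esup>\<close> balances the two terms. The mean value
  theorem rests on the short interval hypothesis, averaged against a Gaussian weight because its Fourier transform is
  explicit, positive and rapidly decreasing.
\<close>

section \<open>Counting generalized integers\<close>

text \<open>The abscissa (1 + \<theta>)/2 is set by the mean value theorem: coefficients of size
  n^o(1) give the weight n^(-2 \<sigma>) (n + T n^\<theta>), whose part with T is summable exactly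
  for 2 \<sigma> > 1 + \<theta>. At the border the other part contributes N^(1 - \<theta>) for a
  polynomial of length N, which equals T for N = T^(1/(1 - \<theta>)); the same length makes T
  X^(\<theta> - 1) bounded on the right line. The only pointwise bound for F in the strip is
  polynomial. It suffices because exp((s - \<rho>)^2) at distance ln T beats every power of T. The
  shifts by \<delta> keep 1/(s - \<rho>) bounded on both lines, even for \<alpha> = (1 +
  \<theta>)/2, and make the right-hand series converge absolutely. F M - 1 has frequencies n_j n_k
  that may repeat, so spacing is needed for pairs as well; a divisor bound for formal factorizations
  supplies it. No well-spaced subset of zeros is chosen. The lower bounds over windows of length 2
  ln T are added up, and Jensen's inequality bounds the overlap. Zeros whose window comes near the
  pole are counted by Jensen alone.\<close>

text \<open>
  The factor \<open>exp (6 * \<eta>)\<close> makes the bound uniform in \<open>\<eta>\<close>; any fixed exponent would do, since the bound is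
  summed against Gaussian weights in \<open>\<eta>\<close>.
\<close>

definition spaced :: "real \<Rightarrow> ('i \<Rightarrow> real) \<Rightarrow> bool" where
  "spaced \<theta> \<nu> \<longleftrightarrow> (\<forall>\<epsilon>>0. \<epsilon> \<le> 1 \<longrightarrow> (\<exists>C\<ge>0. \<forall>x\<ge>1. \<forall>\<eta>\<ge>0.
     finite {i. \<bar>ln (\<nu> i) - ln x\<bar> \<le> \<eta>} \<and>
     real (card {i. \<bar>ln (\<nu> i) - ln x\<bar> \<le> \<eta>})
       \<le> C * x powr \<epsilon> * exp (6 * \<eta>) * (\<eta> * x + x powr \<theta>)))"

text \<open>The Landau bound speaks of large indices only; positivity of \<open>g\<close> lets the
  finitely many remaining ratios be added to the constant.\<close>

lemma bigo_nat_all: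
  fixes f g :: "nat \<Rightarrow> real"
  assumes "f \<in> O(g)" "\<And>j. g j > 0"
  obtains C where "C \<ge> 0" "\<And>j. \<bar>f j\<bar> \<le> C * g j"
proof -
  obtain c where c: "c > 0" "eventually (\<lambda>j. norm (f j) \<le> c * norm (g j)) sequentially"
    using assms(1) by (elim landau_o.bigE) auto
  then obtain J where J: "\<And>j. j \<ge> J \<Longrightarrow> \<bar>f j\<bar> \<le> c * g j"
    using assms(2) by (auto simp: eventually_sequentially less_imp_le abs_of_pos)
  define C where "C = c + (\<Sum>j<J. \<bar>f j\<bar> / g j)"
  have nn: "(\<Sum>j<J. \<bar>f j\<bar> / g j) \<ge> 0"
    by (intro sum_nonneg divide_nonneg_nonneg) (use assms(2) in \<open>auto intro: less_imp_le\<close>)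
  show ?thesis
  proof
    show "C \<ge> 0" using c nn by (simp add: C_def)
    fix j show "\<bar>f j\<bar> \<le> C * g j"
    proof (cases "j < J")
      case True
      have "\<bar>f j\<bar> / g j \<le> (\<Sum>j<J. \<bar>f j\<bar> / g j)"
        by (rule member_le_sum) (use True assms(2) in \<open>auto intro!: divide_nonneg_pos\<close>)
      also have "\<dots> \<le> C" using c by (simp add: C_def)
      finally show ?thesis using assms(2)[of j] by (simp add: field_simps)
    next
      case False
      then have "\<bar>f j\<bar> \<le> c * g j" using J by simp
      also have "\<dots> \<le> C * g j" using nn assms(2)[of j] by (intro mult_right_mono) (auto simp: C_def)
      finally show ?thesis .
    qed
  qed
qed

lemma exp_diff_le: "exp \<eta> - exp (- \<eta>) \<le> 2 * \<eta> * exp (\<eta>::real)"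
proof -
  have "1 - 2 * \<eta> \<le> exp (- 2 * \<eta>)" using exp_ge_add_one_self[of "-2*\<eta>"] by simp
  then have "(1 - 2 * \<eta>) * exp \<eta> \<le> exp (- 2 * \<eta>) * exp \<eta>" by (intro mult_right_mono) auto
  also have "\<dots> = exp (- \<eta>)" by (simp flip: exp_add)
  finally show ?thesis by (simp add: algebra_simps)
qed

locale beurling_system =
  fixes p n :: "nat \<Rightarrow> real" and \<theta> :: real
  assumes integers: "beurling_integers p n"
    and theta: "0 \<le> \<theta>" "\<theta> < 1"
    and short_intervals: "\<And>\<epsilon>. \<epsilon> > 0 \<Longrightarrow>
      (\<lambda>x::real. real (counting n (x + x powr \<theta>)) - real (counting n (x - x powr \<theta>)))
        \<in> O(\<lambda>x. x powr (\<theta> + \<epsilon>))"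
begin

lemma n_ge1: "1 \<le> n j" using beurling_integers_ge_1[OF integers] .
lemma n_pos: "0 < n j" using n_ge1[of j] by linarith
lemma n_finite: "finite {j. n j \<le> x}" using beurling_integers_finite[OF integers] .
lemma n_0: "n 0 = 1" using beurling_integers_0[OF integers] .
lemma n_mono: "i \<le> j \<Longrightarrow> n i \<le> n j"
  using integers by (auto simp: beurling_integers_def mono_def)

text \<open>Tile \<open>[y, z]\<close> with constant step \<open>h = y powr \<theta>\<close>. The
  interval about the point y + i h has half-length (y + i h)^\<theta>, which is at least h because
  \<theta> is nonnegative, so it contains the whole tile to its right. About (z - y)/h + 1
  applications of the short interval hypothesis suffice.\<close>

lemma cover_count:
  assumes e: "\<epsilon> > 0"
  obtains C x0 where "C \<ge> 0" "x0 \<ge> 1"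
    "\<And>y z. x0 \<le> y \<Longrightarrow> y \<le> z \<Longrightarrow>
       real (card {j. y \<le> n j \<and> n j \<le> z}) \<le> C * ((z - y) / y powr \<theta> + 1) * z powr (\<theta> + \<epsilon>)"
proof -
  obtain c where c: "c > 0" "eventually (\<lambda>x. norm (real (counting n (x + x powr \<theta>)) -
      real (counting n (x - x powr \<theta>))) \<le> c * norm (x powr (\<theta> + \<epsilon>))) at_top"
    using short_intervals[OF e] by (elim landau_o.bigE) auto
  then obtain x1 where x1: "\<And>x. x \<ge> x1 \<Longrightarrow> real (counting n (x + x powr \<theta>)) -
      real (counting n (x - x powr \<theta>)) \<le> c * x powr (\<theta> + \<epsilon>)"
    unfolding eventually_at_top_linorder by fastforce
  define x0 where "x0 = max 1 x1"
  have step: "real (card {j. x - x powr \<theta> < n j \<and> n j \<le> x + x powr \<theta>}) \<le> c * x powr (\<theta> + \<epsilon>)"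
    if "x \<ge> x0" for x
  proof -
    have "{j. x - x powr \<theta> < n j \<and> n j \<le> x + x powr \<theta>} = {j. n j \<le> x + x powr \<theta>} - {j. n j \<le> x - x powr \<theta>}"
      by auto
    moreover have "{j. n j \<le> x - x powr \<theta>} \<subseteq> {j. n j \<le> x + x powr \<theta>}"
      using powr_ge_zero[of x \<theta>] by (auto intro: order_trans)
    ultimately have "real (card {j. x - x powr \<theta> < n j \<and> n j \<le> x + x powr \<theta>}) =
        real (counting n (x + x powr \<theta>)) - real (counting n (x - x powr \<theta>))"
      by (simp add: card_Diff_subset n_finite counting_def card_mono of_nat_diff)
    then show ?thesis using x1[of x] that by (simp add: x0_def)
  qed
  show ?thesis
  proof (rule that[of c x0])
    show "c \<ge> 0" "x0 \<ge> 1" using c by (auto simp: x0_def)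
    fix y z assume yz: "x0 \<le> y" "y \<le> z"
    have y1: "y \<ge> 1" using yz by (simp add: x0_def)
    define h where "h = y powr \<theta>"
    have h: "h > 0" using y1 by (simp add: h_def)
    define m where "m = nat \<lfloor>(z - y) / h\<rfloor>"
    define S where "S i = {j. (y + real i * h) - (y + real i * h) powr \<theta> < n j \<and> n j \<le> (y + real i * h) + (y + real i * h) powr \<theta>}" for i
    have sub: "{j. y \<le> n j \<and> n j \<le> z} \<subseteq> (\<Union>i\<in>{..m}. S i)"
    proof clarify
      fix j assume j: "y \<le> n j" "n j \<le> z"
      define i where "i = nat \<lfloor>(n j - y) / h\<rfloor>"
      have q: "(n j - y) / h \<ge> 0" using j h by simp
      have i1: "real i \<le> (n j - y) / h" "(n j - y) / h < real i + 1"
        unfolding i_def using q of_nat_floor[OF q] by (simp_all add: of_nat_nat)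
      have "(n j - y) / h \<le> (z - y) / h" using j h by (intro divide_right_mono) auto
      then have "i \<le> m" unfolding i_def m_def by (intro nat_mono floor_mono)
      have hle: "h \<le> (y + real i * h) powr \<theta>" unfolding h_def
        by (rule powr_mono2) (use theta y1 in auto)
      have "real i * h \<le> n j - y" "n j - y < real i * h + h"
        using i1 h by (simp_all add: field_simps)
      then have "j \<in> S i" using hle h unfolding S_def by auto
      then show "j \<in> (\<Union>i\<in>{..m}. S i)" using \<open>i \<le> m\<close> by blast
    qed
    have m: "real m \<le> (z - y) / h" unfolding m_def using yz h by (intro of_nat_floor) simp
    have Sc: "real (card (S i)) \<le> c * z powr (\<theta> + \<epsilon>)" if "i \<le> m" for i
    proof -
      have "real i * h \<le> real m * h" using that h by (intro mult_right_mono) auto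
      also have "\<dots> \<le> z - y" using m h by (simp add: field_simps)
      finally have le: "y + real i * h \<le> z" by simp
      have ge: "x0 \<le> y + real i * h" using yz h by (simp add: add_increasing2)
      have "real (card (S i)) \<le> c * (y + real i * h) powr (\<theta> + \<epsilon>)"
        unfolding S_def by (rule step[OF ge])
      also have "\<dots> \<le> c * z powr (\<theta> + \<epsilon>)"
        using c le theta e y1 h by (intro mult_left_mono powr_mono2) auto
      finally show ?thesis .
    qed
    have finS: "finite (S i)" for i
      unfolding S_def by (rule finite_subset[OF _ n_finite[of "(y + real i * h) + (y + real i * h) powr \<theta>"]]) auto
    have "card {j. y \<le> n j \<and> n j \<le> z} \<le> card (\<Union>i\<in>{..m}. S i)"
      by (intro card_mono sub finite_UN_I finS) auto
    also have "\<dots> \<le> (\<Sum>i\<le>m. card (S i))" by (rule card_UN_le) auto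
    finally have "real (card {j. y \<le> n j \<and> n j \<le> z}) \<le> (\<Sum>i\<le>m. real (card (S i)))"
      by (simp flip: of_nat_sum)
    also have "\<dots> \<le> (\<Sum>i\<le>m. c * z powr (\<theta> + \<epsilon>))" by (intro sum_mono Sc) auto
    also have "\<dots> = (real m + 1) * (c * z powr (\<theta> + \<epsilon>))" by simp
    also have "\<dots> \<le> ((z - y) / h + 1) * (c * z powr (\<theta> + \<epsilon>))"
      using m c by (intro mult_right_mono) auto
    finally show "real (card {j. y \<le> n j \<and> n j \<le> z}) \<le> c * ((z - y) / y powr \<theta> + 1) * z powr (\<theta> + \<epsilon>)"
      by (simp add: h_def mult_ac)
  qed
qed

lemma window_sub: "{j. \<bar>ln (n j) - ln x\<bar> \<le> \<eta>} = {j. x * exp (-\<eta>) \<le> n j \<and> n j \<le> x * exp \<eta>}"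
  if "x > 0"
proof -
  have "\<bar>ln (n j) - ln x\<bar> \<le> \<eta> \<longleftrightarrow> x * exp (-\<eta>) \<le> n j \<and> n j \<le> x * exp \<eta>" for j
  proof -
    have "\<bar>ln (n j) - ln x\<bar> \<le> \<eta> \<longleftrightarrow> ln x - \<eta> \<le> ln (n j) \<and> ln (n j) \<le> ln x + \<eta>" by auto
    also have "\<dots> \<longleftrightarrow> exp (ln x - \<eta>) \<le> exp (ln (n j)) \<and> exp (ln (n j)) \<le> exp (ln x + \<eta>)" by simp
    also have "\<dots> \<longleftrightarrow> x * exp (-\<eta>) \<le> n j \<and> n j \<le> x * exp \<eta>"
      using that n_pos[of j] by (simp add: exp_add exp_diff exp_minus divide_inverse)
    finally show ?thesis .
  qed
  then show ?thesis by auto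
qed

lemma window_finite: "x > 0 \<Longrightarrow> finite {j. \<bar>ln (n j) - ln x\<bar> \<le> \<eta>}"
  by (rule finite_subset[OF _ n_finite[of "x * exp \<eta>"]]) (auto simp: window_sub)

text \<open>A window of half-width \<eta> in the logarithm has length at most 2 \<eta> x exp \<eta>,
  to which \<open>cover_count\<close> applies. The losses exp \<eta> (length), exp(\<eta> \<theta>)
  (step at the lower end) and exp(\<eta> (\<theta> + \<epsilon>)) (count at the upper end) multiply
  to at most exp(4 \<eta>), since \<theta> and \<epsilon> are at most 1.\<close>

lemma window_count:
  assumes e: "\<epsilon> > 0" "\<epsilon> \<le> 1"
  obtains C where "C \<ge> 0" "\<And>x \<eta>. x \<ge> 1 \<Longrightarrow> \<eta> \<ge> 0 \<Longrightarrow>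
       real (card {j. \<bar>ln (n j) - ln x\<bar> \<le> \<eta>}) \<le> C * x powr \<epsilon> * exp (4 * \<eta>) * (\<eta> * x + x powr \<theta>)"
proof -
  obtain C x0 where C: "C \<ge> 0" "x0 \<ge> 1"
    "\<And>y z. x0 \<le> y \<Longrightarrow> y \<le> z \<Longrightarrow>
       real (card {j. y \<le> n j \<and> n j \<le> z}) \<le> C * ((z - y) / y powr \<theta> + 1) * z powr (\<theta> + \<epsilon>)"
    using cover_count[OF e(1)] by blast
  define K where "K = real (card {j. n j \<le> x0})"
  show ?thesis
  proof (rule that[of "2 * C + K"])
    show "2 * C + K \<ge> 0" using C by (simp add: K_def)
    fix x \<eta> :: real assume x: "x \<ge> 1" and eta: "\<eta> \<ge> 0"
    define z where "z = x * exp \<eta>"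
    \<comment> \<open>The covering bound starts at \<open>x0\<close>, so the lower end is cut off
      there; whatever lies below is counted by the constant \<open>K\<close>, and
      \<open>R \<ge> 1\<close> absorbs it.\<close>
    define y where "y = max (x * exp (-\<eta>)) x0"
    have W: "{j. \<bar>ln (n j) - ln x\<bar> \<le> \<eta>} \<subseteq> {j. n j \<le> x0} \<union> {j. y \<le> n j \<and> n j \<le> z}"
      using x by (auto simp: window_sub y_def z_def)
    have fin: "finite {j. y \<le> n j \<and> n j \<le> z}" by (rule finite_subset[OF _ n_finite[of z]]) auto
    have "card {j. \<bar>ln (n j) - ln x\<bar> \<le> \<eta>} \<le> card ({j. n j \<le> x0} \<union> {j. y \<le> n j \<and> n j \<le> z})"
      by (intro card_mono W finite_UnI n_finite fin)
    also have "\<dots> \<le> card {j. n j \<le> x0} + card {j. y \<le> n j \<and> n j \<le> z}" by (rule card_Un_le)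
    finally have 1: "real (card {j. \<bar>ln (n j) - ln x\<bar> \<le> \<eta>}) \<le> K + real (card {j. y \<le> n j \<and> n j \<le> z})"
      unfolding K_def by linarith
    define R where "R = x powr \<epsilon> * exp (4 * \<eta>) * (\<eta> * x + x powr \<theta>)"
    have R1: "R \<ge> 1"
    proof -
      have "1 * 1 * 1 \<le> R" unfolding R_def
        using x eta theta e by (intro mult_mono) (auto simp: ge_one_powr_ge_zero add_increasing)
      then show ?thesis by simp
    qed
    have 2: "real (card {j. y \<le> n j \<and> n j \<le> z}) \<le> 2 * C * R"
    proof (cases "y \<le> z")
      case False
      then have "{j. y \<le> n j \<and> n j \<le> z} = {}" by auto
      then have "card {j. y \<le> n j \<and> n j \<le> z} = 0" by (simp only: card.empty)
      then show ?thesis using C R1 by simp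
    next
      case True
      have y0: "y > 0" using C by (simp add: y_def)
      have "z - y \<le> x * (exp \<eta> - exp (-\<eta>))" by (simp add: z_def y_def algebra_simps)
      also have "\<dots> \<le> x * (2 * \<eta> * exp \<eta>)" using x by (intro mult_left_mono exp_diff_le) auto
      finally have zy: "z - y \<le> 2 * x * \<eta> * exp \<eta>" by simp
      have "(x * exp (-\<eta>)) powr \<theta> \<le> y powr \<theta>"
        using theta x by (intro powr_mono2) (auto simp: y_def)
      then have yt: "x powr \<theta> * exp (- \<eta> * \<theta>) \<le> y powr \<theta>"
        using x by (simp add: powr_mult exp_powr_real)
      have "(z - y) / y powr \<theta> \<le> (2 * x * \<eta> * exp \<eta>) / (x powr \<theta> * exp (- \<eta> * \<theta>))"
        using zy yt x eta y0 True by (intro frac_le) auto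
      also have "\<dots> = 2 * (x powr (- \<theta>) * (x * \<eta>)) * (exp \<eta> * exp (\<eta> * \<theta>))"
        by (simp add: powr_minus field_simps exp_minus)
      also have "exp \<eta> * exp (\<eta> * \<theta>) = exp (\<eta> + \<eta> * \<theta>)" by (simp add: exp_add)
      finally have a: "(z - y) / y powr \<theta> \<le> 2 * (x powr (- \<theta>) * (x * \<eta>)) * exp (\<eta> + \<eta> * \<theta>)" .
      have zt: "z powr (\<theta> + \<epsilon>) = x powr \<theta> * x powr \<epsilon> * exp (\<eta> * (\<theta> + \<epsilon>))"
        using x by (simp add: z_def powr_mult exp_powr_real powr_add distrib_left exp_add)
      have et: "\<eta> * \<theta> \<le> \<eta>" "\<eta> * \<epsilon> \<le> \<eta>" using eta theta e by (simp_all add: mult_left_le)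
      have "((z - y) / y powr \<theta> + 1) * z powr (\<theta> + \<epsilon>) \<le>
          (2 * (x powr (- \<theta>) * (x * \<eta>)) * exp (\<eta> + \<eta> * \<theta>) + 1) * (x powr \<theta> * x powr \<epsilon> * exp (\<eta> * (\<theta> + \<epsilon>)))"
        unfolding zt using a by (intro mult_right_mono) auto
      also have "\<dots> = 2 * (x powr (- \<theta>) * x powr \<theta>) * (x * \<eta>) * x powr \<epsilon> * exp (\<eta> + \<eta> * \<theta> + \<eta> * (\<theta> + \<epsilon>))
           + x powr \<theta> * x powr \<epsilon> * exp (\<eta> * (\<theta> + \<epsilon>))"
        unfolding exp_add[of "\<eta> + \<eta> * \<theta>"] distrib_right mult_1 by (simp only: mult_ac)
      also have "x powr (- \<theta>) * x powr \<theta> = 1" using x by (simp flip: powr_add)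
      also have "2 * 1 * (x * \<eta>) * x powr \<epsilon> * exp (\<eta> + \<eta> * \<theta> + \<eta> * (\<theta> + \<epsilon>))
           + x powr \<theta> * x powr \<epsilon> * exp (\<eta> * (\<theta> + \<epsilon>)) \<le>
          2 * 1 * (x * \<eta>) * x powr \<epsilon> * exp (4 * \<eta>) + 2 * x powr \<theta> * x powr \<epsilon> * exp (4 * \<eta>)"
      proof (intro add_mono mult_mono)
        show "exp (\<eta> + \<eta> * \<theta> + \<eta> * (\<theta> + \<epsilon>)) \<le> exp (4 * \<eta>)" "exp (\<eta> * (\<theta> + \<epsilon>)) \<le> exp (4 * \<eta>)"
          unfolding exp_le_cancel_iff distrib_left using et eta by linarith+
        show "x powr \<theta> \<le> 2 * x powr \<theta>" using x by simp
      qed (use eta x in auto)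
      also have "\<dots> = 2 * R" by (simp add: R_def algebra_simps)
      finally have "((z - y) / y powr \<theta> + 1) * z powr (\<theta> + \<epsilon>) \<le> 2 * R" .
      moreover have "real (card {j. y \<le> n j \<and> n j \<le> z}) \<le> C * (((z - y) / y powr \<theta> + 1) * z powr (\<theta> + \<epsilon>))"
        using C(3)[of y z] True by (simp add: y_def mult.assoc)
      ultimately show ?thesis using mult_left_mono[OF _ C(1), of "((z - y) / y powr \<theta> + 1) * z powr (\<theta> + \<epsilon>)" "2 * R"] by simp
    qed
    have "real (card {j. \<bar>ln (n j) - ln x\<bar> \<le> \<eta>}) \<le> K * 1 + 2 * C * R" using 1 2 by simp
    also have "\<dots> \<le> K * R + 2 * C * R" using R1 C(1) by (intro add_mono mult_left_mono) (auto simp: K_def)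
    finally show "real (card {j. \<bar>ln (n j) - ln x\<bar> \<le> \<eta>}) \<le> (2 * C + K) * x powr \<epsilon> * exp (4 * \<eta>) * (\<eta> * x + x powr \<theta>)"
      by (simp add: R_def algebra_simps)
  qed
qed

lemma spaced_n: "spaced \<theta> n"
  unfolding spaced_def
proof (intro allI impI)
  fix \<epsilon> :: real assume e: "\<epsilon> > 0" "\<epsilon> \<le> 1"
  obtain C where C: "C \<ge> 0" "\<And>x \<eta>. x \<ge> 1 \<Longrightarrow> \<eta> \<ge> 0 \<Longrightarrow>
       real (card {j. \<bar>ln (n j) - ln x\<bar> \<le> \<eta>}) \<le> C * x powr \<epsilon> * exp (4 * \<eta>) * (\<eta> * x + x powr \<theta>)"
    using window_count[OF e] by blast
  have "C * x powr \<epsilon> * exp (4 * \<eta>) * (\<eta> * x + x powr \<theta>) \<le> C * x powr \<epsilon> * exp (6 * \<eta>) * (\<eta> * x + x powr \<theta>)"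
    if "x \<ge> 1" "\<eta> \<ge> 0" for x \<eta>
    using that C by (intro mult_mono mult_right_mono mult_left_mono) auto
  then have "real (card {j. \<bar>ln (n j) - ln x\<bar> \<le> \<eta>}) \<le> C * x powr \<epsilon> * exp (6 * \<eta>) * (\<eta> * x + x powr \<theta>)"
    if "x \<ge> 1" "\<eta> \<ge> 0" for x \<eta>
    using C(2)[OF that] that order_trans by blast
  then show "\<exists>C\<ge>0. \<forall>x\<ge>1. \<forall>\<eta>\<ge>0. finite {i. \<bar>ln (n i) - ln x\<bar> \<le> \<eta>} \<and>
     real (card {i. \<bar>ln (n i) - ln x\<bar> \<le> \<eta>}) \<le> C * x powr \<epsilon> * exp (6 * \<eta>) * (\<eta> * x + x powr \<theta>)"
    using C(1) window_finite by (intro exI[of _ C]) auto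
qed

text \<open>Dyadic induction: the window of half-width ln 2 about z covers [z/2, z], and (z/2)^(1 +
  \<epsilon>) is at most z^(1 + \<epsilon>)/2. Hence K/2 + C1 is at most K once K is at least 2 C1,
  and the induction closes.\<close>

lemma counting_bound:
  assumes e: "\<epsilon> > 0" "\<epsilon> \<le> 1"
  obtains K where "K > 0" "\<And>z. z \<ge> 1 \<Longrightarrow> real (card {j. n j \<le> z}) \<le> K * z powr (1 + \<epsilon>)"
proof -
  obtain C where C: "C \<ge> 0" "\<And>x \<eta>. x \<ge> 1 \<Longrightarrow> \<eta> \<ge> 0 \<Longrightarrow>
       real (card {j. \<bar>ln (n j) - ln x\<bar> \<le> \<eta>}) \<le> C * x powr \<epsilon> * exp (4 * \<eta>) * (\<eta> * x + x powr \<theta>)"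
    using window_count[OF e] by blast
  define C1 where "C1 = 2 * C * exp (4 * ln 2)"
  have C1: "C1 \<ge> 0" using C by (simp add: C1_def)
  have dy: "real (card {j. z / 2 \<le> n j \<and> n j \<le> z}) \<le> C1 * z powr (1 + \<epsilon>)" if z: "z \<ge> 1" for z
  proof -
    have fin: "finite {j. \<bar>ln (n j) - ln z\<bar> \<le> ln 2}" using window_finite[of z] z by simp
    have "card {j. z / 2 \<le> n j \<and> n j \<le> z} \<le> card {j. \<bar>ln (n j) - ln z\<bar> \<le> ln 2}"
      by (rule card_mono[OF fin]) (use z in \<open>auto simp: window_sub exp_minus field_simps\<close>)
    then have "real (card {j. z / 2 \<le> n j \<and> n j \<le> z}) \<le> real (card {j. \<bar>ln (n j) - ln z\<bar> \<le> ln 2})" by simp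
    also have "\<dots> \<le> C * z powr \<epsilon> * exp (4 * ln 2) * (ln 2 * z + z powr \<theta>)" by (intro C z) auto
    also have "\<dots> \<le> C * z powr \<epsilon> * exp (4 * ln 2) * (1 * z + z powr 1)"
      using z C theta ln_2_less_1 by (intro mult_left_mono add_mono mult_right_mono powr_mono) auto
    also have "\<dots> = C1 * z powr (1 + \<epsilon>)" using z by (simp add: C1_def powr_add)
    finally show ?thesis .
  qed
  define K where "K = 2 * C1 + real (card {j. n j \<le> 2}) + 1"
  have K: "K > 0" using C1 by (simp add: K_def)
  have main: "real (card {j. n j \<le> z}) \<le> K * z powr (1 + \<epsilon>)" if "1 \<le> z" "z \<le> 2 ^ m" for m z
    using that
  proof (induction m arbitrary: z)
    case base: 0
    then have "z = 1" by simp
    have "card {j. n j \<le> 1} \<le> card {j. n j \<le> 2}" by (intro card_mono n_finite) auto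
    then have "real (card {j. n j \<le> 1}) \<le> K" using C1 unfolding K_def by linarith
    then show ?case using \<open>z = 1\<close> by simp
  next
    case (Suc m)
    show ?case
    proof (cases "z \<le> 2")
      case True
      have "card {j. n j \<le> z} \<le> card {j. n j \<le> 2}" by (intro card_mono n_finite) (use True in auto)
      then have "real (card {j. n j \<le> z}) \<le> real (card {j. n j \<le> 2})" by simp
      also have "\<dots> \<le> K * 1" using C1 unfolding K_def by simp
      finally have "real (card {j. n j \<le> z}) \<le> K * 1" .
      also have "\<dots> \<le> K * z powr (1 + \<epsilon>)" using K Suc e by (intro mult_left_mono ge_one_powr_ge_zero) auto
      finally show ?thesis .
    next
      case False
      have "{j. n j \<le> z} \<subseteq> {j. n j \<le> z / 2} \<union> {j. z / 2 \<le> n j \<and> n j \<le> z}" by auto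
      then have "card {j. n j \<le> z} \<le> card ({j. n j \<le> z / 2} \<union> {j. z / 2 \<le> n j \<and> n j \<le> z})"
        by (intro card_mono finite_UnI n_finite) (auto intro: finite_subset[OF _ n_finite[of z]])
      also have "\<dots> \<le> card {j. n j \<le> z / 2} + card {j. z / 2 \<le> n j \<and> n j \<le> z}" by (rule card_Un_le)
      finally have "real (card {j. n j \<le> z}) \<le> real (card {j. n j \<le> z / 2}) + real (card {j. z / 2 \<le> n j \<and> n j \<le> z})"
        by linarith
      also have "\<dots> \<le> K * (z / 2) powr (1 + \<epsilon>) + C1 * z powr (1 + \<epsilon>)"
        using Suc False by (intro add_mono Suc.IH dy) auto
      also have "(z / 2) powr (1 + \<epsilon>) \<le> z powr (1 + \<epsilon>) / 2"
      proof -
        have "(2::real) powr 1 \<le> 2 powr (1 + \<epsilon>)" using e by (intro powr_mono) auto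
        then show ?thesis using False by (simp add: powr_divide field_simps mult_left_mono)
      qed
      also have "K * (z powr (1 + \<epsilon>) / 2) + C1 * z powr (1 + \<epsilon>) = (K / 2 + C1) * z powr (1 + \<epsilon>)"
        by (simp add: algebra_simps)
      also have "\<dots> \<le> K * z powr (1 + \<epsilon>)" by (intro mult_right_mono) (auto simp: K_def)
      finally show ?thesis using K by (simp add: mult_left_mono)
    qed
  qed
  show ?thesis
  proof (rule that[OF K])
    fix z :: real assume "z \<ge> 1"
    moreover obtain m where "z < 2 ^ m" using real_arch_pow[of 2 z] by auto
    ultimately show "real (card {j. n j \<le> z}) \<le> K * z powr (1 + \<epsilon>)" using main[of z m] by simp
  qed
qed

text \<open>Monotonicity turns the counting bound into j + 1 \<le> K (n_j)^(1 + \<epsilon>), so the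
  terms are dominated by a p-series with exponent \<sigma>/(1 + \<epsilon>) > 1.\<close>

lemma summable_n:
  assumes s: "\<sigma> > 1"
  shows "summable (\<lambda>j. n j powr (- \<sigma>))"
proof -
  define \<epsilon> where "\<epsilon> = min 1 ((\<sigma> - 1) / 2)"
  have e: "\<epsilon> > 0" "\<epsilon> \<le> 1" "1 + \<epsilon> < \<sigma>" using s by (auto simp: \<epsilon>_def min_def field_simps)
  obtain K where K: "K > 0" "\<And>z. z \<ge> 1 \<Longrightarrow> real (card {j. n j \<le> z}) \<le> K * z powr (1 + \<epsilon>)"
    using counting_bound[OF e(1,2)] by blast
  define \<tau> where "\<tau> = \<sigma> / (1 + \<epsilon>)"
  have tau: "\<tau> > 1" using e by (simp add: \<tau>_def field_simps)
  have bound: "n j powr (- \<sigma>) \<le> K powr \<tau> * real (j + 1) powr (- \<tau>)" for j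
  proof -
    have "card {..j} \<le> card {i. n i \<le> n j}" by (intro card_mono n_finite) (auto intro: n_mono)
    then have "real (j + 1) \<le> K * n j powr (1 + \<epsilon>)" using K(2)[OF n_ge1[of j]] by simp
    then have le: "real (j + 1) / K \<le> n j powr (1 + \<epsilon>)" using K(1) by (simp add: field_simps)
    have "n j powr (- \<sigma>) = (n j powr (1 + \<epsilon>)) powr (- \<tau>)"
      using e by (simp add: powr_powr \<tau>_def)
    also have "\<dots> \<le> (real (j + 1) / K) powr (- \<tau>)"
      using le K(1) tau n_pos[of j] by (intro powr_mono2') auto
    also have "\<dots> = K powr \<tau> * real (j + 1) powr (- \<tau>)"
      using K(1) by (simp add: powr_divide powr_minus field_simps)
    finally show ?thesis .
  qed
  have "summable (\<lambda>j. real (Suc j) powr (- \<tau>))"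
    by (subst summable_Suc_iff) (use tau in \<open>simp add: summable_real_powr_iff\<close>)
  then have "summable (\<lambda>j. K powr \<tau> * real (j + 1) powr (- \<tau>))" by (intro summable_mult) simp
  then show ?thesis
    by (rule summable_comparison_test'[where N = 0]) (use bound in auto)
qed

end

section \<open>The divisor bound and the spacing of products of two generalized integers\<close>

lemma card_submultisets_le:
  "finite {N. N \<subseteq># M} \<and> card {N. N \<subseteq># M} \<le> (\<Prod>i\<in>set_mset M. count M i + 1)"
proof -
  let ?P = "PiE (set_mset M) (\<lambda>i. {..count M i})"
  have fin: "finite ?P" by (intro finite_PiE) auto
  have sub: "(\<lambda>N. restrict (count N) (set_mset M)) ` {N. N \<subseteq># M} \<subseteq> ?P"
    by (auto simp: PiE_iff mset_subset_eq_count)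
  have inj: "inj_on (\<lambda>N. restrict (count N) (set_mset M)) {N. N \<subseteq># M}"
  proof (rule inj_onI)
    fix N N' assume H: "N \<in> {N. N \<subseteq># M}" "N' \<in> {N. N \<subseteq># M}"
      "restrict (count N) (set_mset M) = restrict (count N') (set_mset M)"
    show "N = N'"
    proof (rule multiset_eqI)
      fix i show "count N i = count N' i"
      proof (cases "i \<in># M")
        case True then show ?thesis using fun_cong[OF H(3), of i] by simp
      next
        case False
        then have "i \<notin># N" "i \<notin># N'" using H by (auto dest: mset_subset_eqD)
        then show ?thesis by (simp add: not_in_iff)
      qed
    qed
  qed
  show ?thesis
    using card_inj_on_le[OF inj sub fin] finite_imageD[OF finite_subset[OF sub fin] inj]
    by (simp add: card_PiE)
qed

context beurling_system
begin

text \<open>Submultisets are formal divisors, so their number is at most the product of k_i + 1 over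
  the exponents k_i. For p_i \<ge> 2^(1/\<epsilon>) the factor is at most 2^k \<le> p_i^(\<epsilon>
  k) without loss; the finitely many smaller primes each cost a factor \<open>c\<close>, in total at
  most \<open>c ^ I\<close>.\<close>

lemma divisor_bound:
  assumes e: "\<epsilon> > 0"
  obtains C where "C > 0"
    "\<And>M. real (card {N. N \<subseteq># M}) \<le> C * (\<Prod>i\<in>#M. p i) powr \<epsilon>"
proof -
  have p1: "1 < p 0" "\<And>i. p 0 \<le> p i" "filterlim p at_top sequentially"
    using integers by (auto simp: beurling_integers_def beurling_primes_def mono_def)
  have pp: "p i > 0" "p i > 1" for i using p1(1) p1(2)[of i] by linarith+
  have "eventually (\<lambda>i. 2 powr (1 / \<epsilon>) \<le> p i) sequentially"
    using p1(3) by (auto simp: filterlim_at_top)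
  then obtain I where I: "\<And>i. I \<le> i \<Longrightarrow> 2 powr (1 / \<epsilon>) \<le> p i" by (auto simp: eventually_sequentially)
  define L where "L = \<epsilon> * ln (p 0)"
  have L: "L > 0" using e p1 by (simp add: L_def)
  \<comment> \<open>With exp L = p_0^\<epsilon>, both 1 and k L are at most exp(k L); hence k + 1
    \<le> (1 + 1/L) exp(k L), and p_0 is the worst prime.\<close>
  define c where "c = 1 + 1 / L"
  have c1: "c \<ge> 1" using L by (simp add: c_def)
  have small: "real k + 1 \<le> c * p i powr (\<epsilon> * real k)" for i k
  proof -
    have "p i powr (\<epsilon> * real k) = exp (real k * (\<epsilon> * ln (p i)))" using pp[of i] by (simp add: powr_def mult_ac)
    also have "\<dots> \<ge> exp (real k * L)"
      using p1 pp e by (auto simp: L_def intro!: mult_left_mono)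
    finally have 1: "exp (real k * L) \<le> p i powr (\<epsilon> * real k)" .
    have "1 + real k * L \<le> exp (real k * L)" by (rule exp_ge_add_one_self)
    moreover have "exp (real k * L) \<ge> 1" using L by simp
    ultimately have "real k + 1 \<le> (1 / L) * exp (real k * L) + exp (real k * L)"
      using L by (intro add_mono) (auto simp: field_simps intro: order_trans[of _ "1 + L * real k"])
    also have "\<dots> = c * exp (real k * L)" by (simp add: c_def algebra_simps)
    also have "\<dots> \<le> c * p i powr (\<epsilon> * real k)" using 1 c1 by (intro mult_left_mono) auto
    finally show ?thesis .
  qed
  have large: "real k + 1 \<le> p i powr (\<epsilon> * real k)" if "I \<le> i" for i k
  proof -
    have "real k + 1 \<le> 2 ^ k" by (induction k) auto
    also have "\<dots> = (2 powr (1 / \<epsilon>)) powr (\<epsilon> * real k)" using e by (simp add: powr_powr powr_realpow)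
    also have "\<dots> \<le> p i powr (\<epsilon> * real k)" using I[OF that] e by (intro powr_mono2) auto
    finally show ?thesis .
  qed
  show ?thesis
  proof (rule that[of "c ^ I"])
    show "c ^ I > 0" using c1 by simp
    fix M :: "nat multiset"
    have "real (card {N. N \<subseteq># M}) \<le> real (\<Prod>i\<in>set_mset M. count M i + 1)"
      using card_submultisets_le[of M] of_nat_le_iff by blast
    also have "\<dots> = (\<Prod>i\<in>set_mset M. real (count M i) + 1)" by (simp add: add.commute)
    also have "\<dots> \<le> (\<Prod>i\<in>set_mset M. (if i < I then c else 1) * p i powr (\<epsilon> * real (count M i)))"
      using small large by (intro prod_mono) auto
    also have "\<dots> = (\<Prod>i\<in>set_mset M. if i < I then c else 1) * (\<Prod>i\<in>set_mset M. p i ^ count M i) powr \<epsilon>"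
    proof -
      have "(\<Prod>i\<in>A. p i ^ count M i) powr \<epsilon> = (\<Prod>i\<in>A. p i powr (\<epsilon> * real (count M i)))" if "finite A" for A
        using that by induction (use pp in \<open>auto simp: powr_mult prod_nonneg less_imp_le powr_realpow[symmetric] powr_powr mult_ac\<close>)
      then show ?thesis by (simp add: prod.distrib)
    qed
    also have "\<dots> \<le> c ^ I * (\<Prod>i\<in>set_mset M. p i ^ count M i) powr \<epsilon>"
    proof (intro mult_right_mono)
      have "(\<Prod>i\<in>set_mset M. if i < I then c else 1) = (\<Prod>i\<in>{i\<in>set_mset M. i < I}. c)"
        by (subst prod.inter_filter) auto
      also have "\<dots> = c ^ card {i\<in>set_mset M. i < I}" by simp
      also have "\<dots> \<le> c ^ I"
      proof (rule power_increasing[OF _ c1])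
        have "card {i\<in>set_mset M. i < I} \<le> card {..<I}" by (intro card_mono) auto
        then show "card {i\<in>set_mset M. i < I} \<le> I" by simp
      qed
      finally show "(\<Prod>i\<in>set_mset M. if i < I then c else 1) \<le> c ^ I" .
    qed auto
    finally show "real (card {N. N \<subseteq># M}) \<le> c ^ I * (\<Prod>i\<in>#M. p i) powr \<epsilon>"
      by (simp add: image_prod_mset_multiplicity)
  qed
qed

text \<open>Grouping pairs by their formal product maps them to generalized integers. The fibre over
  l embeds into the formal divisors of l, because one factor determines the other, so it has size
  O(n_l^(\<epsilon>/2)). The fibre bound costs a further exp \<eta> on top of exp(4 \<eta>), which
  explains the room left in the exponent 6 of \<open>spaced\<close>.\<close>

lemma spaced_pairs: "spaced \<theta> (\<lambda>(j, k). n j * n k)"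
  unfolding spaced_def
proof (intro allI impI)
  fix \<epsilon> :: real assume e: "\<epsilon> > 0" "\<epsilon> \<le> 1"
  obtain E :: "nat \<Rightarrow> nat multiset" where E: "bij E" "\<And>j. n j = (\<Prod>i\<in>#E j. p i)"
    using integers by (auto simp: beurling_integers_def)
  \<comment> \<open>Products are formed on multisets of prime indices and not on real values, so
    unique factorization holds for \<open>m\<close> even if different products coincide as
    reals.\<close>
  define m where "m = (\<lambda>(j, k). inv E (E j + E k))"
  have Em: "E (m (j, k)) = E j + E k" for j k
    using E(1) by (simp add: m_def bij_is_surj surj_f_inv_f)
  have nm: "n (m (j, k)) = n j * n k" for j k
    by (simp add: E(2)[of "m (j,k)"] Em) (simp add: E(2))
  have e2: "\<epsilon> / 2 > 0" "\<epsilon> / 2 \<le> 1" using e by auto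
  obtain C where C: "C \<ge> 0" "\<And>x \<eta>. x \<ge> 1 \<Longrightarrow> \<eta> \<ge> 0 \<Longrightarrow>
       real (card {j. \<bar>ln (n j) - ln x\<bar> \<le> \<eta>}) \<le> C * x powr (\<epsilon>/2) * exp (4 * \<eta>) * (\<eta> * x + x powr \<theta>)"
    using window_count[OF e2] by blast
  obtain D where D: "D > 0" "\<And>M. real (card {N. N \<subseteq># M}) \<le> D * (\<Prod>i\<in>#M. p i) powr (\<epsilon>/2)"
    using divisor_bound[OF e2(1)] by blast
  have fibre: "finite {jk. m jk = l} \<and> card {jk. m jk = l} \<le> card {N. N \<subseteq># E l}" for l
  proof -
    have inj: "inj_on (\<lambda>jk. E (fst jk)) {jk. m jk = l}"
    proof (rule inj_onI, clarify)
      fix j k j' k' assume H: "l = m (j, k)" "m (j', k') = m (j, k)" "E (fst (j, k)) = E (fst (j', k'))"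
      then have "E j' + E k' = E j + E k" by (metis Em)
      with H have "E k' = E k" by simp
      with H show "j = j' \<and> k = k'" using E(1) by (simp add: bij_def inj_eq)
    qed
    have sub: "(\<lambda>jk. E (fst jk)) ` {jk. m jk = l} \<subseteq> {N. N \<subseteq># E l}"
      by (auto simp: Em)
    show ?thesis
      using card_inj_on_le[OF inj sub] card_submultisets_le[of "E l"]
        finite_imageD[OF finite_subset[OF sub] inj] by simp
  qed
  have main: "finite {jk. \<bar>ln ((\<lambda>(j, k). n j * n k) jk) - ln x\<bar> \<le> \<eta>} \<and>
      real (card {jk. \<bar>ln ((\<lambda>(j, k). n j * n k) jk) - ln x\<bar> \<le> \<eta>})
       \<le> (C * D) * x powr \<epsilon> * exp (6 * \<eta>) * (\<eta> * x + x powr \<theta>)"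
    if x: "x \<ge> 1" and eta: "\<eta> \<ge> 0" for x \<eta>
  proof -
    let ?W = "{j. \<bar>ln (n j) - ln x\<bar> \<le> \<eta>}"
    have fW: "finite ?W" using window_finite x by simp
    have eq: "{jk. \<bar>ln ((\<lambda>(j, k). n j * n k) jk) - ln x\<bar> \<le> \<eta>} = (\<Union>l\<in>?W. {jk. m jk = l})"
      by (auto simp: nm)
    have fin: "finite (\<Union>l\<in>?W. {jk. m jk = l})" using fW fibre by blast
    have lW: "real (card {jk. m jk = l}) \<le> D * (x powr (\<epsilon>/2) * exp \<eta>)" if "l \<in> ?W" for l
    proof -
      have nl: "n l \<le> x * exp \<eta>" using that x by (simp add: window_sub)
      have "real (card {jk. m jk = l}) \<le> D * n l powr (\<epsilon>/2)"
        using fibre[of l] D(2)[of "E l"] unfolding E(2)[of l] by linarith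
      also have "n l powr (\<epsilon>/2) \<le> (x * exp \<eta>) powr (\<epsilon>/2)" using nl n_pos[of l] e by (intro powr_mono2) auto
      also have "\<dots> = x powr (\<epsilon>/2) * exp (\<eta> * (\<epsilon>/2))" using x by (simp add: powr_mult exp_powr_real)
      also have "exp (\<eta> * (\<epsilon>/2)) \<le> exp \<eta>" using mult_left_mono[of "\<epsilon>/2" 1 \<eta>] eta e by simp
      finally show ?thesis using D(1) x by (simp add: mult_left_mono)
    qed
    have "card (\<Union>l\<in>?W. {jk. m jk = l}) \<le> (\<Sum>l\<in>?W. card {jk. m jk = l})" by (rule card_UN_le[OF fW])
    then have "real (card (\<Union>l\<in>?W. {jk. m jk = l})) \<le> (\<Sum>l\<in>?W. real (card {jk. m jk = l}))"
      by (simp flip: of_nat_sum)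
    also have "\<dots> \<le> (\<Sum>l\<in>?W. D * (x powr (\<epsilon>/2) * exp \<eta>))" by (intro sum_mono lW)
    also have "\<dots> = real (card ?W) * (D * (x powr (\<epsilon>/2) * exp \<eta>))" by simp
    also have "\<dots> \<le> (C * x powr (\<epsilon>/2) * exp (4 * \<eta>) * (\<eta> * x + x powr \<theta>)) * (D * (x powr (\<epsilon>/2) * exp \<eta>))"
      using D(1) by (intro mult_right_mono C x eta) auto
    also have "\<dots> = C * D * (x powr (\<epsilon>/2) * x powr (\<epsilon>/2)) * exp (4 * \<eta> + \<eta>) * (\<eta> * x + x powr \<theta>)"
      unfolding exp_add by (simp only: mult_ac)
    also have "x powr (\<epsilon>/2) * x powr (\<epsilon>/2) = x powr \<epsilon>" by (simp flip: powr_add)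
    also have "C * D * x powr \<epsilon> * exp (4 * \<eta> + \<eta>) * (\<eta> * x + x powr \<theta>) \<le> C * D * x powr \<epsilon> * exp (6 * \<eta>) * (\<eta> * x + x powr \<theta>)"
      using C D eta x by (intro mult_right_mono mult_left_mono) auto
    finally show ?thesis unfolding eq using fin by simp
  qed
  show "\<exists>C\<ge>0. \<forall>x\<ge>1. \<forall>\<eta>\<ge>0. finite {i. \<bar>ln ((\<lambda>(j, k). n j * n k) i) - ln x\<bar> \<le> \<eta>} \<and>
     real (card {i. \<bar>ln ((\<lambda>(j, k). n j * n k) i) - ln x\<bar> \<le> \<eta>}) \<le> C * x powr \<epsilon> * exp (6 * \<eta>) * (\<eta> * x + x powr \<theta>)"
    using main C D by (intro exI[of _ "C * D"]) auto
qed

end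

section \<open>Counting zeros in discs\<close>

text \<open>Zeros are divided out one at a time. The quotient is glued from two formulas that agree
  on the overlap: near \<open>a\<close> the local factor \<open>u / Q\<close>, elsewhere
  \<open>g z / (z - a) ^ n\<close>. The disc has to avoid the other points of \<open>Z\<close>, so
  that \<open>Q\<close> does not vanish there.\<close>

lemma factor_zeros:
  assumes S: "open S" "connected S" and f: "f holomorphic_on S" and nz: "w \<in> S" "f w \<noteq> 0"
    and Z: "finite Z" "Z \<subseteq> S"
  shows "\<exists>g. g holomorphic_on S \<and> (\<forall>z\<in>S. f z = g z * (\<Prod>a\<in>Z. (z - a) ^ nat (zorder f a)))"
  using Z
proof (induction Z)
  case empty
  show ?case using f by (intro exI[of _ f]) auto
next
  case (insert a Z)
  then obtain g where g: "g holomorphic_on S"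
    "\<And>z. z \<in> S \<Longrightarrow> f z = g z * (\<Prod>a\<in>Z. (z - a) ^ nat (zorder f a))" by auto
  define Q where "Q z = (\<Prod>a\<in>Z. (z - a) ^ nat (zorder f a))" for z
  define n where "n = nat (zorder f a)"
  define u where "u = zor_poly f a"
  have aS: "a \<in> S" using insert by simp
  obtain r where r: "r > 0" "cball a r \<subseteq> S" "u holomorphic_on cball a r"
    "\<And>w. w \<in> cball a r \<Longrightarrow> f w = u w * (w - a) ^ n"
    using zorder_exist_zero[OF f S aS] nz unfolding u_def n_def by blast
  obtain e where e: "e > 0" "\<And>x. x \<in> Z \<Longrightarrow> x \<noteq> a \<Longrightarrow> e \<le> dist a x"
    using finite_set_avoid[OF insert(1), of a] by blast
  define d where "d = min r e"
  have d: "d > 0" using r e by (simp add: d_def)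
  have Q0: "Q z \<noteq> 0" if "z \<in> ball a d" for z
    using that e(2) insert.hyps by (force simp: Q_def d_def)
  have Qh: "Q holomorphic_on A" for A unfolding Q_def by (intro holomorphic_intros)
  define h where "h z = (if z \<in> ball a d then u z / Q z else g z / (z - a) ^ n)" for z
  have eq: "h z = g z / (z - a) ^ n" if "z \<in> S - {a}" for z
  proof (cases "z \<in> ball a d")
    case True
    then have "u z * (z - a) ^ n = g z * Q z"
      using r(4)[of z] g(2)[of z] that by (auto simp: d_def Q_def)
    then show ?thesis using True Q0[OF True] that by (simp add: h_def field_simps)
  qed (simp add: h_def)
  have "h holomorphic_on ball a d"
  proof -
    have "(\<lambda>z. u z / Q z) holomorphic_on ball a d"
      by (intro holomorphic_on_divide Qh holomorphic_on_subset[OF r(3)]) (use Q0 in \<open>auto simp: d_def\<close>)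
    then show ?thesis by (subst holomorphic_cong[OF refl, of _ h "\<lambda>z. u z / Q z"]) (auto simp: h_def)
  qed
  moreover have "h holomorphic_on (S - {a})"
  proof -
    have "(\<lambda>z. g z / (z - a) ^ n) holomorphic_on (S - {a})"
      by (intro holomorphic_intros holomorphic_on_subset[OF g(1)]) auto
    then show ?thesis using holomorphic_cong[OF refl, of "S - {a}" h "\<lambda>z. g z / (z - a) ^ n"] eq by auto
  qed
  ultimately have "h holomorphic_on (ball a d \<union> (S - {a}))"
    by (intro holomorphic_on_Un) (use S in auto)
  then have hS: "h holomorphic_on S" by (rule holomorphic_on_subset) (use d in auto)
  have "f z = h z * ((z - a) ^ n * Q z)" if "z \<in> S" for z
  proof (cases "z = a")
    case True
    then show ?thesis using r(4)[of a] r(1) Q0[of a] d by (simp add: h_def)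
  next
    case False
    then show ?thesis using eq[of z] g(2)[OF that] that by (simp add: Q_def)
  qed
  then show ?case using hS insert.hyps by (intro exI[of _ h]) (auto simp: Q_def n_def)
qed

text \<open>Jensen's inequality in multiplicative form. Each factor z - a is replaced by (R^2 -
  cnj(a - c)(z - c))/R, which has the same modulus on the circle of radius R but the value R at the
  centre, where z - a has modulus at most r. The maximum principle for the modified function gives
  R/r per zero.\<close>

lemma jensen_bound:
  assumes R: "0 < r" "r < R" "R < R'" and f: "f holomorphic_on ball c R'" "f c \<noteq> 0"
    and M: "\<And>z. dist c z = R \<Longrightarrow> norm (f z) \<le> M"
    and Z: "finite Z" "Z \<subseteq> cball c r"
  shows "(R / r) ^ (\<Sum>a\<in>Z. nat (zorder f a)) * norm (f c) \<le> M"
proof -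
  define m where "m a = nat (zorder f a)" for a
  obtain g where g: "g holomorphic_on ball c R'" "\<And>z. z \<in> ball c R' \<Longrightarrow> f z = g z * (\<Prod>a\<in>Z. (z - a) ^ m a)"
    using factor_zeros[OF _ _ f(1) _ f(2) Z(1)] R Z(2) unfolding m_def by force
  define h where "h z = g z * (\<Prod>a\<in>Z. ((of_real (R\<^sup>2) - cnj (a - c) * (z - c)) / of_real R) ^ m a)" for z
  have hh: "h holomorphic_on ball c R'" unfolding h_def using R by (intro holomorphic_intros g) auto
  have bd: "norm (h z) \<le> M" if "dist c z = R" for z
  proof -
    have w: "norm (z - c) = R" using that by (simp add: dist_norm norm_minus_commute)
    have "norm ((of_real (R\<^sup>2) - cnj (a - c) * (z - c)) / of_real R) = norm (z - a)" for a
    proof -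
      have "of_real (R\<^sup>2) = (z - c) * cnj (z - c)" using w complex_norm_square[of "z - c"] by (simp add: mult.commute)
      then have "of_real (R\<^sup>2) - cnj (a - c) * (z - c) = (z - c) * cnj (z - a)" by (simp add: algebra_simps)
      then show ?thesis using w R by (simp add: norm_divide norm_mult del: complex_cnj_diff)
    qed
    then have "norm (h z) = norm (f z)"
      using g(2)[of z] that R by (simp add: h_def norm_mult prod_norm[symmetric] norm_power)
    then show ?thesis using M[OF that] by simp
  qed
  have "norm (h c) \<le> M"
  proof (rule maximum_modulus_frontier[of h "cball c R"])
    show "h holomorphic_on interior (cball c R)" by (rule holomorphic_on_subset[OF hh]) (use R in auto)
    show "continuous_on (closure (cball c R)) h"
      by (rule holomorphic_on_imp_continuous_on, rule holomorphic_on_subset[OF hh]) (use R in auto)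
    show "\<And>z. z \<in> frontier (cball c R) \<Longrightarrow> norm (h z) \<le> M"
      using bd by (auto simp: frontier_cball)
  qed (use R in auto)
  moreover have "norm (h c) = norm (g c) * (\<Prod>a\<in>Z. R ^ m a)"
    using R by (simp add: h_def norm_mult prod_norm[symmetric] norm_power norm_divide power2_eq_square)
  moreover have "norm (f c) \<le> norm (g c) * (\<Prod>a\<in>Z. r ^ m a)"
  proof -
    have "norm (f c) = norm (g c) * (\<Prod>a\<in>Z. norm (c - a) ^ m a)"
      using g(2)[of c] R by (simp add: norm_mult prod_norm[symmetric] norm_power)
    also have "\<dots> \<le> norm (g c) * (\<Prod>a\<in>Z. r ^ m a)"
      using Z(2) by (intro mult_left_mono prod_mono conjI power_mono) (auto simp: dist_norm)
    finally show ?thesis .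
  qed
  ultimately have *: "norm (f c) \<le> norm (g c) * r ^ sum m Z" "norm (g c) * R ^ sum m Z \<le> M"
    by (auto simp: power_sum)
  have "(R / r) ^ sum m Z * norm (f c) \<le> (R / r) ^ sum m Z * (norm (g c) * r ^ sum m Z)"
    using * R by (intro mult_left_mono) auto
  also have "\<dots> = norm (g c) * R ^ sum m Z" using R by (simp add: power_divide)
  also have "\<dots> \<le> M" by fact
  finally show ?thesis by (simp add: m_def)
qed

section \<open>Mean values\<close>

text \<open>Bounded dependence on a finite measure: this is the form in which Fubini is justified
  twice in \<open>gaussian_mean_value\<close>.\<close>

lemma integrable_pair_bound:
  fixes h :: "'a \<times> 'b \<Rightarrow> complex"
  assumes M: "sigma_finite_measure M" and N: "finite_measure N"
    and h: "h \<in> borel_measurable (M \<Otimes>\<^sub>M N)" and k: "integrable M k"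
    and b: "\<And>w x. w \<in> space M \<Longrightarrow> x \<in> space N \<Longrightarrow> norm (h (w, x)) \<le> k w"
  shows "integrable (M \<Otimes>\<^sub>M N) h"
proof -
  interpret M: sigma_finite_measure M by fact
  interpret N: finite_measure N by fact
  interpret P: pair_sigma_finite M N ..
  have hm [measurable]: "h \<in> borel_measurable (M \<Otimes>\<^sub>M N)" by fact
  have int: "integrable N (\<lambda>x. h (w, x))" if "w \<in> space M" for w
  proof (rule Bochner_Integration.integrable_bound[where f = "\<lambda>_. k w"])
    show "(\<lambda>x. h (w, x)) \<in> borel_measurable N" using that by measurable
    show "AE x in N. norm (h (w, x)) \<le> norm (k w)" using b[OF that] by (intro AE_I2) (auto intro: order_trans[OF _ abs_ge_self])
    show "integrable N (\<lambda>_. k w)" by simp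
  qed
  show ?thesis
  proof (rule P.Fubini_integrable)
    show "integrable M (\<lambda>w. LINT x|N. norm (h (w, x)))"
    proof (rule Bochner_Integration.integrable_bound[where f = "\<lambda>w. k w * measure N (space N)"])
      show "integrable M (\<lambda>w. k w * measure N (space N))" using k by simp
      show "(\<lambda>w. LINT x|N. norm (h (w, x))) \<in> borel_measurable M" by measurable
      show "AE w in M. norm (LINT x|N. norm (h (w, x))) \<le> norm (k w * measure N (space N))"
      proof (rule AE_I2)
        fix w assume w: "w \<in> space M"
        have "(LINT x|N. norm (h (w, x))) \<le> (LINT x|N. k w)"
          using int[OF w] b[OF w] by (intro integral_mono) auto
        then show "norm (LINT x|N. norm (h (w, x))) \<le> norm (k w * measure N (space N))"
          by (simp add: mult.commute)
      qed
    qed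
    show "AE w in M. integrable N (\<lambda>x. h (w, x))" using int by (intro AE_I2)
  qed measurable
qed

lemma char_std_normal_cis:
  "(LINT x|std_normal_distribution. cis (u * x)) = of_real (exp (- u\<^sup>2 / 2))"
  using fun_cong[OF char_std_normal_distribution, of u] by (simp add: char_def cis_conv_exp)

text \<open>Averaging the square of f(T x) against the normal density in x gives a quadratic form in
  g whose kernel is the Gaussian's Fourier transform, exp(-(T (lam v - lam w))^2/2). The kernel is
  positive and symmetric, so Schur's test bounds the form by the row integrals \<open>B\<close>. An
  arbitrary measure is allowed so that Dirichlet series (counting measure) and Laplace integrals
  (Lebesgue measure) are both covered.\<close>

lemma gaussian_mean_value:
  fixes M :: "'a measure" and g :: "'a \<Rightarrow> complex" and lam B :: "'a \<Rightarrow> real"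
  assumes M: "sigma_finite_measure M" and g: "integrable M g" and lam [measurable]: "lam \<in> borel_measurable M"
    and T: "T > 0"
    and B: "\<And>w. w \<in> space M \<Longrightarrow> (\<integral>\<^sup>+v. ennreal (exp (- (T * (lam v - lam w))\<^sup>2 / 2)) \<partial>M) \<le> ennreal (B w)"
    and gB: "integrable M (\<lambda>w. (norm (g w))\<^sup>2 * B w)" and Bnn: "\<And>w. w \<in> space M \<Longrightarrow> B w \<ge> 0"
  defines "f \<equiv> \<lambda>t. LINT w|M. g w * cis (- t * lam w)"
  shows "set_integrable lborel {-T..T} (\<lambda>t. (norm (f t))\<^sup>2)"
    and "(LINT t:{-T..T}|lborel. (norm (f t))\<^sup>2) \<le> T / std_normal_density 1 * (LINT w|M. (norm (g w))\<^sup>2 * B w)"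
proof -
  interpret M: sigma_finite_measure M by fact
  let ?N = "std_normal_distribution"
  interpret N: real_distribution ?N by (rule real_dist_normal_dist)
  interpret P: pair_sigma_finite M ?N ..
  interpret PM: pair_sigma_finite M M ..
  have gm [measurable]: "g \<in> borel_measurable M" using g by (rule borel_measurable_integrable)
  have cism [measurable]: "cis \<in> borel_measurable borel"
    by (intro borel_measurable_continuous_onI continuous_intros)
  have cnjm [measurable]: "cnj \<in> borel_measurable borel"
    by (intro borel_measurable_continuous_onI continuous_intros)
  define G where "G = (LINT w|M. norm (g w))"
  have gn: "integrable M (\<lambda>w. norm (g w))" using g by simp
  have fm [measurable]: "f \<in> borel_measurable borel" unfolding f_def
    by (intro M.borel_measurable_lebesgue_integral) (simp add: split_beta', measurable)
  have fb: "norm (f t) \<le> G" for t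
  proof -
    have "norm (f t) \<le> (LINT w|M. norm (g w * cis (- t * lam w)))" unfolding f_def by (rule integral_norm_bound)
    then show ?thesis by (simp add: G_def norm_mult)
  qed
  have G0: "G \<ge> 0" unfolding G_def by (intro integral_nonneg_AE) auto
  have fb2: "(norm (f t))\<^sup>2 \<le> G\<^sup>2" for t using fb[of t] by (intro power_mono) auto
  show si: "set_integrable lborel {-T..T} (\<lambda>t. (norm (f t))\<^sup>2)"
    unfolding set_integrable_def
  proof (rule Bochner_Integration.integrable_bound[where f = "\<lambda>t. indicator {-T..T} t * G\<^sup>2"])
    show "integrable lborel (\<lambda>t. indicator {-T..T} t * G\<^sup>2)"
      using borel_integrable_atLeastAtMost'[of "-T" T "\<lambda>_. G\<^sup>2"]
      by (simp add: set_integrable_def)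
  qed (use fb2 in \<open>auto simp: indicator_def\<close>)
  define kk where "kk v w = exp (- (T * (lam v - lam w))\<^sup>2 / 2)" for v w
  have kkm [measurable]: "(\<lambda>x. kk (fst x) (snd x)) \<in> borel_measurable (M \<Otimes>\<^sub>M M)"
    unfolding kk_def by measurable
  have kkm1 [measurable]: "(\<lambda>v. kk v w) \<in> borel_measurable M" for w unfolding kk_def by measurable
  have kkm2 [measurable]: "(\<lambda>v. kk w v) \<in> borel_measurable M" for w unfolding kk_def by measurable
  have kk_sym: "kk v w = kk w v" for v w unfolding kk_def by (simp add: power2_commute power_mult_distrib)
  have kk1: "0 \<le> kk v w" "kk v w \<le> 1" for v w by (auto simp: kk_def)
  let ?h = "\<lambda>w x. g w * cis (- (T * x) * lam w)"
  \<comment> \<open>The square is written as f times its conjugate, so that the two factors can be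
    expanded one after the other, with one exchange of integrals each.\<close>
  define E where "E = (LINT x|?N. f (T * x) * cnj (f (T * x)))"
  have intg: "integrable M (\<lambda>w. g w * cis (- t * lam w))" for t
    by (rule Bochner_Integration.integrable_bound[OF g]) (auto simp: norm_mult)
  have E1: "E = (LINT x|?N. LINT w|M. ?h w x * cnj (f (T * x)))"
    unfolding E_def f_def using intg by (simp add: integral_mult_left_zero)
  have "integrable (M \<Otimes>\<^sub>M ?N) (\<lambda>(w, x). ?h w x * cnj (f (T * x)))"
  proof (rule integrable_pair_bound[OF M N.finite_measure_axioms, where k = "\<lambda>w. norm (g w) * G"])
    show "(\<lambda>(w, x). ?h w x * cnj (f (T * x))) \<in> borel_measurable (M \<Otimes>\<^sub>M ?N)"
      by (simp add: split_beta') measurable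
    show "integrable M (\<lambda>w. norm (g w) * G)" using gn by simp
  qed (use fb in \<open>auto simp: norm_mult intro: mult_left_mono\<close>)
  then have E2: "E = (LINT w|M. LINT x|?N. ?h w x * cnj (f (T * x)))"
    unfolding E1 by (rule P.Fubini_integral)
  have inner: "(LINT x|?N. ?h w x * cnj (f (T * x))) = g w * (LINT v|M. cnj (g v) * kk v w)" if w: "w \<in> space M" for w
  proof -
    have eqn: "?h w x * cnj (f (T * x)) = g w * (LINT v|M. cnj (g v) * cis (T * (lam v - lam w) * x))" for x
    proof -
      have "cnj (f (T * x)) = (LINT v|M. cnj (g v * cis (- (T * x) * lam v)))"
        unfolding f_def by (rule Bochner_Integration.integral_cnj[symmetric])
      also have "\<dots> = (LINT v|M. cnj (g v) * cis (T * x * lam v))" by (simp add: cis_cnj)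
      finally have "?h w x * cnj (f (T * x)) = g w * (cis (- (T * x) * lam w) * (LINT v|M. cnj (g v) * cis (T * x * lam v)))"
        by (simp add: mult_ac)
      also have "\<dots> = g w * (LINT v|M. cis (- (T * x) * lam w) * (cnj (g v) * cis (T * x * lam v)))"
        by (simp only: integral_mult_right_zero)
      also have "(\<lambda>v. cis (- (T * x) * lam w) * (cnj (g v) * cis (T * x * lam v)))
           = (\<lambda>v. cnj (g v) * cis (T * (lam v - lam w) * x))"
        by (simp add: cis_mult algebra_simps mult.left_commute[of "cis _" "cnj _"] fun_eq_iff)
      finally show ?thesis .
    qed
    have "integrable (M \<Otimes>\<^sub>M ?N) (\<lambda>(v, x). cnj (g v) * cis (T * (lam v - lam w) * x))"
    proof (rule integrable_pair_bound[OF M N.finite_measure_axioms, where k = "\<lambda>w. norm (g w)"])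
      show "(\<lambda>(v, x). cnj (g v) * cis (T * (lam v - lam w) * x)) \<in> borel_measurable (M \<Otimes>\<^sub>M ?N)"
        by (simp add: split_beta') measurable
    qed (use gn in \<open>auto simp: norm_mult\<close>)
    then have "(LINT x|?N. LINT v|M. cnj (g v) * cis (T * (lam v - lam w) * x)) =
        (LINT v|M. LINT x|?N. cnj (g v) * cis (T * (lam v - lam w) * x))"
      by (rule P.Fubini_integral)
    also have "\<dots> = (LINT v|M. cnj (g v) * kk v w)"
      by (simp add: integral_mult_right_zero char_std_normal_cis kk_def)
    finally show ?thesis by (simp only: eqn integral_mult_right_zero)
  qed
  have E3: "E = (LINT w|M. g w * (LINT v|M. cnj (g v) * kk v w))"
    unfolding E2 by (intro Bochner_Integration.integral_cong refl inner)
  define S where "S = (LINT w|M. (norm (g w))\<^sup>2 * B w)"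
  have nnS: "(\<integral>\<^sup>+w. \<integral>\<^sup>+v. ennreal ((norm (g w))\<^sup>2 * kk v w) \<partial>M \<partial>M) \<le> ennreal S"
  proof -
    have "(\<integral>\<^sup>+w. \<integral>\<^sup>+v. ennreal ((norm (g w))\<^sup>2 * kk v w) \<partial>M \<partial>M)
        = (\<integral>\<^sup>+w. ennreal ((norm (g w))\<^sup>2) * (\<integral>\<^sup>+v. ennreal (kk v w) \<partial>M) \<partial>M)"
      by (intro nn_integral_cong, subst nn_integral_cmult[symmetric]) (auto simp: ennreal_mult kk1)
    also have "\<dots> \<le> (\<integral>\<^sup>+w. ennreal ((norm (g w))\<^sup>2 * B w) \<partial>M)"
      using B Bnn by (intro nn_integral_mono) (auto simp: ennreal_mult kk_def intro!: mult_left_mono)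
    also have "\<dots> = ennreal S" unfolding S_def using gB Bnn by (intro nn_integral_eq_integral) auto
    finally show ?thesis .
  qed
  have nnS': "(\<integral>\<^sup>+w. \<integral>\<^sup>+v. ennreal ((norm (g v))\<^sup>2 * kk v w) \<partial>M \<partial>M) \<le> ennreal S"
  proof -
    have "(\<integral>\<^sup>+w. \<integral>\<^sup>+v. ennreal ((norm (g v))\<^sup>2 * kk v w) \<partial>M \<partial>M)
       = (\<integral>\<^sup>+v. \<integral>\<^sup>+w. ennreal ((norm (g v))\<^sup>2 * kk v w) \<partial>M \<partial>M)"
      by (rule PM.Fubini') (simp add: split_beta' kk_def)
    then show ?thesis using nnS by (simp add: kk_sym)
  qed
  have E4: "ennreal (norm E) \<le> ennreal S"
  proof -
    have int: "integrable M (\<lambda>v. cnj (g v) * kk v w)" for w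
      by (rule Bochner_Integration.integrable_bound[OF g]) (auto simp: norm_mult kk1 mult_left_le)
    have ib: "norm (LINT v|M. cnj (g v) * kk v w) \<le> G" for w
    proof -
      have "norm (LINT v|M. cnj (g v) * kk v w) \<le> (LINT v|M. norm (cnj (g v) * kk v w))" by (rule integral_norm_bound)
      also have "\<dots> \<le> G" unfolding G_def
        by (rule integral_mono[OF integrable_norm[OF int] gn]) (auto simp: norm_mult kk1 mult_left_le)
      finally show ?thesis .
    qed
    have m1 [measurable]: "(\<lambda>w. LINT v|M. cnj (g v) * kk v w) \<in> borel_measurable M"
      by (intro M.borel_measurable_lebesgue_integral) (simp add: split_beta' kk_def)
    have "integrable M (\<lambda>w. g w * (LINT v|M. cnj (g v) * kk v w))"
      by (rule Bochner_Integration.integrable_bound[where f = "\<lambda>w. norm (g w) * G"])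
         (use gn ib G0 in \<open>auto simp: norm_mult intro!: mult_left_mono\<close>)
    then have "ennreal (norm E) \<le> (\<integral>\<^sup>+w. norm (g w * (LINT v|M. cnj (g v) * kk v w)) \<partial>M)"
      unfolding E3 by (rule integral_norm_bound_ennreal)
    also have "\<dots> \<le> (\<integral>\<^sup>+w. \<integral>\<^sup>+v. ennreal (norm (g w) * norm (g v) * kk v w) \<partial>M \<partial>M)"
    proof (rule nn_integral_mono)
      fix w
      have "ennreal (norm (LINT v|M. cnj (g v) * kk v w)) \<le> (\<integral>\<^sup>+v. norm (cnj (g v) * kk v w) \<partial>M)"
        by (rule integral_norm_bound_ennreal[OF int])
      then have "ennreal (norm (g w)) * ennreal (norm (LINT v|M. cnj (g v) * kk v w)) \<le>
           ennreal (norm (g w)) * (\<integral>\<^sup>+v. norm (cnj (g v) * kk v w) \<partial>M)" by (intro mult_left_mono) auto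
      also have "\<dots> = (\<integral>\<^sup>+v. ennreal (norm (g w)) * norm (cnj (g v) * kk v w) \<partial>M)"
        by (rule nn_integral_cmult[symmetric]) measurable
      also have "\<dots> = (\<integral>\<^sup>+v. ennreal (norm (g w) * norm (g v) * kk v w) \<partial>M)"
        by (simp add: norm_mult ennreal_mult[symmetric] kk1 mult.assoc)
      finally show "ennreal (norm (g w * (LINT v|M. cnj (g v) * kk v w))) \<le> (\<integral>\<^sup>+v. ennreal (norm (g w) * norm (g v) * kk v w) \<partial>M)"
        by (simp add: norm_mult ennreal_mult)
    qed
    also have "\<dots> \<le> (\<integral>\<^sup>+w. \<integral>\<^sup>+v. (ennreal ((norm (g w))\<^sup>2 * kk v w) + ennreal ((norm (g v))\<^sup>2 * kk v w)) / 2 \<partial>M \<partial>M)"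
    \<comment> \<open>Schur's test: the arithmetic-geometric mean inequality decouples the two
      coefficients, and by symmetry of the kernel both halves are bounded by the same
      \<open>S\<close>.\<close>
    proof (intro nn_integral_mono)
      fix w v
      have "2 * (norm (g w) * norm (g v)) \<le> (norm (g w))\<^sup>2 + (norm (g v))\<^sup>2"
        using sum_squares_bound[of "norm (g w)" "norm (g v)"] by simp
      then have "norm (g w) * norm (g v) * kk v w \<le> ((norm (g w))\<^sup>2 * kk v w + (norm (g v))\<^sup>2 * kk v w) / 2"
        using mult_right_mono[of _ _ "kk v w / 2"] kk1[of v w] by (fastforce simp: algebra_simps)
      then have "ennreal (norm (g w) * norm (g v) * kk v w) \<le> ennreal (((norm (g w))\<^sup>2 * kk v w + (norm (g v))\<^sup>2 * kk v w) / 2)"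
        by (rule ennreal_leI)
      also have "\<dots> = (ennreal ((norm (g w))\<^sup>2 * kk v w) + ennreal ((norm (g v))\<^sup>2 * kk v w)) / 2"
        using kk1[of v w] by (simp add: divide_ennreal[symmetric] ennreal_plus[symmetric] del: ennreal_plus)
      finally show "ennreal (norm (g w) * norm (g v) * kk v w) \<le> (ennreal ((norm (g w))\<^sup>2 * kk v w) + ennreal ((norm (g v))\<^sup>2 * kk v w)) / 2" .
    qed
    also have "\<dots> = ((\<integral>\<^sup>+w. \<integral>\<^sup>+v. ennreal ((norm (g w))\<^sup>2 * kk v w) \<partial>M \<partial>M) + (\<integral>\<^sup>+w. \<integral>\<^sup>+v. ennreal ((norm (g v))\<^sup>2 * kk v w) \<partial>M \<partial>M)) / 2"
    proof -
      have [measurable]: "(\<lambda>w. \<integral>\<^sup>+v. ennreal ((norm (g w))\<^sup>2 * kk v w) \<partial>M) \<in> borel_measurable M"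
        "(\<lambda>w. \<integral>\<^sup>+v. ennreal ((norm (g v))\<^sup>2 * kk v w) \<partial>M) \<in> borel_measurable M"
        by (intro M.borel_measurable_nn_integral; simp add: split_beta' kk_def)+
      show ?thesis by (simp add: nn_integral_divide nn_integral_add)
    qed
    also have "\<dots> \<le> (ennreal S + ennreal S) / 2"
      by (intro divide_right_mono_ennreal add_mono nnS nnS')
    also have "\<dots> = ennreal S"
    proof -
      have "S \<ge> 0" unfolding S_def using Bnn by (intro integral_nonneg_AE AE_I2) auto
      then have "(ennreal S + ennreal S) / 2 = ennreal (S + S) / ennreal 2"
        by (simp only: ennreal_plus[OF \<open>S \<ge> 0\<close> \<open>S \<ge> 0\<close>] ennreal_numeral)
      also have "\<dots> = ennreal ((S + S) / 2)" by (rule divide_ennreal) (use \<open>S \<ge> 0\<close> in auto)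
      finally show ?thesis by simp
    qed
    finally show ?thesis .
  qed
  have S0: "S \<ge> 0" unfolding S_def using Bnn by (intro integral_nonneg_AE AE_I2) auto
  have E5: "E = of_real (LINT x|?N. (norm (f (T * x)))\<^sup>2)"
    unfolding E_def complex_norm_square[symmetric] of_real_power[symmetric] by (rule integral_complex_of_real)
  \<comment> \<open>This is the minimum of the normal density on [-1, 1]; passing from the Gaussian
    average to the sharp range |t| \<le> T costs 1/c.\<close>
  define c where "c = std_normal_density 1"
  have c: "c > 0" unfolding c_def by (rule normal_density_pos) simp
  have intN: "integrable ?N (\<lambda>x. (norm (f (T * x)))\<^sup>2)"
    by (rule N.integrable_const_bound[where B = "G\<^sup>2"]) (use fb2 in auto)
  have "ennreal c * (\<integral>\<^sup>+x. ennreal ((norm (f (T * x)))\<^sup>2 * indicator {-1..1} x) \<partial>lborel)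
      = (\<integral>\<^sup>+x. ennreal c * ennreal ((norm (f (T * x)))\<^sup>2 * indicator {-1..1} x) \<partial>lborel)"
    by (rule nn_integral_cmult[symmetric]) measurable
  also have "\<dots> \<le> (\<integral>\<^sup>+x. ennreal (std_normal_density x) * ennreal ((norm (f (T * x)))\<^sup>2) \<partial>lborel)"
  proof (intro nn_integral_mono)
    fix x :: real
    show "ennreal c * ennreal ((norm (f (T * x)))\<^sup>2 * indicator {-1..1} x) \<le> ennreal (std_normal_density x) * ennreal ((norm (f (T * x)))\<^sup>2)"
    proof (cases "x \<in> {-1..1}")
      case True
      then have "x\<^sup>2 \<le> 1" by (auto simp: abs_square_le_1)
      then have "c \<le> std_normal_density x" unfolding c_def normal_density_def by (auto intro!: divide_right_mono)
      then show ?thesis using True by (auto intro!: mult_right_mono ennreal_leI)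
    qed auto
  qed
  also have "\<dots> = (\<integral>\<^sup>+x. ennreal ((norm (f (T * x)))\<^sup>2) \<partial>?N)"
    by (subst nn_integral_density) auto
  also have "\<dots> = ennreal (LINT x|?N. (norm (f (T * x)))\<^sup>2)"
    by (rule nn_integral_eq_integral[OF intN]) auto
  also have "\<dots> \<le> ennreal S"
  proof -
    have "norm E = (LINT x|?N. (norm (f (T * x)))\<^sup>2)"
      unfolding E5 by (simp add: integral_nonneg_AE)
    then show ?thesis using E4 by simp
  qed
  finally have A: "ennreal c * (\<integral>\<^sup>+x. ennreal ((norm (f (T * x)))\<^sup>2 * indicator {-1..1} x) \<partial>lborel) \<le> ennreal S" .
  have "(\<integral>\<^sup>+t. ennreal ((norm (f t))\<^sup>2 * indicator {-T..T} t) \<partial>lborel)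
     = ennreal \<bar>T\<bar> * (\<integral>\<^sup>+x. ennreal ((norm (f (0 + T * x)))\<^sup>2 * indicator {-T..T} (0 + T * x)) \<partial>lborel)"
    by (rule nn_integral_real_affine) (use T in auto)
  also have "\<dots> = ennreal T * (\<integral>\<^sup>+x. ennreal ((norm (f (T * x)))\<^sup>2 * indicator {-1..1} x) \<partial>lborel)"
  proof -
    have "T * x \<in> {-T..T} \<longleftrightarrow> x \<in> {-1..1}" for x
      using T mult_le_cancel_left_pos[of T x 1] mult_le_cancel_left_pos[of T "-1" x] by auto
    then show ?thesis using T by (simp add: indicator_def)
  qed
  finally have B1: "(\<integral>\<^sup>+t. ennreal ((norm (f t))\<^sup>2 * indicator {-T..T} t) \<partial>lborel)
     = ennreal T * (\<integral>\<^sup>+x. ennreal ((norm (f (T * x)))\<^sup>2 * indicator {-1..1} x) \<partial>lborel)" .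
  have L: "ennreal (LINT t:{-T..T}|lborel. (norm (f t))\<^sup>2) = (\<integral>\<^sup>+t. ennreal ((norm (f t))\<^sup>2 * indicator {-T..T} t) \<partial>lborel)"
    unfolding set_lebesgue_integral_def using si unfolding set_integrable_def
    by (subst nn_integral_eq_integral[symmetric]) (auto simp: mult.commute)
  have "ennreal c * ennreal (LINT t:{-T..T}|lborel. (norm (f t))\<^sup>2) \<le> ennreal T * ennreal S"
    unfolding L B1 using mult_left_mono[OF A, of "ennreal T"] by (simp add: mult_ac)
  then have "c * (LINT t:{-T..T}|lborel. (norm (f t))\<^sup>2) \<le> T * S"
    using c T S0 by (simp add: ennreal_mult'[symmetric] set_lebesgue_integral_def integral_nonneg_AE)
  then show "(LINT t:{-T..T}|lborel. (norm (f t))\<^sup>2) \<le> T / std_normal_density 1 * (LINT w|M. (norm (g w))\<^sup>2 * B w)"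
    using c by (simp add: c_def[symmetric] S_def field_simps)
qed

section \<open>Laplace transforms\<close>

lemma exp_tail_integral:
  fixes k U :: real assumes k: "k > 0"
  shows "set_integrable lborel {U<..} (\<lambda>u. exp (- k * u))"
    and "(LINT u:{U<..}|lborel. exp (- k * u)) = exp (- k * U) / k"
proof -
  have lim: "((\<lambda>u. - exp (- k * u) / k) \<longlongrightarrow> 0) at_top" using k by real_asymp
  have nn: "(\<integral>\<^sup>+u. ennreal (exp (- k * u)) * indicator {U ..} u \<partial>lborel) = ennreal (0 - (- exp (- k * U) / k))"
    by (rule nn_integral_FTC_atLeast[where F = "\<lambda>u. - exp (- k * u) / k"])
       (use k lim in \<open>auto intro!: derivative_eq_intros\<close>)
  have nn2: "(\<integral>\<^sup>+u. ennreal (indicator {U<..} u * exp (- k * u)) \<partial>lborel) = ennreal (exp (- k * U) / k)"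
  proof -
    have "AE u in lborel. u \<noteq> U" by (rule AE_lborel_singleton)
    then have "(\<integral>\<^sup>+u. ennreal (indicator {U<..} u * exp (- k * u)) \<partial>lborel) =
        (\<integral>\<^sup>+u. ennreal (exp (- k * u)) * indicator {U ..} u \<partial>lborel)"
      by (intro nn_integral_cong_AE) (auto simp: indicator_def elim!: eventually_mono)
    then show ?thesis using nn by simp
  qed
  show si: "set_integrable lborel {U<..} (\<lambda>u. exp (- k * u))"
    unfolding set_integrable_def by (rule integrableI_nonneg) (use nn2 in auto)
  show "(LINT u:{U<..}|lborel. exp (- k * u)) = exp (- k * U) / k"
    unfolding set_lebesgue_integral_def
    by (rule integral_eq_nn_integral[THEN trans]) (use nn2 k in auto)
qed

lemma norm_exp_minus_one_le: "norm (exp z - 1) \<le> norm z * exp (norm (z::complex))"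
proof -
  have "norm (exp z - exp 0) \<le> exp (norm z) * norm (z - 0)"
  proof (rule field_differentiable_bound[of "cball 0 (norm z)" exp exp])
    fix w :: complex assume "w \<in> cball 0 (norm z)"
    then show "norm (exp w) \<le> exp (norm z)"
      using norm_exp[of w] by (auto intro: order_trans)
  qed (auto intro: DERIV_subset DERIV_exp)
  then show ?thesis by (simp add: mult.commute)
qed

lemma laplace_integrand:
  fixes r :: "real \<Rightarrow> real"
  assumes r [measurable]: "r \<in> borel_measurable borel" and C: "\<And>u. u \<ge> 0 \<Longrightarrow> \<bar>r u\<bar> \<le> C * exp (c * u)"
    and s: "Re s > c" and U: "U \<ge> 0"
  shows "set_integrable lborel {U<..} (\<lambda>u. of_real (r u) * exp (- s * of_real u))"
    and "norm (LINT u:{U<..}|lborel. of_real (r u) * exp (- s * of_real u)) \<le> C * exp (- (Re s - c) * U) / (Re s - c)"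
proof -
  have b: "norm (of_real (r u) * exp (- s * of_real u)) \<le> C * exp (- (Re s - c) * u)" if "u \<ge> 0" for u
  proof -
    have "norm (of_real (r u) * exp (- s * of_real u)) = \<bar>r u\<bar> * exp (- Re s * u)"
      by (simp add: norm_mult norm_exp_eq_Re)
    also have "\<dots> \<le> C * exp (c * u) * exp (- Re s * u)" using C[OF that] by (intro mult_right_mono) auto
    also have "\<dots> = C * exp (- (Re s - c) * u)" by (simp add: exp_add[symmetric] algebra_simps)
    finally show ?thesis .
  qed
  have gi: "set_integrable lborel {U<..} (\<lambda>u. C * exp (- (Re s - c) * u))"
    by (intro set_integrable_mult_right exp_tail_integral(1)) (use s in auto)
  show si: "set_integrable lborel {U<..} (\<lambda>u. of_real (r u) * exp (- s * of_real u))"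
  proof (rule set_integrable_bound[OF gi])
    show "set_borel_measurable lborel {U<..} (\<lambda>u. of_real (r u) * exp (- s * of_real u))"
      unfolding set_borel_measurable_def by measurable
  qed (use b U in \<open>auto intro!: AE_I2 order_trans[OF _ abs_ge_self]\<close>)
  have "norm (LINT u:{U<..}|lborel. of_real (r u) * exp (- s * of_real u)) \<le>
      (LINT u:{U<..}|lborel. norm (of_real (r u) * exp (- s * of_real u)))"
    by (rule set_integral_norm_bound[OF si])
  also have "\<dots> \<le> (LINT u:{U<..}|lborel. C * exp (- (Re s - c) * u))"
    by (rule set_integral_mono[OF set_integrable_norm[OF si] gi]) (use b U in auto)
  also have "\<dots> = C * exp (- (Re s - c) * U) / (Re s - c)"
    using s exp_tail_integral(2)[of "Re s - c" U] by simp
  finally show "norm (LINT u:{U<..}|lborel. of_real (r u) * exp (- s * of_real u)) \<le> C * exp (- (Re s - c) * U) / (Re s - c)" .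
qed

text \<open>Differentiation under the integral sign, by dominated convergence along sequences of
  difference quotients.\<close>

lemma laplace_holomorphic:
  fixes r :: "real \<Rightarrow> real"
  assumes r [measurable]: "r \<in> borel_measurable borel" and C: "\<And>u. u \<ge> 0 \<Longrightarrow> \<bar>r u\<bar> \<le> C * exp (c * u)"
  shows "(\<lambda>s. LINT u:{0<..}|lborel. of_real (r u) * exp (- s * of_real u)) holomorphic_on {s. Re s > c}"
    (is "?L holomorphic_on _")
proof (rule holomorphic_onI)
  fix s assume "s \<in> {s. Re s > c}"
  \<comment> \<open>The distance to the abscissa is spent in thirds: one for the perturbed point
    \<open>X i\<close>, one for the factor u \<le> exp(\<eta> u)/\<eta>, and one is left to make the
    majorant integrable.\<close>
  define \<eta> where "\<eta> = (Re s - c) / 3"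
  have eta: "\<eta> > 0" "Re s = c + 3 * \<eta>" using \<open>s \<in> _\<close> by (auto simp: \<eta>_def field_simps)
  define D where "D = (LINT u:{0<..}|lborel. of_real (r u) * (- of_real u * exp (- s * of_real u)))"
  have C0: "C \<ge> 0" using C[of 0] by simp
  have "(?L has_field_derivative D) (at s)"
    unfolding has_field_derivative_iff tendsto_at_iff_sequentially comp_def
  proof (intro allI impI)
    fix X :: "nat \<Rightarrow> complex" assume X: "\<forall>i. X i \<in> UNIV - {s}" "X \<longlonglongrightarrow> s"
    obtain N where N: "\<And>i. i \<ge> N \<Longrightarrow> dist (X i) s < \<eta>"
      using X(2) eta(1) by (auto simp: lim_sequentially)
    have XRe: "Re (X i) > c" if "i \<ge> N" for i
    proof -
      have "\<bar>Re (X i - s)\<bar> < \<eta>" using N[OF that] abs_Re_le_cmod[of "X i - s"] by (simp add: dist_norm)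
      then show ?thesis using eta by (simp add: abs_less_iff)
    qed
    let ?q = "\<lambda>i u. indicator {0<..} u *\<^sub>R (of_real (r u) * ((exp (- X i * of_real u) - exp (- s * of_real u)) / (X i - s)))"
    have lim: "(\<lambda>i. LINT u|lborel. ?q (i + N) u) \<longlonglongrightarrow> D"
      unfolding D_def set_lebesgue_integral_def
    proof (rule integral_dominated_convergence)
      show "integrable lborel (\<lambda>u. indicator {0<..} u *\<^sub>R ((C / \<eta>) * exp (- \<eta> * u)))"
        unfolding set_integrable_def[symmetric]
        by (intro set_integrable_mult_right exp_tail_integral(1) eta)
      show "AE u in lborel. (\<lambda>i. ?q (i + N) u) \<longlonglongrightarrow> indicator {0<..} u *\<^sub>R (of_real (r u) * (- of_real u * exp (- s * of_real u)))"
      proof (rule AE_I2)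
        fix u :: real
        have "((\<lambda>z. exp (- z * of_real u)) has_field_derivative (- of_real u * exp (- s * of_real u))) (at s)"
          by (auto intro!: derivative_eq_intros)
        then have "(\<lambda>i. (exp (- X i * of_real u) - exp (- s * of_real u)) / (X i - s)) \<longlonglongrightarrow> - of_real u * exp (- s * of_real u)"
          unfolding has_field_derivative_iff tendsto_at_iff_sequentially comp_def using X by blast
        then have "(\<lambda>i. ?q i u) \<longlonglongrightarrow> indicator {0<..} u *\<^sub>R (of_real (r u) * (- of_real u * exp (- s * of_real u)))"
          by (intro tendsto_intros)
        then show "(\<lambda>i. ?q (i + N) u) \<longlonglongrightarrow> indicator {0<..} u *\<^sub>R (of_real (r u) * (- of_real u * exp (- s * of_real u)))"
          by (rule LIMSEQ_ignore_initial_segment)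
      qed
      show "AE u in lborel. norm (?q (i + N) u) \<le> indicator {0<..} u *\<^sub>R ((C / \<eta>) * exp (- \<eta> * u))" for i
      proof (rule AE_I2)
        fix u :: real
        show "norm (?q (i + N) u) \<le> indicator {0<..} u *\<^sub>R ((C / \<eta>) * exp (- \<eta> * u))"
        proof (cases "u > 0")
          case True
          define h where "h = X (i + N) - s"
          have h: "h \<noteq> 0" "norm h \<le> \<eta>" using X(1) N[of "i + N"] by (auto simp: h_def dist_norm)
          have "exp (- X (i + N) * of_real u) - exp (- s * of_real u) = exp (- s * of_real u) * (exp (- h * of_real u) - 1)"
            by (simp add: h_def algebra_simps exp_add[symmetric])
          then have "norm ((exp (- X (i + N) * of_real u) - exp (- s * of_real u)) / (X (i + N) - s)) =
              exp (- Re s * u) * norm (exp (- h * of_real u) - 1) / norm h"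
            by (simp add: h_def norm_mult norm_divide norm_exp_eq_Re)
          also have "\<dots> \<le> exp (- Re s * u) * (norm h * u * exp (\<eta> * u)) / norm h"
          proof (intro divide_right_mono mult_left_mono)
            have "norm (exp (- h * of_real u) - 1) \<le> norm (- h * of_real u) * exp (norm (- h * of_real u))"
              by (rule norm_exp_minus_one_le)
            also have "\<dots> = norm h * u * exp (norm h * u)" using True by (simp add: norm_mult)
            also have "\<dots> \<le> norm h * u * exp (\<eta> * u)" using True h by (intro mult_left_mono) auto
            finally show "norm (exp (- h * of_real u) - 1) \<le> norm h * u * exp (\<eta> * u)" .
          qed auto
          also have "\<dots> = u * (exp (- Re s * u) * exp (\<eta> * u))" using h by simp
          also have "\<dots> \<le> (1 / \<eta>) * exp (\<eta> * u) * (exp (- Re s * u) * exp (\<eta> * u))"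
          proof (intro mult_right_mono)
            have "\<eta> * u \<le> exp (\<eta> * u)" using exp_ge_add_one_self[of "\<eta> * u"] by linarith
            then show "u \<le> 1 / \<eta> * exp (\<eta> * u)" using eta by (simp add: field_simps)
          qed auto
          finally have "norm ((exp (- X (i + N) * of_real u) - exp (- s * of_real u)) / (X (i + N) - s)) \<le>
              1 / \<eta> * exp (\<eta> * u) * (exp (- Re s * u) * exp (\<eta> * u))" .
          then have "norm (?q (i + N) u) \<le> (C * exp (c * u)) * (1 / \<eta> * exp (\<eta> * u) * (exp (- Re s * u) * exp (\<eta> * u)))"
            unfolding norm_scaleR norm_mult using True C[of u] C0
            by (simp only: indicator_simps greaterThan_iff norm_of_real abs_one mult_1) (intro mult_mono, auto)
          also have "\<dots> = C / \<eta> * (exp (c * u) * exp (\<eta> * u) * exp (- Re s * u) * exp (\<eta> * u))" by simp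
          also have "exp (c * u) * exp (\<eta> * u) * exp (- Re s * u) * exp (\<eta> * u) = exp (- \<eta> * u)"
            using eta(2) by (simp add: exp_add[symmetric] algebra_simps)
          finally show ?thesis using True by simp
        qed simp
      qed
    qed measurable
    have "(LINT u|lborel. ?q i u) = (?L (X i) - ?L s) / (X i - s)" if "i \<ge> N" for i
    proof -
      have "?L (X i) - ?L s = (LINT u:{0<..}|lborel. of_real (r u) * exp (- X i * of_real u) - of_real (r u) * exp (- s * of_real u))"
        by (rule set_integral_diff(2)[symmetric])
           (intro laplace_integrand(1)[where C = C and c = c]; use C XRe[OF that] eta in auto)+
      moreover have "(LINT u|lborel. ?q i u) = (LINT u:{0<..}|lborel. (of_real (r u) * exp (- X i * of_real u) - of_real (r u) * exp (- s * of_real u)) / (X i - s))"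
        unfolding set_lebesgue_integral_def
        by (rule Bochner_Integration.integral_cong) (simp_all add: right_diff_distrib)
      moreover have "\<dots> = (LINT u:{0<..}|lborel. of_real (r u) * exp (- X i * of_real u) - of_real (r u) * exp (- s * of_real u)) / (X i - s)"
        by (rule set_integral_divide_zero)
      ultimately show ?thesis by (simp only:)
    qed
    then have "(\<lambda>i. (?L (X (i + N)) - ?L s) / (X (i + N) - s)) \<longlonglongrightarrow> D" using lim by simp
    then show "(\<lambda>i. (?L (X i) - ?L s) / (X i - s)) \<longlonglongrightarrow> D" by (rule LIMSEQ_offset)
  qed
  then show "?L field_differentiable at s within {s. Re s > c}"
    using field_differentiable_at_within field_differentiable_def by blast
qed

text \<open>
  \<open>polar P s 0\<close> is the Laplace transform of \<open>P\<close> at \<open>s - 1\<close>, continued to all \<open>s \<noteq> 1\<close>.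
\<close>

definition polar :: "real poly \<Rightarrow> complex \<Rightarrow> real \<Rightarrow> complex" where
  "polar P s u = (\<Sum>k\<le>degree P. of_real (poly ((pderiv ^^ k) P) u) / (s - 1) ^ (k + 1))"

lemma pderiv_funpow_degree: "degree P < k \<Longrightarrow> (pderiv ^^ k) P = (0 :: real poly)"
proof (induction k arbitrary: P)
  case (Suc k)
  have "(pderiv ^^ Suc k) P = (pderiv ^^ k) (pderiv P)" by (simp add: funpow_swap1)
  also have "\<dots> = 0"
  proof (cases "degree P = 0")
    case True
    then have "pderiv P = 0" by (simp add: pderiv_eq_0_iff)
    moreover have "(pderiv ^^ k) (0 :: real poly) = 0" by (induction k) auto
    ultimately show ?thesis by simp
  next
    case False
    then show ?thesis using Suc by (intro Suc.IH) (simp add: degree_pderiv)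
  qed
  finally show ?case .
qed simp

text \<open>The right-hand side is the u-derivative of \<open>polar P s u\<close>, so the identity
  is the differential equation p' = (s - 1) p - P, the outcome of repeated integration by parts. The
  sum telescopes because the derivatives of P beyond its degree vanish.\<close>

lemma polar_shift:
  assumes s: "s \<noteq> 1"
  shows "(s - 1) * polar P s u - of_real (poly P u) =
     (\<Sum>k\<le>degree P. of_real (poly ((pderiv ^^ Suc k) P) u) / (s - 1) ^ (k + 1))"
proof -
  have "(s - 1) * polar P s u - of_real (poly P u) = (\<Sum>k\<le>degree P. of_real (poly ((pderiv ^^ k) P) u) / (s - 1) ^ k) - of_real (poly P u)"
    using s by (simp add: polar_def sum_distrib_left)
  also have "\<dots> = (\<Sum>k\<le>Suc (degree P). of_real (poly ((pderiv ^^ k) P) u) / (s - 1) ^ k) - of_real (poly P u)"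
    by (simp only: sum.atMost_Suc) (subst pderiv_funpow_degree, auto)
  also have "\<dots> = (\<Sum>k\<le>degree P. of_real (poly ((pderiv ^^ Suc k) P) u) / (s - 1) ^ (k + 1))"
    by (simp only: sum.atMost_Suc_shift) simp
  finally show ?thesis .
qed

lemma polar_antiderivative:
  assumes s: "s \<noteq> 1"
  shows "((\<lambda>u. - polar P s u * exp ((1 - s) * of_real u)) has_vector_derivative
     of_real (poly P u) * exp ((1 - s) * of_real u)) (at u within A)"
proof -
  let ?D = "\<Sum>k\<le>degree P. of_real (poly ((pderiv ^^ Suc k) P) u) / (s - 1) ^ (k + 1)"
  have D: "?D = (s - 1) * polar P s u - of_real (poly P u)" by (rule polar_shift[OF s, symmetric])
  have pd: "((\<lambda>u. of_real (poly Q u) :: complex) has_vector_derivative of_real (poly (pderiv Q) u)) (at u within A)" for Q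
    using has_vector_derivative_of_real[OF has_field_derivative_at_within[OF poly_DERIV[of Q u], of A]]
    by (simp add: o_def)
  have p1: "((\<lambda>u. polar P s u) has_vector_derivative ?D) (at u within A)"
    unfolding polar_def
    by (intro has_vector_derivative_sum has_vector_derivative_divide) (simp add: pd)
  have "((\<lambda>z. exp ((1 - s) * z)) has_field_derivative (1 - s) * exp ((1 - s) * of_real u)) (at (of_real u))"
    by (auto intro!: derivative_eq_intros)
  then have p2: "((\<lambda>u. exp ((1 - s) * of_real u)) has_vector_derivative (1 - s) * exp ((1 - s) * of_real u)) (at u within A)"
    by (rule has_vector_derivative_at_within[OF has_vector_derivative_real_field])
  have "((\<lambda>u. - polar P s u * exp ((1 - s) * of_real u)) has_vector_derivative
     - polar P s u * ((1 - s) * exp ((1 - s) * of_real u)) + - ?D * exp ((1 - s) * of_real u)) (at u within A)"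
    by (intro has_vector_derivative_mult has_vector_derivative_minus p1 p2)
  moreover have "- polar P s u * ((1 - s) * exp ((1 - s) * of_real u)) + - ?D * exp ((1 - s) * of_real u)
     = of_real (poly P u) * exp ((1 - s) * of_real u)"
    unfolding D by (simp add: algebra_simps)
  ultimately show ?thesis by simp
qed

section \<open>Mean values of general Dirichlet series\<close>

text \<open>Sort the frequencies by the integer part m of T times the logarithmic distance. Class m
  has weight at most exp(-m^2/2) and lies in the window of half-width (m + 1)/T, so the Gaussian
  outweighs both the number of windows and the factor exp(6 \<eta>). What remains is the count at
  width 1/T, with the two terms \<nu>/T and \<nu>^\<theta>.\<close>

lemma spaced_kernel:
  fixes \<nu> :: "'i \<Rightarrow> real"
  assumes sp: "spaced \<theta> \<nu>" and nu: "\<And>i. \<nu> i \<ge> 1" and e: "\<epsilon> > 0" "\<epsilon> \<le> 1"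
  obtains C where "C \<ge> 0" "\<And>T i. T \<ge> 1 \<Longrightarrow>
    (\<integral>\<^sup>+k. ennreal (exp (- (T * (ln (\<nu> k) - ln (\<nu> i)))\<^sup>2 / 2)) \<partial>count_space UNIV)
      \<le> ennreal (C * \<nu> i powr \<epsilon> * (\<nu> i / T + \<nu> i powr \<theta>))"
proof -
  obtain C where C: "C \<ge> 0" "\<And>x \<eta>. x \<ge> 1 \<Longrightarrow> \<eta> \<ge> 0 \<Longrightarrow> finite {i. \<bar>ln (\<nu> i) - ln x\<bar> \<le> \<eta>} \<and>
     real (card {i. \<bar>ln (\<nu> i) - ln x\<bar> \<le> \<eta>}) \<le> C * x powr \<epsilon> * exp (6 * \<eta>) * (\<eta> * x + x powr \<theta>)"
    using sp[unfolded spaced_def, rule_format, OF e] by metis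
  \<comment> \<open>The constant 38 completes a square: -m^2/2 + 6 (m + 1) + m equals 38 - m - (m -
    8)^2/2.\<close>
  define h :: "nat \<Rightarrow> real" where "h m = exp 38 * exp (-1) ^ m" for m
  have hs: "summable h" unfolding h_def by (intro summable_mult summable_geometric) simp
  have h0: "h m \<ge> 0" for m by (simp add: h_def)
  have hb: "exp (- (real m)\<^sup>2 / 2) * exp (6 * (real m + 1)) * (real m + 1) \<le> h m" for m
  proof -
    have "real m + 1 \<le> exp (real m)" using exp_ge_add_one_self[of "real m"] by linarith
    then have "exp (- (real m)\<^sup>2 / 2) * exp (6 * (real m + 1)) * (real m + 1) \<le> exp (- (real m)\<^sup>2 / 2) * exp (6 * (real m + 1)) * exp (real m)"
      by (intro mult_left_mono) auto
    also have "\<dots> = exp (- (real m)\<^sup>2 / 2 + 6 * (real m + 1) + real m)" by (simp only: exp_add)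
    also have "- (real m)\<^sup>2 / 2 + 6 * (real m + 1) + real m \<le> 38 + real m * (-1)"
      using zero_le_power2[of "real m - 8"] by (simp add: power2_eq_square algebra_simps)
    also have "exp (38 + real m * (-1)) = h m" unfolding h_def by (simp only: exp_add exp_of_nat_mult)
    finally show ?thesis by simp
  qed
  show ?thesis
  proof (rule that[of "C * suminf h"])
    show "C * suminf h \<ge> 0" using C(1) hs h0 by (simp add: suminf_nonneg)
    fix T :: real and i :: 'i assume T: "T \<ge> 1"
    define x where "x = \<nu> i"
    define D where "D = C * x powr \<epsilon> * (x / T + x powr \<theta>)"
    have x: "x \<ge> 1" using nu by (simp add: x_def)
    have D0: "D \<ge> 0" unfolding D_def using C(1) x T by (intro mult_nonneg_nonneg add_nonneg_nonneg) auto
    define W where "W m = {k. \<bar>ln (\<nu> k) - ln x\<bar> \<le> (real m + 1) / T}" for m :: nat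
    have W: "finite (W m)" "exp (- (real m)\<^sup>2 / 2) * real (card (W m)) \<le> D * h m" for m
    proof -
      show fin: "finite (W m)" unfolding W_def using C(2)[of x "(real m + 1) / T"] x T by simp
      have "real (card (W m)) \<le> C * x powr \<epsilon> * exp (6 * ((real m + 1) / T)) * ((real m + 1) / T * x + x powr \<theta>)"
        unfolding W_def using C(2)[of x "(real m + 1) / T"] x T by simp
      also have "\<dots> \<le> C * x powr \<epsilon> * exp (6 * (real m + 1)) * ((real m + 1) * (x / T + x powr \<theta>))"
      proof (intro mult_mono mult_left_mono)
        have "(real m + 1) / T \<le> (real m + 1) / 1" using T by (intro divide_left_mono) auto
        then show "exp (6 * ((real m + 1) / T)) \<le> exp (6 * (real m + 1))"
          unfolding exp_le_cancel_iff by (intro mult_left_mono) auto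
        show "(real m + 1) / T * x + x powr \<theta> \<le> (real m + 1) * (x / T + x powr \<theta>)"
        proof -
          have "1 * x powr \<theta> \<le> (real m + 1) * x powr \<theta>" by (intro mult_right_mono) auto
          then show ?thesis by (simp add: distrib_left)
        qed
      qed (use C(1) x T in auto)
      also have "\<dots> = D * (exp (6 * (real m + 1)) * (real m + 1))" by (simp add: D_def)
      finally have "exp (- (real m)\<^sup>2 / 2) * real (card (W m)) \<le> exp (- (real m)\<^sup>2 / 2) * (D * (exp (6 * (real m + 1)) * (real m + 1)))"
        by (intro mult_left_mono) auto
      also have "\<dots> = D * (exp (- (real m)\<^sup>2 / 2) * exp (6 * (real m + 1)) * (real m + 1))" by simp
      also have "\<dots> \<le> D * h m" by (intro mult_left_mono hb D0)
      finally show "exp (- (real m)\<^sup>2 / 2) * real (card (W m)) \<le> D * h m" .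
    qed
    have pt: "ennreal (exp (- (T * (ln (\<nu> k) - ln x))\<^sup>2 / 2)) \<le> (\<Sum>m. ennreal (exp (- (real m)\<^sup>2 / 2)) * indicator (W m) k)" for k
    proof -
      define y where "y = T * \<bar>ln (\<nu> k) - ln x\<bar>"
      define m where "m = nat \<lfloor>y\<rfloor>"
      have y0: "y \<ge> 0" using T by (simp add: y_def)
      have m: "real m \<le> y" "y \<le> real m + 1" using y0 unfolding m_def by linarith+
      have kW: "k \<in> W m" using m(2) T by (simp add: W_def y_def field_simps)
      have "(real m)\<^sup>2 \<le> y\<^sup>2" using m(1) by (intro power_mono) auto
      also have "y\<^sup>2 = (T * (ln (\<nu> k) - ln x))\<^sup>2" by (simp add: y_def power_mult_distrib)
      finally have "ennreal (exp (- (T * (ln (\<nu> k) - ln x))\<^sup>2 / 2)) \<le> ennreal (exp (- (real m)\<^sup>2 / 2)) * indicator (W m) k"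
        using kW by (auto intro!: ennreal_leI)
      also have "\<dots> \<le> (\<Sum>m. ennreal (exp (- (real m)\<^sup>2 / 2)) * indicator (W m) k)"
      proof -
        define w where "w m = ennreal (exp (- (real m)\<^sup>2 / 2)) * indicator (W m) k" for m
        have "sum w {m} \<le> suminf w" by (rule sum_le_suminf) auto
        then have "w m \<le> suminf w" by simp
        then show ?thesis by (simp only: w_def[abs_def])
      qed
      finally show ?thesis .
    qed
    have "(\<integral>\<^sup>+k. ennreal (exp (- (T * (ln (\<nu> k) - ln x))\<^sup>2 / 2)) \<partial>count_space UNIV)
       \<le> (\<integral>\<^sup>+k. (\<Sum>m. ennreal (exp (- (real m)\<^sup>2 / 2)) * indicator (W m) k) \<partial>count_space UNIV)"
      by (intro nn_integral_mono pt)
    also have "\<dots> = (\<Sum>m. \<integral>\<^sup>+k. ennreal (exp (- (real m)\<^sup>2 / 2)) * indicator (W m) k \<partial>count_space UNIV)"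
      by (rule nn_integral_suminf) simp
    also have "\<dots> = (\<Sum>m. ennreal (exp (- (real m)\<^sup>2 / 2) * real (card (W m))))"
      using W(1) by (simp add: nn_integral_cmult_indicator emeasure_count_space ennreal_mult ennreal_of_nat_eq_real_of_nat)
    also have "\<dots> \<le> (\<Sum>m. ennreal (D * h m))"
      by (intro suminf_le ennreal_leI W(2)) auto
    also have "\<dots> = ennreal (\<Sum>m. D * h m)"
      by (rule suminf_ennreal2) (use D0 h0 hs in \<open>auto intro: summable_mult\<close>)
    also have "(\<Sum>m. D * h m) = C * suminf h * \<nu> i powr \<epsilon> * (\<nu> i / T + \<nu> i powr \<theta>)"
      by (subst suminf_mult[OF hs]) (simp add: D_def x_def)
    finally show "(\<integral>\<^sup>+k. ennreal (exp (- (T * (ln (\<nu> k) - ln (\<nu> i)))\<^sup>2 / 2)) \<partial>count_space UNIV)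
      \<le> ennreal (C * suminf h * \<nu> i powr \<epsilon> * (\<nu> i / T + \<nu> i powr \<theta>))" by (simp add: x_def)
  qed
qed

text \<open>The factor T of \<open>gaussian_mean_value\<close> turns the row sums \<nu>/T +
  \<nu>^\<theta> into \<nu> + T \<nu>^\<theta>: an off-diagonal and a diagonal part, as in the
  classical n + T for well-spaced frequencies.\<close>

lemma spaced_mean_value:
  fixes \<nu> :: "'i :: countable \<Rightarrow> real"
  assumes sp: "spaced \<theta> \<nu>" and nu: "\<And>i. \<nu> i \<ge> 1" and e: "\<epsilon> > 0" "\<epsilon> \<le> 1"
  obtains C where "C \<ge> 0" "\<And>T (g :: 'i \<Rightarrow> complex). T \<ge> 1 \<Longrightarrow> integrable (count_space UNIV) g \<Longrightarrow>
    integrable (count_space UNIV) (\<lambda>i. (norm (g i))\<^sup>2 * \<nu> i powr \<epsilon> * (\<nu> i + T * \<nu> i powr \<theta>)) \<Longrightarrow>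
    set_integrable lborel {-T..T} (\<lambda>t. (norm (LINT i|count_space UNIV. g i * cis (- t * ln (\<nu> i))))\<^sup>2) \<and>
    (LINT t:{-T..T}|lborel. (norm (LINT i|count_space UNIV. g i * cis (- t * ln (\<nu> i))))\<^sup>2)
      \<le> C * (LINT i|count_space UNIV. (norm (g i))\<^sup>2 * \<nu> i powr \<epsilon> * (\<nu> i + T * \<nu> i powr \<theta>))"
proof -
  obtain C where C: "C \<ge> 0" "\<And>T i. T \<ge> 1 \<Longrightarrow>
    (\<integral>\<^sup>+k. ennreal (exp (- (T * (ln (\<nu> k) - ln (\<nu> i)))\<^sup>2 / 2)) \<partial>count_space UNIV)
      \<le> ennreal (C * \<nu> i powr \<epsilon> * (\<nu> i / T + \<nu> i powr \<theta>))"
    using spaced_kernel[OF sp nu e] by blast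
  have c: "std_normal_density 1 > 0" by (rule normal_density_pos) simp
  show ?thesis
  proof (rule that[of "C / std_normal_density 1"])
    show "C / std_normal_density 1 \<ge> 0" using C(1) c by simp
    fix T :: real and g :: "'i \<Rightarrow> complex"
    assume T: "T \<ge> 1" and g: "integrable (count_space UNIV) g"
      and gi: "integrable (count_space UNIV) (\<lambda>i. (norm (g i))\<^sup>2 * \<nu> i powr \<epsilon> * (\<nu> i + T * \<nu> i powr \<theta>))"
    have eq: "(norm (g i))\<^sup>2 * (C * \<nu> i powr \<epsilon> * (\<nu> i / T + \<nu> i powr \<theta>)) = (C / T) * ((norm (g i))\<^sup>2 * \<nu> i powr \<epsilon> * (\<nu> i + T * \<nu> i powr \<theta>))" for i
      using T by (simp add: field_simps)
    have T0: "0 < T" using T by simp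
    have gi2: "integrable (count_space UNIV) (\<lambda>i. (norm (g i))\<^sup>2 * (C * \<nu> i powr \<epsilon> * (\<nu> i / T + \<nu> i powr \<theta>)))"
      unfolding eq by (intro integrable_mult_right gi)
    have nn: "0 \<le> C * \<nu> i powr \<epsilon> * (\<nu> i / T + \<nu> i powr \<theta>)" for i
      using C(1) T nu[of i] by (intro mult_nonneg_nonneg add_nonneg_nonneg divide_nonneg_nonneg) auto
    note gm = gaussian_mean_value[OF sigma_finite_measure_count_space g, where lam = "\<lambda>i. ln (\<nu> i)" and T = T, OF _ T0 C(2)[OF T] gi2 nn]
    show "set_integrable lborel {-T..T} (\<lambda>t. (norm (LINT i|count_space UNIV. g i * cis (- t * ln (\<nu> i))))\<^sup>2) \<and>
    (LINT t:{-T..T}|lborel. (norm (LINT i|count_space UNIV. g i * cis (- t * ln (\<nu> i))))\<^sup>2)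
      \<le> C / std_normal_density 1 * (LINT i|count_space UNIV. (norm (g i))\<^sup>2 * \<nu> i powr \<epsilon> * (\<nu> i + T * \<nu> i powr \<theta>))"
    proof
      show "set_integrable lborel {-T..T} (\<lambda>t. (norm (LINT i|count_space UNIV. g i * cis (- t * ln (\<nu> i))))\<^sup>2)"
        by (rule gm(1)) simp
      have "(LINT t:{-T..T}|lborel. (norm (LINT i|count_space UNIV. g i * cis (- t * ln (\<nu> i))))\<^sup>2)
        \<le> T / std_normal_density 1 * (LINT i|count_space UNIV. (norm (g i))\<^sup>2 * (C * \<nu> i powr \<epsilon> * (\<nu> i / T + \<nu> i powr \<theta>)))"
        by (rule gm(2)) simp
      also have "\<dots> = T / std_normal_density 1 * ((C / T) * (LINT i|count_space UNIV. (norm (g i))\<^sup>2 * \<nu> i powr \<epsilon> * (\<nu> i + T * \<nu> i powr \<theta>)))"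
        unfolding eq by (simp only: integral_mult_right_zero)
      also have "\<dots> = C / std_normal_density 1 * (LINT i|count_space UNIV. (norm (g i))\<^sup>2 * \<nu> i powr \<epsilon> * (\<nu> i + T * \<nu> i powr \<theta>))"
        using T by simp
      finally show "(LINT t:{-T..T}|lborel. (norm (LINT i|count_space UNIV. g i * cis (- t * ln (\<nu> i))))\<^sup>2)
      \<le> C / std_normal_density 1 * (LINT i|count_space UNIV. (norm (g i))\<^sup>2 * \<nu> i powr \<epsilon> * (\<nu> i + T * \<nu> i powr \<theta>))" .
    qed
  qed
qed

lemma lborel_kernel:
  fixes T w :: real assumes T: "T > 0"
  shows "(\<integral>\<^sup>+v. ennreal (exp (- (T * (v - w))\<^sup>2 / 2)) \<partial>lborel) \<le> ennreal (sqrt (2 * pi) / T)"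
proof -
  have eq: "exp (- (T * (v - w))\<^sup>2 / 2) = sqrt (2 * pi) / T * normal_density w (1 / T) v" for v
  proof -
    have "sqrt (2 * pi * (1 / T)\<^sup>2) = sqrt (2 * pi) / T" using T by (simp add: real_sqrt_mult)
    moreover have "- (v - w)\<^sup>2 / (2 * (1 / T)\<^sup>2) = - (T * (v - w))\<^sup>2 / 2"
      unfolding power_mult_distrib by (simp add: power_divide)
    ultimately show ?thesis using T unfolding normal_density_def by simp
  qed
  have "(\<integral>\<^sup>+v. ennreal (exp (- (T * (v - w))\<^sup>2 / 2)) \<partial>lborel) = ennreal (LINT v|lborel. exp (- (T * (v - w))\<^sup>2 / 2))"
    unfolding eq using T by (intro nn_integral_eq_integral integrable_mult_right) (auto simp: integrable_normal_density)
  also have "(LINT v|lborel. exp (- (T * (v - w))\<^sup>2 / 2)) = sqrt (2 * pi) / T"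
    unfolding eq using T by (simp add: integral_normal_density)
  finally show ?thesis by simp
qed

text \<open>A Plancherel bound: for Lebesgue measure the row integral of the kernel is sqrt(2 pi)/T,
  which cancels the factor T. The result is uniform in T, so a tail integral costs nothing for long
  ranges of height.\<close>

lemma laplace_mean_square:
  fixes r :: "real \<Rightarrow> real"
  assumes r [measurable]: "r \<in> borel_measurable borel" and C: "\<And>u. u \<ge> 0 \<Longrightarrow> \<bar>r u\<bar> \<le> C * exp (c * u)"
    and s: "\<sigma> > c" and U: "U \<ge> 0" and T: "T > 0"
  defines "K \<equiv> \<lambda>t. LINT u:{U<..}|lborel. of_real (r u) * exp (- Complex \<sigma> t * of_real u)"
  shows "set_integrable lborel {-T..T} (\<lambda>t. (norm (K t))\<^sup>2)"
    and "(LINT t:{-T..T}|lborel. (norm (K t))\<^sup>2)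
       \<le> sqrt (2 * pi) / std_normal_density 1 * (C\<^sup>2 * exp (- (2 * (\<sigma> - c)) * U) / (2 * (\<sigma> - c)))"
proof -
  define g where "g u = indicator {U<..} u *\<^sub>R (of_real (r u * exp (- \<sigma> * u)) :: complex)" for u
  have Kg: "K t = (LINT u|lborel. g u * cis (- t * u))" for t
  proof -
    have "exp (- Complex \<sigma> t * of_real u) = of_real (exp (- \<sigma> * u)) * cis (- t * u)" for u
      by (simp add: complex_eq_iff Re_exp Im_exp)
    then show ?thesis unfolding K_def g_def set_lebesgue_integral_def
      by (intro Bochner_Integration.integral_cong) (auto simp: scaleR_conv_of_real)
  qed
  have gm [measurable]: "g \<in> borel_measurable borel" unfolding g_def by measurable
  have gb: "norm (g u) \<le> indicator {U<..} u *\<^sub>R (C * exp (- (\<sigma> - c) * u))" for u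
  proof (cases "u > U")
    case True
    then have "\<bar>r u\<bar> * exp (- \<sigma> * u) \<le> C * exp (c * u) * exp (- \<sigma> * u)"
      using C[of u] U by (intro mult_right_mono) auto
    also have "\<dots> = C * exp (- (\<sigma> - c) * u)" by (simp add: exp_add[symmetric] algebra_simps)
    finally show ?thesis using True by (simp add: g_def norm_mult abs_mult)
  qed (simp add: g_def)
  have gi: "integrable lborel g"
  proof (rule Bochner_Integration.integrable_bound)
    show "integrable lborel (\<lambda>u. indicator {U<..} u *\<^sub>R (C * exp (- (\<sigma> - c) * u)))"
      unfolding set_integrable_def[symmetric]
      by (intro set_integrable_mult_right exp_tail_integral(1)) (use s in auto)
  qed (use gb in \<open>auto intro!: AE_I2 order_trans[OF _ abs_ge_self]\<close>)
  have g2: "(norm (g u))\<^sup>2 \<le> C\<^sup>2 * (indicator {U<..} u *\<^sub>R exp (- (2 * (\<sigma> - c)) * u))" for u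
  proof -
    have "(norm (g u))\<^sup>2 \<le> (indicator {U<..} u *\<^sub>R (C * exp (- (\<sigma> - c) * u)))\<^sup>2"
      by (rule power_mono[OF gb]) simp
    also have "\<dots> = C\<^sup>2 * (indicator {U<..} u *\<^sub>R exp (- (2 * (\<sigma> - c)) * u))"
    proof -
      have "(exp (- (\<sigma> - c) * u))\<^sup>2 = exp (- (2 * (\<sigma> - c)) * u)"
        by (simp only: exp_double[symmetric]) (rule arg_cong[of _ _ exp], simp)
      then show ?thesis by (cases "u > U") (simp_all add: power_mult_distrib)
    qed
    finally show ?thesis .
  qed
  have ti: "integrable lborel (\<lambda>u. C\<^sup>2 * (indicator {U<..} u *\<^sub>R exp (- (2 * (\<sigma> - c)) * u)))"
    using exp_tail_integral(1)[of "2 * (\<sigma> - c)" U] s unfolding set_integrable_def by (intro integrable_mult_right) auto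
  have g2i: "integrable lborel (\<lambda>u. (norm (g u))\<^sup>2)"
    by (rule Bochner_Integration.integrable_bound[OF ti]) (use g2 in \<open>auto intro!: AE_I2 order_trans[OF _ abs_ge_self]\<close>)
  have gBi: "integrable lborel (\<lambda>u. (norm (g u))\<^sup>2 * (sqrt (2 * pi) / T))" using g2i by simp
  have nn: "0 \<le> sqrt (2 * pi) / T" using T by simp
  note gm = gaussian_mean_value[OF lborel.sigma_finite_measure_axioms gi, where lam = "\<lambda>u. u" and T = T, OF _ T lborel_kernel[OF T] gBi nn]
  show "set_integrable lborel {-T..T} (\<lambda>t. (norm (K t))\<^sup>2)" unfolding Kg by (rule gm(1)) simp
  have "(LINT t:{-T..T}|lborel. (norm (K t))\<^sup>2) \<le> T / std_normal_density 1 * (LINT u|lborel. (norm (g u))\<^sup>2 * (sqrt (2 * pi) / T))"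
    unfolding Kg by (rule gm(2)) simp
  also have "\<dots> = sqrt (2 * pi) / std_normal_density 1 * (LINT u|lborel. (norm (g u))\<^sup>2)" using T by simp
  also have "\<dots> \<le> sqrt (2 * pi) / std_normal_density 1 * (LINT u|lborel. C\<^sup>2 * (indicator {U<..} u *\<^sub>R exp (- (2 * (\<sigma> - c)) * u)))"
    by (intro mult_left_mono integral_mono g2i ti g2) auto
  also have "(LINT u|lborel. C\<^sup>2 * (indicator {U<..} u *\<^sub>R exp (- (2 * (\<sigma> - c)) * u))) = C\<^sup>2 * exp (- (2 * (\<sigma> - c)) * U) / (2 * (\<sigma> - c))"
    using exp_tail_integral(2)[of "2 * (\<sigma> - c)" U] s by (simp add: set_lebesgue_integral_def)
  finally show "(LINT t:{-T..T}|lborel. (norm (K t))\<^sup>2)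
       \<le> sqrt (2 * pi) / std_normal_density 1 * (C\<^sup>2 * exp (- (2 * (\<sigma> - c)) * U) / (2 * (\<sigma> - c)))" .
qed

section \<open>Analytic continuation\<close>

lemma ln_le_iff_le_exp: "x > 0 \<Longrightarrow> ln x \<le> u \<longleftrightarrow> x \<le> exp (u :: real)"
  by (metis exp_gt_zero ln_exp ln_le_cancel_iff)

lemma poly_bound:
  fixes Q :: "real poly"
  obtains C where "C \<ge> 0" "\<And>u. u \<ge> 0 \<Longrightarrow> \<bar>poly Q u\<bar> \<le> C * (1 + u) ^ degree Q"
proof
  let ?C = "\<Sum>i\<le>degree Q. \<bar>coeff Q i\<bar>"
  show "?C \<ge> 0" by (intro sum_nonneg) auto
  fix u :: real assume u: "u \<ge> 0"
  have "\<bar>poly Q u\<bar> \<le> (\<Sum>i\<le>degree Q. \<bar>coeff Q i * u ^ i\<bar>)" unfolding poly_altdef by (rule sum_abs)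
  also have "\<dots> \<le> (\<Sum>i\<le>degree Q. \<bar>coeff Q i\<bar> * (1 + u) ^ degree Q)"
  proof (intro sum_mono)
    fix i assume i: "i \<in> {..degree Q}"
    have "u ^ i \<le> (1 + u) ^ i" using u by (intro power_mono) auto
    also have "\<dots> \<le> (1 + u) ^ degree Q" using u i by (intro power_increasing) auto
    finally show "\<bar>coeff Q i * u ^ i\<bar> \<le> \<bar>coeff Q i\<bar> * (1 + u) ^ degree Q"
      using u by (simp add: abs_mult mult_left_mono)
  qed
  also have "\<dots> = ?C * (1 + u) ^ degree Q" by (simp add: sum_distrib_right)
  finally show "\<bar>poly Q u\<bar> \<le> ?C * (1 + u) ^ degree Q" .
qed

lemma poly_exp_tendsto_0:
  assumes k: "k > 0"
  shows "((\<lambda>u. poly Q u * exp (- k * u)) \<longlongrightarrow> (0::real)) at_top"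
proof -
  obtain C where C: "C \<ge> 0" "\<And>u. u \<ge> 0 \<Longrightarrow> \<bar>poly Q u\<bar> \<le> C * (1 + u) ^ degree Q" using poly_bound by blast
  define m where "m = degree Q"
  have lim: "((\<lambda>u. C * (1 + u) ^ m * exp (- k * u)) \<longlongrightarrow> 0) at_top" using k by real_asymp
  show ?thesis
  proof (rule Lim_null_comparison[OF _ lim])
    show "\<forall>\<^sub>F u in at_top. norm (poly Q u * exp (- k * u)) \<le> C * (1 + u) ^ m * exp (- k * u)"
      using eventually_ge_at_top[of 0]
      by eventually_elim (use C in \<open>auto simp: abs_mult m_def intro!: mult_right_mono\<close>)
  qed
qed

locale dirichlet_pair = beurling_system p n \<theta> for p n :: "nat \<Rightarrow> real" and \<theta> :: real +
  fixes a :: "nat \<Rightarrow> real" and b :: "nat \<Rightarrow> complex" and q :: real and P :: "real poly"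
  assumes a_0: "a 0 = 1" and b_0: "b 0 = 1"
    and inverse: "formal_inverse n (\<lambda>j. complex_of_real (a j)) b"
    and a_nonneg: "\<And>j. 0 \<le> a j"
    and a_bigo: "\<And>\<epsilon>. \<epsilon> > 0 \<Longrightarrow> a \<in> O(\<lambda>j. n j powr \<epsilon>)"
    and b_bigo: "\<And>\<epsilon>. \<epsilon> > 0 \<Longrightarrow> (\<lambda>j. norm (b j)) \<in> O(\<lambda>j. n j powr \<epsilon>)"
    and P_nonzero: "P \<noteq> 0"
    and summatory_asymp: "(\<lambda>x. summatory n a x - x * poly P (ln x)) \<in> O(\<lambda>x. x powr \<theta> * ln x powr q)"
begin

lemma a_le:
  assumes "\<epsilon> > 0" obtains C where "C \<ge> 0" "\<And>j. a j \<le> C * n j powr \<epsilon>"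
  using bigo_nat_all[OF a_bigo[OF assms]] n_pos by (metis abs_ge_self order_trans powr_gt_zero less_irrefl)

lemma b_le:
  assumes "\<epsilon> > 0" obtains C where "C \<ge> 0" "\<And>j. norm (b j) \<le> C * n j powr \<epsilon>"
  using bigo_nat_all[OF b_bigo[OF assms]] n_pos by (metis abs_norm_cancel powr_gt_zero less_irrefl)

definition remainder :: "real \<Rightarrow> real" where
  "remainder u = summatory n a (exp u) - exp u * poly P u"

definition laplace :: "complex \<Rightarrow> complex" where
  "laplace s = (LINT u:{0<..}|lborel. of_real (remainder u) * exp (- s * of_real u))"

text \<open>This is (s - 1)^(d + 1) times the continuation, d the degree of P, multiplied out so
  that no division occurs. It is therefore holomorphic at 1 too, and zeros and growth are studied
  for it in place of \<open>F\<close>.\<close>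

definition F_reg :: "complex \<Rightarrow> complex" where
  "F_reg s = s * ((\<Sum>k\<le>degree P. of_real (poly ((pderiv ^^ k) P) 0) * (s - 1) ^ (degree P - k))
     + (s - 1) ^ (degree P + 1) * laplace s)"

text \<open>
  The value at the pole is the junk value \<open>F 1 = 0\<close>.
\<close>

definition F :: "complex \<Rightarrow> complex" where
  "F s = F_reg s / (s - 1) ^ (degree P + 1)"

lemma summatory_mono: "x \<le> y \<Longrightarrow> summatory n a x \<le> summatory n a y"
  unfolding summatory_def by (intro sum_mono2 n_finite) (auto simp: a_nonneg)

lemma summatory_nonneg: "0 \<le> summatory n a x"
  unfolding summatory_def by (intro sum_nonneg a_nonneg)

lemma remainder_measurable [measurable]: "remainder \<in> borel_measurable borel"
proof -
  have "(\<lambda>u. summatory n a (exp u)) \<in> borel_measurable borel"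
    by (intro borel_measurable_mono) (auto simp: mono_def intro: summatory_mono)
  moreover have "(\<lambda>u. exp u * poly P u) \<in> borel_measurable borel"
    by (intro borel_measurable_continuous_onI continuous_intros)
  ultimately show ?thesis unfolding remainder_def by (rule borel_measurable_diff)
qed

text \<open>The power of ln x is absorbed by the \<delta> in the exponent. Below the threshold of
  the asymptotics the summatory function and the polynomial part are bounded separately by a
  constant.\<close>

lemma remainder_bound:
  assumes d: "\<delta> > 0"
  obtains C where "C \<ge> 0" "\<And>u. u \<ge> 0 \<Longrightarrow> \<bar>remainder u\<bar> \<le> C * exp ((\<theta> + \<delta>) * u)"
proof -
  have "(\<lambda>x. x powr \<theta> * ln x powr q) \<in> O(\<lambda>x. x powr (\<theta> + \<delta>))" using d by real_asymp
  with summatory_asymp have "(\<lambda>x. summatory n a x - x * poly P (ln x)) \<in> O(\<lambda>x. x powr (\<theta> + \<delta>))"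
    by (rule landau_o.big_trans)
  then obtain c where c: "c > 0" "eventually (\<lambda>x. norm (summatory n a x - x * poly P (ln x)) \<le> c * norm (x powr (\<theta> + \<delta>))) at_top"
    by (elim landau_o.bigE)
  then obtain x0 where x0: "\<And>x. x \<ge> x0 \<Longrightarrow> \<bar>summatory n a x - x * poly P (ln x)\<bar> \<le> c * x powr (\<theta> + \<delta>)"
    unfolding eventually_at_top_linorder by fastforce
  define u0 where "u0 = max 0 (ln (max 1 x0))"
  obtain D where D: "D \<ge> 0" "\<And>u. u \<ge> 0 \<Longrightarrow> \<bar>poly P u\<bar> \<le> D * (1 + u) ^ degree P" using poly_bound by blast
  define E where "E = summatory n a (exp u0) + exp u0 * (D * (1 + u0) ^ degree P)"
  have E0: "E \<ge> 0" unfolding E_def u0_def using D(1) summatory_nonneg by (intro add_nonneg_nonneg mult_nonneg_nonneg) auto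
  show ?thesis
  proof (rule that[of "c + E"])
    show "c + E \<ge> 0" using c E0 by simp
    fix u :: real assume u: "u \<ge> 0"
    show "\<bar>remainder u\<bar> \<le> (c + E) * exp ((\<theta> + \<delta>) * u)"
    proof (cases "u \<ge> u0")
      case True
      then have "ln (max 1 x0) \<le> u" by (simp add: u0_def)
      then have "max 1 x0 \<le> exp u" by (simp add: ln_le_iff_le_exp ln_ge_iff)
      then have "\<bar>remainder u\<bar> \<le> c * (exp u) powr (\<theta> + \<delta>)" using x0[of "exp u"] by (simp add: remainder_def)
      also have "(exp u) powr (\<theta> + \<delta>) = exp ((\<theta> + \<delta>) * u)" by (simp add: powr_def)
      also have "c * exp ((\<theta> + \<delta>) * u) \<le> (c + E) * exp ((\<theta> + \<delta>) * u)" using E0 by (intro mult_right_mono) auto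
      finally show ?thesis .
    next
      case False
      then have uu: "u \<le> u0" by simp
      have "\<bar>remainder u\<bar> \<le> \<bar>summatory n a (exp u)\<bar> + \<bar>exp u * poly P u\<bar>" unfolding remainder_def by (rule abs_triangle_ineq4)
      also have "\<dots> \<le> E" unfolding E_def
      proof (intro add_mono)
        show "\<bar>summatory n a (exp u)\<bar> \<le> summatory n a (exp u0)"
          using summatory_nonneg[of "exp u"] summatory_mono[of "exp u" "exp u0"] uu by simp
        have "\<bar>exp u * poly P u\<bar> \<le> exp u * (D * (1 + u) ^ degree P)" using D(2)[OF u] by (simp add: abs_mult)
        also have "\<dots> \<le> exp u0 * (D * (1 + u0) ^ degree P)"
          using uu u D(1) by (intro mult_mono mult_left_mono power_mono) auto
        finally show "\<bar>exp u * poly P u\<bar> \<le> exp u0 * (D * (1 + u0) ^ degree P)" .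
      qed
      also have "E \<le> (c + E) * 1" using c by simp
      also have "\<dots> \<le> (c + E) * exp ((\<theta> + \<delta>) * u)"
        using c E0 u theta d by (intro mult_left_mono) auto
      finally show ?thesis .
    qed
  qed
qed

lemma laplace_holo: "laplace holomorphic_on {s. Re s > \<theta>}"
  unfolding holomorphic_on_open[OF open_halfspace_Re_gt]
proof clarify
  fix s assume s: "Re s > \<theta>"
  define \<delta> where "\<delta> = (Re s - \<theta>) / 2"
  have d: "\<delta> > 0" "Re s > \<theta> + \<delta>" using s by (auto simp: \<delta>_def field_simps)
  obtain C where C: "C \<ge> 0" "\<And>u. u \<ge> 0 \<Longrightarrow> \<bar>remainder u\<bar> \<le> C * exp ((\<theta> + \<delta>) * u)"
    using remainder_bound[OF d(1)] by blast
  have "laplace holomorphic_on {s. Re s > \<theta> + \<delta>}"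
    unfolding laplace_def by (rule laplace_holomorphic[OF remainder_measurable C(2)])
  then show "\<exists>D. (laplace has_field_derivative D) (at s)"
    using d(2) holomorphic_on_open[OF open_halfspace_Re_gt] by blast
qed

lemma F_reg_holo: "F_reg holomorphic_on {s. Re s > \<theta>}"
  unfolding F_reg_def by (intro holomorphic_intros laplace_holo)

lemma F_holo: "F holomorphic_on ({s. Re s > \<theta>} - {1})"
  unfolding F_def by (intro holomorphic_intros holomorphic_on_subset[OF F_reg_holo]) auto

text \<open>The formula comes from s times the Laplace transform of the summatory function A(exp u):
  the main term exp u P(u) gives \<open>polar P s 0\<close>, the remainder gives
  \<open>laplace s\<close>. That this agrees with the Dirichlet series is proved in
  \<open>F_sums\<close>.\<close>

lemma F_eq: "s \<noteq> 1 \<Longrightarrow> F s = s * (polar P s 0 + laplace s)"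
proof -
  assume s: "s \<noteq> 1"
  have "(\<Sum>k\<le>degree P. of_real (poly ((pderiv ^^ k) P) 0) * (s - 1) ^ (degree P - k)) = polar P s 0 * (s - 1) ^ (degree P + 1)"
    unfolding polar_def sum_distrib_right
  proof (intro sum.cong refl)
    fix k assume "k \<in> {..degree P}"
    then have eq: "(s - 1) ^ (degree P + 1) = (s - 1) ^ (degree P - k) * (s - 1) ^ (k + 1)" by (simp flip: power_add)
    then show "of_real (poly ((pderiv ^^ k) P) 0) * (s - 1) ^ (degree P - k) =
        of_real (poly ((pderiv ^^ k) P) 0) / (s - 1) ^ (k + 1) * (s - 1) ^ (degree P + 1)"
      unfolding eq using s by simp
  qed
  then have "F_reg s = s * (polar P s 0 + laplace s) * (s - 1) ^ (degree P + 1)"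
    unfolding F_reg_def by (simp only: distrib_right distrib_left mult_ac)
  then show ?thesis using s by (simp add: F_def)
qed

definition partial_sum :: "real \<Rightarrow> complex \<Rightarrow> complex" where
  "partial_sum U s = (\<Sum>j | n j \<le> exp U. of_real (a j) * exp (- s * of_real (ln (n j))))"

definition tail :: "real \<Rightarrow> complex \<Rightarrow> complex" where
  "tail U s = (LINT u:{U<..}|lborel. of_real (remainder u) * exp (- s * of_real u))"

lemma has_bochner_integral_exp_Icc:
  fixes s :: complex
  assumes s: "s \<noteq> 0" and l: "l \<le> U"
  shows "has_bochner_integral lborel (\<lambda>u. indicator {l..U} u *\<^sub>R exp (- s * of_real u))
     ((exp (- s * of_real l) - exp (- s * of_real U)) / s)"
proof -
  have "((\<lambda>z. - exp (- s * z) / s) has_field_derivative exp (- s * of_real u)) (at (of_real u))" for u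
    using s by (auto intro!: derivative_eq_intros)
  then have "((\<lambda>u. - exp (- s * of_real u) / s) has_vector_derivative exp (- s * of_real u)) (at u within {l..U})" for u
    by (rule has_vector_derivative_at_within[OF has_vector_derivative_real_field])
  from has_bochner_integral_FTC_Icc[OF l this]
  have "has_bochner_integral lborel (\<lambda>u. indicator {l..U} u *\<^sub>R exp (- s * of_real u))
     (- exp (- s * of_real U) / s - (- exp (- s * of_real l) / s))"
    by (simp add: continuous_intros)
  moreover have "- exp (- s * of_real U) / s - (- exp (- s * of_real l) / s) = (exp (- s * of_real l) - exp (- s * of_real U)) / s"
    by (simp add: diff_divide_distrib)
  ultimately show ?thesis by (simp only:)
qed

text \<open>Partial summation as an integral: the j-th coefficient is present for u in [ln n_j, U],
  where exp(-s u) integrates to (exp(-s ln n_j) - exp(-s U))/s. The polynomial part has the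
  antiderivative found in \<open>polar_antiderivative\<close>.\<close>

lemma head_integral:
  assumes s: "s \<noteq> 0" "s \<noteq> 1" and U: "U \<ge> 0"
  shows "has_bochner_integral lborel (\<lambda>u. indicator {0..U} u *\<^sub>R (of_real (remainder u) * exp (- s * of_real u)))
     ((partial_sum U s - of_real (summatory n a (exp U)) * exp (- s * of_real U)) / s
       - (polar P s 0 - polar P s U * exp ((1 - s) * of_real U)))"
proof -
  let ?J = "{j. n j \<le> exp U}"
  have J: "0 \<le> ln (n j)" "ln (n j) \<le> U" if "j \<in> ?J" for j
    using that n_ge1[of j] n_pos[of j] by (auto simp: ln_le_iff_le_exp)
  have 1: "has_bochner_integral lborel (\<lambda>u. \<Sum>j\<in>?J. of_real (a j) * (indicator {ln (n j)..U} u *\<^sub>R exp (- s * of_real u)))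
     (\<Sum>j\<in>?J. of_real (a j) * ((exp (- s * of_real (ln (n j))) - exp (- s * of_real U)) / s))"
    by (intro has_bochner_integral_sum has_bochner_integral_mult_right has_bochner_integral_exp_Icc s J)
  have 2: "has_bochner_integral lborel (\<lambda>u. indicator {0..U} u *\<^sub>R (of_real (poly P u) * exp ((1 - s) * of_real u)))
     (- polar P s U * exp ((1 - s) * of_real U) - (- polar P s 0 * exp ((1 - s) * of_real 0)))"
    by (rule has_bochner_integral_FTC_Icc[OF U polar_antiderivative[OF s(2)]]) (intro continuous_intros)
  have pt: "indicator {0..U} u *\<^sub>R (of_real (remainder u) * exp (- s * of_real u)) =
     (\<Sum>j\<in>?J. of_real (a j) * (indicator {ln (n j)..U} u *\<^sub>R exp (- s * of_real u)))
     - indicator {0..U} u *\<^sub>R (of_real (poly P u) * exp ((1 - s) * of_real u))" for u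
  proof (cases "u \<in> {0..U}")
    case True
    have "summatory n a (exp u) = (\<Sum>j\<in>{j\<in>?J. n j \<le> exp u}. a j)"
      unfolding summatory_def using True by (intro sum.cong) (auto intro: order_trans)
    also have "\<dots> = (\<Sum>j\<in>?J. if n j \<le> exp u then a j else 0)"
      by (rule sum.inter_filter) (rule n_finite)
    also have "\<dots> = (\<Sum>j\<in>?J. a j * indicator {ln (n j)..U} u)"
      using True n_pos by (intro sum.cong) (auto simp: ln_le_iff_le_exp indicator_def)
    finally have "of_real (summatory n a (exp u)) * exp (- s * of_real u) =
        (\<Sum>j\<in>?J. of_real (a j) * (indicator {ln (n j)..U} u *\<^sub>R exp (- s * of_real u)))"
      by (simp add: sum_distrib_right scaleR_conv_of_real mult.assoc)
    moreover have "exp ((1 - s) * of_real u) = of_real (exp u) * exp (- s * of_real u)"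
      by (simp add: exp_of_real[symmetric] exp_add[symmetric] algebra_simps)
    ultimately show ?thesis using True by (simp add: remainder_def algebra_simps)
  next
    case False
    have "(\<Sum>j\<in>?J. of_real (a j) * (indicator {ln (n j)..U} u *\<^sub>R exp (- s * of_real u))) = 0"
    proof (rule sum.neutral, rule ballI)
      fix j assume "j \<in> ?J"
      from J(1)[OF this] False have "u \<notin> {ln (n j)..U}" by auto
      then show "of_real (a j) * (indicator {ln (n j)..U} u *\<^sub>R exp (- s * of_real u)) = 0" by simp
    qed
    then show ?thesis using False by simp
  qed
  have v: "(\<Sum>j\<in>?J. of_real (a j) * ((exp (- s * of_real (ln (n j))) - exp (- s * of_real U)) / s)) =
     (partial_sum U s - of_real (summatory n a (exp U)) * exp (- s * of_real U)) / s"
    unfolding partial_sum_def summatory_def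
    by (simp add: sum_divide_distrib sum_distrib_right diff_divide_distrib right_diff_distrib sum_subtractf)
  have "has_bochner_integral lborel (\<lambda>u. indicator {0..U} u *\<^sub>R (of_real (remainder u) * exp (- s * of_real u)))
    ((\<Sum>j\<in>?J. of_real (a j) * ((exp (- s * of_real (ln (n j))) - exp (- s * of_real U)) / s))
     - (- polar P s U * exp ((1 - s) * of_real U) - (- polar P s 0 * exp ((1 - s) * of_real 0))))"
    unfolding pt by (rule has_bochner_integral_diff[OF 1 2])
  then show ?thesis unfolding v by (simp add: algebra_simps)
qed

text \<open>Cutting the Laplace integral at U turns its head back into a partial sum. Unlike the
  series, the identity holds in all of Re s > \<theta> apart from the pole, and U stays free to be
  chosen in terms of the height.\<close>

lemma F_identity:
  assumes s: "Re s > \<theta>" "s \<noteq> 1" and U: "U \<ge> 0"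
  shows "F s = partial_sum U s - of_real (summatory n a (exp U)) * exp (- s * of_real U)
     + s * polar P s U * exp ((1 - s) * of_real U) + s * tail U s"
proof -
  have s0: "s \<noteq> 0" using s theta by auto
  define \<delta> where "\<delta> = (Re s - \<theta>) / 2"
  have d: "\<delta> > 0" "Re s > \<theta> + \<delta>" using s by (auto simp: \<delta>_def field_simps)
  obtain C where C: "C \<ge> 0" "\<And>u. u \<ge> 0 \<Longrightarrow> \<bar>remainder u\<bar> \<le> C * exp ((\<theta> + \<delta>) * u)"
    using remainder_bound[OF d(1)] by blast
  let ?g = "\<lambda>u. of_real (remainder u) * exp (- s * of_real u)"
  have t: "integrable lborel (\<lambda>u. indicator {U<..} u *\<^sub>R ?g u)"
    using laplace_integrand(1)[OF remainder_measurable C(2) d(2) U] by (simp add: set_integrable_def)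
  note h = head_integral[OF s0 s(2) U]
  have "laplace s = (LINT u|lborel. indicator {0..U} u *\<^sub>R ?g u + indicator {U<..} u *\<^sub>R ?g u)"
    unfolding laplace_def set_lebesgue_integral_def
  proof (rule integral_cong_AE)
    have "AE u in lborel. u \<noteq> (0::real)" by (rule AE_lborel_singleton)
    then show "AE u in lborel. indicator {0<..} u *\<^sub>R ?g u = indicator {0..U} u *\<^sub>R ?g u + indicator {U<..} u *\<^sub>R ?g u"
      by eventually_elim (use U in \<open>auto simp: indicator_def\<close>)
  qed measurable
  also have "\<dots> = (LINT u|lborel. indicator {0..U} u *\<^sub>R ?g u) + tail U s"
    unfolding tail_def set_lebesgue_integral_def
    by (rule Bochner_Integration.integral_add[OF integrable.intros[OF h] t])
  also have "(LINT u|lborel. indicator {0..U} u *\<^sub>R ?g u) = (partial_sum U s - of_real (summatory n a (exp U)) * exp (- s * of_real U)) / s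
       - (polar P s 0 - polar P s U * exp ((1 - s) * of_real U))"
    using h by (rule has_bochner_integral_integral_eq)
  finally show ?thesis unfolding F_eq[OF s(2)] using s0 by (simp add: field_simps)
qed

end

section \<open>The mollified series\<close>

lemma count_space_nat_prod:
  fixes f h :: "nat \<Rightarrow> 'c :: {real_normed_field, banach, second_countable_topology}"
  assumes f: "summable (\<lambda>j. norm (f j))" and h: "summable (\<lambda>j. norm (h j))"
  shows "integrable (count_space UNIV) (\<lambda>(j, k). f j * h k)"
    and "(LINT jk|count_space UNIV. (case jk of (j, k) \<Rightarrow> f j * h k)) = suminf f * suminf h"
proof -
  let ?M = "count_space (UNIV :: nat set)"
  have eq: "?M \<Otimes>\<^sub>M ?M = count_space UNIV" by (subst pair_measure_countable) auto
  interpret P: pair_sigma_finite ?M ?M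
    by (intro pair_sigma_finite.intro sigma_finite_measure_count_space)
  have fi: "integrable ?M f" "integrable ?M h" using f h by (simp_all add: integrable_count_space_nat_iff)
  have i: "integrable (?M \<Otimes>\<^sub>M ?M) (\<lambda>(j, k). f j * h k)"
  proof (rule P.Fubini_integrable)
    have "(\<lambda>x. LINT y|?M. norm (case (x, y) of (j, k) \<Rightarrow> f j * h k)) = (\<lambda>x. norm (f x) * (LINT y|?M. norm (h y)))"
      by (simp add: norm_mult)
    then show "integrable ?M (\<lambda>x. LINT y|?M. norm (case (x, y) of (j, k) \<Rightarrow> f j * h k))" using fi by simp
    show "AE x in ?M. integrable ?M (\<lambda>y. case (x, y) of (j, k) \<Rightarrow> f j * h k)" using fi by simp
    show "(\<lambda>(j, k). f j * h k) \<in> borel_measurable (?M \<Otimes>\<^sub>M ?M)" unfolding eq by simp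
  qed
  then show "integrable (count_space UNIV) (\<lambda>(j, k). f j * h k)" unfolding eq .
  have "integral\<^sup>L (?M \<Otimes>\<^sub>M ?M) (\<lambda>(j, k). f j * h k) = (LINT j|?M. LINT k|?M. f j * h k)"
    using P.integral_fst[OF i] by simp
  also have "\<dots> = (LINT j|?M. f j) * (LINT k|?M. h k)" by simp
  also have "\<dots> = suminf f * suminf h" using fi by (simp add: integral_count_space_nat)
  finally show "(LINT jk|count_space UNIV. (case jk of (j, k) \<Rightarrow> f j * h k)) = suminf f * suminf h" unfolding eq .
qed

context dirichlet_pair
begin

lemma coeff_summable:
  fixes c :: "nat \<Rightarrow> real"
  assumes s: "\<sigma> > 1" and c: "\<And>\<epsilon>. \<epsilon> > 0 \<Longrightarrow> \<exists>C\<ge>0. \<forall>j. \<bar>c j\<bar> \<le> C * n j powr \<epsilon>"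
  shows "summable (\<lambda>j. \<bar>c j\<bar> * n j powr (- \<sigma>))"
proof -
  define e where "e = (\<sigma> - 1) / 2"
  have e: "e > 0" "\<sigma> - e > 1" using s by (auto simp: e_def field_simps)
  obtain C where C: "C \<ge> 0" "\<And>j. \<bar>c j\<bar> \<le> C * n j powr e" using c[OF e(1)] by blast
  have "summable (\<lambda>j. C * n j powr (- (\<sigma> - e)))" by (intro summable_mult summable_n e)
  then show ?thesis
  proof (rule summable_comparison_test'[where N = 0])
    fix j
    have "\<bar>c j\<bar> * n j powr (- \<sigma>) \<le> C * n j powr e * n j powr (- \<sigma>)" by (intro mult_right_mono C) auto
    also have "\<dots> = C * n j powr (- (\<sigma> - e))" by (simp add: powr_add[symmetric])
    finally show "norm (\<bar>c j\<bar> * n j powr (- \<sigma>)) \<le> C * n j powr (- (\<sigma> - e))" by simp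
  qed
qed

lemma a_summable: "\<sigma> > 1 \<Longrightarrow> summable (\<lambda>j. a j * n j powr (- \<sigma>))"
proof -
  assume s: "\<sigma> > 1"
  have "\<exists>C\<ge>0. \<forall>j. \<bar>a j\<bar> \<le> C * n j powr \<epsilon>" if e: "\<epsilon> > 0" for \<epsilon>
  proof -
    obtain C where "C \<ge> 0" "\<And>j. a j \<le> C * n j powr \<epsilon>" using a_le[OF e] by blast
    then show ?thesis using a_nonneg by (intro exI[of _ C]) simp
  qed
  from coeff_summable[OF s this] show ?thesis by (simp add: a_nonneg)
qed

lemma b_summable: "\<sigma> > 1 \<Longrightarrow> summable (\<lambda>j. norm (b j) * n j powr (- \<sigma>))"
proof -
  assume s: "\<sigma> > 1"
  have "\<exists>C\<ge>0. \<forall>j. \<bar>norm (b j)\<bar> \<le> C * n j powr \<epsilon>" if e: "\<epsilon> > 0" for \<epsilon>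
  proof -
    obtain C where "C \<ge> 0" "\<And>j. norm (b j) \<le> C * n j powr \<epsilon>" using b_le[OF e] by blast
    then show ?thesis by (intro exI[of _ C]) simp
  qed
  from coeff_summable[OF s this] show ?thesis by simp
qed

definition nexp :: "complex \<Rightarrow> nat \<Rightarrow> complex" where
  "nexp s j = exp (- s * of_real (ln (n j)))"

lemma norm_nexp: "norm (nexp s j) = n j powr (- Re s)"
  using n_pos[of j] by (simp add: nexp_def norm_exp_eq_Re powr_def)

lemma nexp_powr: "nexp s j = 1 / of_real (n j) powr s"
proof -
  have "(of_real (n j) :: complex) \<noteq> 0" using n_pos[of j] by auto
  then show ?thesis using n_pos[of j] by (simp add: nexp_def powr_def exp_minus divide_inverse Ln_of_real)
qed

lemma a_nexp_summable: "Re s > 1 \<Longrightarrow> summable (\<lambda>j. norm (of_real (a j) * nexp s j))"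
  using a_summable[of "Re s"] by (simp add: norm_mult norm_nexp a_nonneg)

lemma b_nexp_summable: "Re s > 1 \<Longrightarrow> summable (\<lambda>j. norm (b j * nexp s j))"
  using b_summable[of "Re s"] by (simp add: norm_mult norm_nexp)

lemma tail_bound:
  assumes d: "\<delta> > 0"
  obtains C where "C \<ge> 0" "\<And>s U. Re s > \<theta> + \<delta> \<Longrightarrow> U \<ge> 0 \<Longrightarrow>
      norm (tail U s) \<le> C * exp (- (Re s - (\<theta> + \<delta>)) * U) / (Re s - (\<theta> + \<delta>))"
proof -
  obtain C where C: "C \<ge> 0" "\<And>u. u \<ge> 0 \<Longrightarrow> \<bar>remainder u\<bar> \<le> C * exp ((\<theta> + \<delta>) * u)"
    using remainder_bound[OF d] by blast
  show ?thesis
    by (rule that[OF C(1)]) (unfold tail_def, rule laplace_integrand(2)[OF remainder_measurable C(2)])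
qed

text \<open>For Re s > 1 every correction term of \<open>F_identity\<close> decays exponentially up
  to polynomial factors, so letting U grow identifies the continuation with the limit of the
  truncated series.\<close>

lemma F_partial_sum_tendsto:
  assumes s: "Re s > 1"
  shows "((\<lambda>U. partial_sum U s) \<longlongrightarrow> F s) at_top"
proof -
  have s1: "s \<noteq> 1" "Re s > \<theta>" using s theta by auto
  define \<sigma> where "\<sigma> = Re s"
  define \<delta> where "\<delta> = (1 - \<theta>) / 2"
  have d: "\<delta> > 0" "Re s > \<theta> + \<delta>" using s theta by (auto simp: \<delta>_def field_simps)
  obtain C where C: "C \<ge> 0" "\<And>u. u \<ge> 0 \<Longrightarrow> \<bar>remainder u\<bar> \<le> C * exp ((\<theta> + \<delta>) * u)"
    using remainder_bound[OF d(1)] by blast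
  obtain C2 where C2: "C2 \<ge> 0" "\<And>s U. Re s > \<theta> + \<delta> \<Longrightarrow> U \<ge> 0 \<Longrightarrow>
      norm (tail U s) \<le> C2 * exp (- (Re s - (\<theta> + \<delta>)) * U) / (Re s - (\<theta> + \<delta>))"
    using tail_bound[OF d(1)] by blast
  define k where "k = \<sigma> - (\<theta> + \<delta>)"
  have k: "k > 0" "\<sigma> - 1 > 0" using d s by (auto simp: k_def \<sigma>_def)
  have nexp: "norm (exp ((1 - s) * of_real U)) = exp (- (\<sigma> - 1) * U)" "norm (exp (- s * of_real U)) = exp (- \<sigma> * U)" for U
    by (simp_all add: norm_exp_eq_Re \<sigma>_def)
  have pl: "((\<lambda>U. of_real (poly Q U) * exp ((1 - s) * of_real U)) \<longlongrightarrow> 0) at_top" for Q :: "real poly"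
  proof (rule tendsto_norm_zero_cancel)
    have "((\<lambda>U. \<bar>poly Q U * exp (- (\<sigma> - 1) * U)\<bar>) \<longlongrightarrow> 0) at_top"
      using poly_exp_tendsto_0[OF k(2), of Q] by (rule tendsto_rabs_zero)
    then show "((\<lambda>U. norm (of_real (poly Q U) * exp ((1 - s) * of_real U))) \<longlongrightarrow> 0) at_top"
      by (simp add: norm_mult norm_exp_eq_Re abs_mult \<sigma>_def)
  qed
  have polar: "((\<lambda>U. s * polar P s U * exp ((1 - s) * of_real U)) \<longlongrightarrow> 0) at_top"
  proof -
    have "((\<lambda>U. s * (\<Sum>k\<le>degree P. (of_real (poly ((pderiv ^^ k) P) U) * exp ((1 - s) * of_real U)) / (s - 1) ^ (k + 1))) \<longlongrightarrow> s * (\<Sum>k\<le>degree P. 0 / (s - 1) ^ (k + 1))) at_top"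
      using s1 by (intro tendsto_intros pl) auto
    then show ?thesis by (simp add: polar_def sum_distrib_right sum_distrib_left mult_ac)
  qed
  have rem: "((\<lambda>U. of_real (remainder U) * exp (- s * of_real U)) \<longlongrightarrow> 0) at_top"
  proof (rule Lim_null_comparison)
    show "((\<lambda>U. C * exp (- k * U)) \<longlongrightarrow> 0) at_top" using k(1) by real_asymp
    show "\<forall>\<^sub>F U in at_top. norm (of_real (remainder U) * exp (- s * of_real U)) \<le> C * exp (- k * U)"
      using eventually_ge_at_top[of 0]
    proof eventually_elim
      case (elim U)
      have "\<bar>remainder U\<bar> * exp (- \<sigma> * U) \<le> C * exp ((\<theta> + \<delta>) * U) * exp (- \<sigma> * U)"
        using C(2)[OF elim] by (intro mult_right_mono) auto
      also have "\<dots> = C * exp (- k * U)" by (simp add: k_def exp_add[symmetric] algebra_simps)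
      finally show ?case by (simp only: norm_mult nexp norm_of_real)
    qed
  qed
  have tl: "((\<lambda>U. s * tail U s) \<longlongrightarrow> s * 0) at_top"
  proof (rule tendsto_mult_left, rule Lim_null_comparison)
    show "((\<lambda>U. C2 * exp (- k * U) / k) \<longlongrightarrow> 0) at_top" using k(1) by real_asymp
    show "\<forall>\<^sub>F U in at_top. norm (tail U s) \<le> C2 * exp (- k * U) / k"
      using eventually_ge_at_top[of 0] unfolding k_def \<sigma>_def by eventually_elim (rule C2(2)[OF d(2)])
  qed
  have A: "of_real (summatory n a (exp U)) * exp (- s * of_real U) =
      of_real (remainder U) * exp (- s * of_real U) + of_real (poly P U) * exp ((1 - s) * of_real U)" for U
  proof -
    have "exp ((1 - s) * of_real U) = of_real (exp U) * exp (- s * of_real U)"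
      by (simp add: exp_of_real[symmetric] exp_add[symmetric] algebra_simps)
    then show ?thesis by (simp add: remainder_def algebra_simps)
  qed
  have "((\<lambda>U. F s + (of_real (remainder U) * exp (- s * of_real U) + of_real (poly P U) * exp ((1 - s) * of_real U))
      - s * polar P s U * exp ((1 - s) * of_real U) - s * tail U s) \<longlongrightarrow> F s + (0 + 0) - 0 - s * 0) at_top"
    by (intro tendsto_add tendsto_diff tendsto_const rem pl polar tl)
  moreover have "\<forall>\<^sub>F U in at_top. F s + (of_real (remainder U) * exp (- s * of_real U) + of_real (poly P U) * exp ((1 - s) * of_real U))
      - s * polar P s U * exp ((1 - s) * of_real U) - s * tail U s = partial_sum U s"
    using eventually_ge_at_top[of 0]
  proof eventually_elim
    case (elim U)
    show ?case unfolding F_identity[OF s1(2,1) elim] A by (simp only: algebra_simps)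
  qed
  ultimately have "((\<lambda>U. partial_sum U s) \<longlongrightarrow> F s + (0 + 0) - 0 - s * 0) at_top"
    by (rule Lim_transform_eventually)
  then show ?thesis by simp
qed

text \<open>\<open>partial_sum\<close> orders the terms by size and \<open>sums\<close> by index.
  Absolute convergence gives unordered summation, and the sets of all j with n_j \<le> exp U exhaust
  the indices, so both orders have the same limit.\<close>

lemma F_sums:
  assumes s: "Re s > 1"
  shows "(\<lambda>j. of_real (a j) * nexp s j) sums F s"
proof -
  let ?f = "\<lambda>j. of_real (a j) * nexp s j"
  have sm: "summable (\<lambda>j. norm (?f j))" by (rule a_nexp_summable[OF s])
  have "(?f has_sum suminf ?f) UNIV"
    by (rule norm_summable_imp_has_sum[OF sm]) (use summable_norm_cancel[OF sm] in \<open>simp add: summable_sums\<close>)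
  then have "(sum ?f \<longlongrightarrow> suminf ?f) (finite_subsets_at_top UNIV)" by (simp add: has_sum_def)
  moreover have "filterlim (\<lambda>U. {j. n j \<le> exp U}) (finite_subsets_at_top UNIV) at_top"
    unfolding filterlim_finite_subsets_at_top
  proof clarify
    fix Y :: "nat set" assume Y: "finite Y"
    show "\<forall>\<^sub>F U in at_top. finite {j. n j \<le> exp U} \<and> Y \<subseteq> {j. n j \<le> exp U} \<and> {j. n j \<le> exp U} \<subseteq> UNIV"
      using eventually_ge_at_top[of "\<Sum>j\<in>Y. n j"]
    proof eventually_elim
      case (elim U)
      have "n j \<le> exp U" if "j \<in> Y" for j
      proof -
        have "n j \<le> (\<Sum>j\<in>Y. n j)" using Y that by (intro member_le_sum) (auto intro: less_imp_le n_pos)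
        also have "\<dots> \<le> exp U" using elim exp_ge_add_one_self[of U] by linarith
        finally show ?thesis .
      qed
      then show ?case using n_finite by auto
    qed
  qed
  ultimately have "((\<lambda>U. sum ?f {j. n j \<le> exp U}) \<longlongrightarrow> suminf ?f) at_top" by (rule filterlim_compose)
  then have "((\<lambda>U. partial_sum U s) \<longlongrightarrow> suminf ?f) at_top" by (simp add: partial_sum_def nexp_def)
  with F_partial_sum_tendsto[OF s] have "suminf ?f = F s" by (intro tendsto_unique[of at_top]) auto
  then show ?thesis using summable_norm_cancel[OF sm] by (simp add: sums_iff)
qed

section \<open>The convolution identity and the series of \<open>F\<close> times the
  mollifier\<close>

lemma nexp_mult: "nexp s j * nexp s k = exp (- s * of_real (ln (n j * n k)))"
  using n_pos[of j] n_pos[of k] by (simp add: nexp_def ln_mult exp_add[symmetric] algebra_simps)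

definition mollifier :: "real \<Rightarrow> complex \<Rightarrow> complex" where
  "mollifier X s = (\<Sum>k | n k \<le> X. b k * nexp s k)"

text \<open>The coefficients of F M - 1 are indexed by pairs and are not merged at equal products;
  this matches \<open>spaced_pairs\<close>, and absolute values remain bounded by those of a and
  b.\<close>

definition pair_coeff :: "real \<Rightarrow> nat \<times> nat \<Rightarrow> complex" where
  "pair_coeff X = (\<lambda>(j, k). if n k \<le> X \<and> X < n j * n k then of_real (a j) * b k else 0)"

text \<open>Grouped by the value of the product, the inner sums are those of
  \<open>dirichlet_conv\<close>, which vanish except at 1. A product of size at most X forces n_k
  \<le> X, so the truncation of the mollifier cannot be felt here.\<close>

lemma small_pairs_sum:
  assumes X: "X \<ge> 1"
  shows "finite {(j, k). n j * n k \<le> X}"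
    and "(\<Sum>(j, k) | n j * n k \<le> X. of_real (a j) * nexp s j * (b k * nexp s k)) = 1"
proof -
  let ?S = "{(j, k). n j * n k \<le> X}"
  show fin: "finite ?S"
  proof (rule finite_subset)
    have "n j \<le> n j * n k \<and> n k \<le> n j * n k" for j k
      using n_ge1[of j] n_ge1[of k] by simp
    then show "?S \<subseteq> {j. n j \<le> X} \<times> {k. n k \<le> X}" by (auto intro: order_trans)
  qed (intro finite_cartesian_product n_finite)
  let ?g = "\<lambda>jk. case jk of (j, k) \<Rightarrow> of_real (a j) * nexp s j * (b k * nexp s k)"
  let ?v = "\<lambda>jk. case jk of (j, k) \<Rightarrow> n j * n k"
  have "sum ?g ?S = (\<Sum>\<nu>\<in>?v ` ?S. sum ?g {jk \<in> ?S. ?v jk = \<nu>})" by (rule sum.image_gen[OF fin])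
  also have "\<dots> = (\<Sum>\<nu>\<in>?v ` ?S. exp (- s * of_real (ln \<nu>)) * (if \<nu> = 1 then 1 else 0))"
  proof (rule sum.cong[OF refl])
    fix \<nu> assume "\<nu> \<in> ?v ` ?S"
    then have "{jk \<in> ?S. ?v jk = \<nu>} = {(j, k). n j * n k = \<nu>}" by auto
    then have "sum ?g {jk \<in> ?S. ?v jk = \<nu>} = (\<Sum>jk\<in>{(j, k). n j * n k = \<nu>}. exp (- s * of_real (ln \<nu>)) * (case jk of (j, k) \<Rightarrow> of_real (a j) * b k))"
    proof (intro sum.cong refl)
      fix jk assume "jk \<in> {(j, k). n j * n k = \<nu>}"
      then have "exp (- s * of_real (ln \<nu>)) = nexp s (fst jk) * nexp s (snd jk)"
        using nexp_mult[of s "fst jk" "snd jk"] by auto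
      then show "?g jk = exp (- s * of_real (ln \<nu>)) * (case jk of (j, k) \<Rightarrow> of_real (a j) * b k)"
        by (simp add: split_beta mult_ac)
    qed
    also have "\<dots> = exp (- s * of_real (ln \<nu>)) * dirichlet_conv n (\<lambda>j. of_real (a j)) b \<nu>"
      by (simp add: dirichlet_conv_def sum_distrib_left)
    finally show "sum ?g {jk \<in> ?S. ?v jk = \<nu>} = exp (- s * of_real (ln \<nu>)) * (if \<nu> = 1 then 1 else 0)"
      using inverse by (simp add: formal_inverse_def)
  qed
  also have "\<dots> = (\<Sum>\<nu>\<in>?v ` ?S. if \<nu> = 1 then 1 else 0)" by (intro sum.cong) auto
  also have "\<dots> = 1"
  proof -
    have "(1::real) \<in> ?v ` ?S" using X n_0 by (force intro: image_eqI[of _ _ "(0, 0)"])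
    moreover have "finite (?v ` ?S)" using fin by (rule finite_imageI)
    ultimately show ?thesis by (subst sum.delta) simp_all
  qed
  finally show "sum ?g ?S = 1" .
qed

text \<open>The product of F and the mollifier is an absolutely convergent double series; its part
  with product at most X sums to 1 and is exactly what subtracting 1 removes.\<close>

lemma mollified_identity:
  assumes s: "Re s > 1" and X: "X \<ge> 1"
  shows "integrable (count_space UNIV) (\<lambda>(j, k). pair_coeff X (j, k) * (nexp s j * nexp s k))"
    and "F s * mollifier X s - 1 = (LINT jk|count_space UNIV. (case jk of (j, k) \<Rightarrow> pair_coeff X (j, k) * (nexp s j * nexp s k)))"
proof -
  let ?f = "\<lambda>j. of_real (a j) * nexp s j"
  let ?h = "\<lambda>k. if n k \<le> X then b k * nexp s k else 0"
  let ?u = "\<lambda>(j, k). ?f j * ?h k"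
  let ?p = "\<lambda>(j, k). pair_coeff X (j, k) * (nexp s j * nexp s k)"
  let ?w = "\<lambda>(j, k). if n j * n k \<le> X then of_real (a j) * nexp s j * (b k * nexp s k) else 0"
  have fs: "summable (\<lambda>j. norm (?f j))" by (rule a_nexp_summable[OF s])
  have hs: "summable (\<lambda>k. norm (?h k))"
    by (rule summable_finite[of "{k. n k \<le> X}"]) (use n_finite in auto)
  have hsum: "suminf ?h = mollifier X s"
    by (subst suminf_finite[of "{k. n k \<le> X}"]) (use n_finite in \<open>auto simp: mollifier_def\<close>)
  have u: "integrable (count_space UNIV) ?u" "integral\<^sup>L (count_space UNIV) ?u = F s * mollifier X s"
    using count_space_nat_prod[OF fs hs] F_sums[OF s] hsum by (simp_all add: sums_iff)
  have le: "n k \<le> n j * n k" for j k using n_ge1[of j] n_ge1[of k] by simp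
  have p_eq: "?p jk = ?u jk - ?w jk" for jk
    using le[of "snd jk" "fst jk"] by (auto simp: pair_coeff_def split: prod.splits)
  have fin: "finite {jk. ?w jk \<noteq> 0}"
    by (rule finite_subset[OF _ small_pairs_sum(1)[OF X]]) (auto split: if_splits)
  have w: "integrable (count_space UNIV) ?w"
    using le by (intro Bochner_Integration.integrable_bound[OF u(1)] AE_I2) (auto split: prod.splits intro: order_trans)
  have "integral\<^sup>L (count_space UNIV) ?w = (\<Sum>jk | jk \<in> UNIV \<and> ?w jk \<noteq> 0. ?w jk)"
    by (rule lebesgue_integral_count_space_finite_support) (use fin in simp)
  also have "\<dots> = (\<Sum>jk | (case jk of (j, k) \<Rightarrow> n j * n k \<le> X). ?w jk)"
    by (rule sum.mono_neutral_left) (use small_pairs_sum(1)[OF X] in \<open>auto split: if_splits\<close>)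
  also have "\<dots> = (\<Sum>(j, k) | n j * n k \<le> X. of_real (a j) * nexp s j * (b k * nexp s k))"
    by (intro sum.cong) auto
  also have "\<dots> = 1" by (rule small_pairs_sum(2)[OF X])
  finally have w1: "integral\<^sup>L (count_space UNIV) ?w = 1" .
  show "integrable (count_space UNIV) ?p"
    unfolding p_eq[abs_def] by (rule Bochner_Integration.integrable_diff[OF u(1) w])
  show "F s * mollifier X s - 1 = integral\<^sup>L (count_space UNIV) ?p"
    unfolding p_eq[abs_def] Bochner_Integration.integral_diff[OF u(1) w] u(2) w1 ..
qed

text \<open>Each pair drops out once X passes its product, and the full double series of absolute
  values dominates. The limit yields both the absence of zeros and a lower bound for F, without
  summing the inverse series.\<close>

lemma mollified_tendsto:
  assumes s: "Re s > 1"
  shows "(\<lambda>i. F s * mollifier (1 + real i) s) \<longlonglongrightarrow> 1"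
proof -
  let ?p = "\<lambda>i. \<lambda>(j, k). pair_coeff (1 + real i) (j, k) * (nexp s j * nexp s k)"
  have "(\<lambda>i. integral\<^sup>L (count_space UNIV) (?p i)) \<longlonglongrightarrow> (LINT jk|count_space (UNIV :: (nat \<times> nat) set). 0)"
  proof (rule integral_dominated_convergence)
    show "integrable (count_space UNIV) (\<lambda>(j, k). norm (of_real (a j) * nexp s j) * norm (b k * nexp s k))"
      by (rule count_space_nat_prod(1)) (use a_nexp_summable[OF s] b_nexp_summable[OF s] in simp_all)
    show "AE jk in count_space UNIV. (\<lambda>i. ?p i jk) \<longlonglongrightarrow> 0"
    proof (rule AE_I2, clarify)
      fix j k :: nat
      have "eventually (\<lambda>i. real i \<ge> n j * n k) sequentially"
        using filterlim_real_sequentially unfolding filterlim_at_top by blast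
      then have "eventually (\<lambda>i. pair_coeff (1 + real i) (j, k) * (nexp s j * nexp s k) = 0) sequentially"
        by eventually_elim (auto simp: pair_coeff_def)
      then show "(\<lambda>i. pair_coeff (1 + real i) (j, k) * (nexp s j * nexp s k)) \<longlonglongrightarrow> 0"
        by (rule tendsto_eventually)
    qed
    show "AE jk in count_space UNIV. norm (?p i jk) \<le> (case jk of (j, k) \<Rightarrow> norm (of_real (a j) * nexp s j) * norm (b k * nexp s k))" for i
      by (rule AE_I2) (auto simp: pair_coeff_def norm_mult)
  qed auto
  moreover have "integral\<^sup>L (count_space UNIV) (?p i) = F s * mollifier (1 + real i) s - 1" for i
    using mollified_identity(2)[OF s, of "1 + real i"] by simp
  ultimately have "(\<lambda>i. F s * mollifier (1 + real i) s - 1) \<longlonglongrightarrow> 0" by simp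
  from tendsto_add[OF this tendsto_const[of 1]] show ?thesis by simp
qed

lemma F_nonzero:
  assumes s: "Re s > 1"
  shows "F s \<noteq> 0"
  using mollified_tendsto[OF s] by (auto simp: LIMSEQ_const_iff)

end

section \<open>Mean squares on vertical lines\<close>

lemma poly_exp_bound:
  fixes Q :: "real poly"
  assumes e: "\<eta> > 0"
  obtains C where "C \<ge> 0" "\<And>u. u \<ge> 0 \<Longrightarrow> \<bar>poly Q u\<bar> \<le> C * exp (\<eta> * u)"
proof -
  obtain C where C: "C \<ge> 0" "\<And>u. u \<ge> 0 \<Longrightarrow> \<bar>poly Q u\<bar> \<le> C * (1 + u) ^ degree Q" using poly_bound by blast
  define m where "m = real (degree Q + 1)"
  define c where "c = 1 + m / \<eta>"
  have m: "m > 0" by (simp add: m_def)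
  have c: "c \<ge> 1" using m e by (simp add: c_def)
  have b: "(1 + u) ^ degree Q \<le> c ^ degree Q * exp (\<eta> * u)" if u: "u \<ge> 0" for u
  proof -
    have "\<eta> * u / m \<le> exp (\<eta> * u / m)" using exp_ge_add_one_self[of "\<eta> * u / m"] by linarith
    then have "(m / \<eta>) * (\<eta> * u / m) \<le> (m / \<eta>) * exp (\<eta> * u / m)"
      using m e by (intro mult_left_mono) auto
    then have "u \<le> (m / \<eta>) * exp (\<eta> * u / m)" using m e by simp
    moreover have "1 \<le> exp (\<eta> * u / m)" using m e u by simp
    ultimately have "1 + u \<le> exp (\<eta> * u / m) + (m / \<eta>) * exp (\<eta> * u / m)" by linarith
    then have "1 + u \<le> c * exp (\<eta> * u / m)" by (simp add: c_def distrib_right)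
    then have "(1 + u) ^ degree Q \<le> (c * exp (\<eta> * u / m)) ^ degree Q" using u by (intro power_mono) auto
    also have "\<dots> = c ^ degree Q * exp (real (degree Q) * (\<eta> * u / m))" by (simp only: power_mult_distrib exp_of_nat_mult)
    also have "\<dots> \<le> c ^ degree Q * exp (\<eta> * u)"
    proof -
      have "real (degree Q) * (\<eta> * u / m) = (real (degree Q) / m) * (\<eta> * u)" by simp
      also have "\<dots> \<le> 1 * (\<eta> * u)" using e u by (intro mult_right_mono) (auto simp: m_def)
      finally show ?thesis using c by simp
    qed
    finally show ?thesis .
  qed
  show ?thesis
  proof (rule that[of "C * c ^ degree Q"])
    show "C * c ^ degree Q \<ge> 0" using C c by simp
    fix u :: real assume u: "u \<ge> 0"
    have "\<bar>poly Q u\<bar> \<le> C * (1 + u) ^ degree Q" by (rule C(2)[OF u])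
    also have "\<dots> \<le> C * (c ^ degree Q * exp (\<eta> * u))" by (intro mult_left_mono b u C(1))
    finally show "\<bar>poly Q u\<bar> \<le> C * c ^ degree Q * exp (\<eta> * u)" by simp
  qed
qed

text \<open>
  The leading terms of \<open>s * polar P s u\<close> and \<open>P u\<close> cancel, which gains the factor \<open>1 / norm (s - 1)\<close>.
\<close>

lemma polar_cancellation:
  assumes e: "\<eta> > 0"
  obtains C where "C \<ge> 0" "\<And>u s. u \<ge> 0 \<Longrightarrow> norm (s - 1) \<ge> 1 \<Longrightarrow>
     norm (s * polar P s u - of_real (poly P u)) \<le> C * exp (\<eta> * u) / norm (s - 1)"
proof -
  have "\<forall>k. \<exists>C\<ge>0. \<forall>u\<ge>0. \<bar>poly ((pderiv ^^ k) P) u\<bar> \<le> C * exp (\<eta> * u)"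
    using poly_exp_bound[OF e] by metis
  then obtain c where c: "\<And>k. c k \<ge> 0" "\<And>k u. u \<ge> 0 \<Longrightarrow> \<bar>poly ((pderiv ^^ k) P) u\<bar> \<le> c k * exp (\<eta> * u)" by metis
  define d where "d = degree P"
  show ?thesis
  proof (rule that[of "(\<Sum>k\<le>d. c k + c (Suc k))"])
    show "(\<Sum>k\<le>d. c k + c (Suc k)) \<ge> 0" by (intro sum_nonneg add_nonneg_nonneg c)
    fix u :: real and s :: complex assume u: "u \<ge> 0" and s: "norm (s - 1) \<ge> 1"
    have s1: "s \<noteq> 1" using s by auto
    have D: "(s - 1) * polar P s u - of_real (poly P u) = (\<Sum>k\<le>d. of_real (poly ((pderiv ^^ Suc k) P) u) / (s - 1) ^ (k + 1))"
      unfolding d_def by (rule polar_shift[OF s1])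
    have "s * polar P s u - of_real (poly P u) = polar P s u + ((s - 1) * polar P s u - of_real (poly P u))"
      by (simp add: algebra_simps)
    also have "\<dots> = (\<Sum>k\<le>d. (of_real (poly ((pderiv ^^ k) P) u) + of_real (poly ((pderiv ^^ Suc k) P) u)) / (s - 1) ^ (k + 1))"
      unfolding D by (simp add: polar_def d_def sum.distrib add_divide_distrib)
    also have "norm \<dots> \<le> (\<Sum>k\<le>d. (c k + c (Suc k)) * (exp (\<eta> * u) / norm (s - 1)))"
    proof (rule sum_norm_le)
      fix k
      have "norm (of_real (poly ((pderiv ^^ k) P) u) + of_real (poly ((pderiv ^^ Suc k) P) u) :: complex) \<le>
          \<bar>poly ((pderiv ^^ k) P) u\<bar> + \<bar>poly ((pderiv ^^ Suc k) P) u\<bar>"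
        by (rule order_trans[OF norm_triangle_ineq]) (simp only: norm_of_real)
      also have "\<dots> \<le> (c k + c (Suc k)) * exp (\<eta> * u)" unfolding distrib_right by (intro add_mono c(2) u)
      finally have 1: "norm (of_real (poly ((pderiv ^^ k) P) u) + of_real (poly ((pderiv ^^ Suc k) P) u) :: complex) \<le> (c k + c (Suc k)) * exp (\<eta> * u)" .
      have "norm (s - 1) ^ 1 \<le> norm (s - 1) ^ (k + 1)" by (rule power_increasing[OF _ s]) simp
      then have "norm (of_real (poly ((pderiv ^^ k) P) u) + of_real (poly ((pderiv ^^ Suc k) P) u) :: complex) / norm (s - 1) ^ (k + 1) \<le>
          (c k + c (Suc k)) * exp (\<eta> * u) / norm (s - 1)"
        using 1 s c(1) by (intro frac_le) (auto intro!: mult_nonneg_nonneg add_nonneg_nonneg)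
      then show "norm ((of_real (poly ((pderiv ^^ k) P) u) + of_real (poly ((pderiv ^^ Suc k) P) u)) / (s - 1) ^ (k + 1)) \<le>
         (c k + c (Suc k)) * (exp (\<eta> * u) / norm (s - 1))" by (simp only: norm_divide norm_power times_divide_eq_right)
    qed
    also have "\<dots> = (\<Sum>k\<le>d. c k + c (Suc k)) * exp (\<eta> * u) / norm (s - 1)" by (simp only: sum_distrib_right times_divide_eq_right sum_divide_distrib)
    finally show "norm (s * polar P s u - of_real (poly P u)) \<le> (\<Sum>k\<le>d. c k + c (Suc k)) * exp (\<eta> * u) / norm (s - 1)" .
  qed
qed

context dirichlet_pair
begin

lemma nexp_Complex: "nexp (Complex \<sigma> t) j = of_real (n j powr (- \<sigma>)) * cis (- t * ln (n j))"
  using n_pos[of j] by (simp add: nexp_def complex_eq_iff Re_exp Im_exp powr_def)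

text \<open>Only frequencies x > X occur, so x + T x^\<theta> is at most x (1 + T X^(\<theta> - 1)).
  On Re s = 1 + \<delta> the remaining exponents add up to -1 - \<delta>: the surplus pays for the
  coefficient bounds and the spacing loss, and the weights \<open>w\<close> are still summable over
  pairs.\<close>

lemma mollified_mean_square:
  assumes d: "\<delta> > 0" "\<delta> \<le> 1"
  obtains C where "C \<ge> 0" "\<And>T X. T \<ge> 1 \<Longrightarrow> X \<ge> 1 \<Longrightarrow>
    set_integrable lborel {-T..T} (\<lambda>t. (norm (F (Complex (1 + \<delta>) t) * mollifier X (Complex (1 + \<delta>) t) - 1))\<^sup>2) \<and>
    (LINT t:{-T..T}|lborel. (norm (F (Complex (1 + \<delta>) t) * mollifier X (Complex (1 + \<delta>) t) - 1))\<^sup>2) \<le> C * (1 + T * X powr (\<theta> - 1))"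
proof -
  define \<nu> where "\<nu> = (\<lambda>(j, k). n j * n k)"
  have nu1: "\<nu> jk \<ge> 1" for jk
    using n_ge1[of "fst jk"] n_ge1[of "snd jk"] mult_mono[of 1 "n (fst jk)" 1 "n (snd jk)"] by (simp add: \<nu>_def split_beta)
  have sp: "spaced \<theta> \<nu>" unfolding \<nu>_def by (rule spaced_pairs)
  obtain C where C: "C \<ge> 0" "\<And>T (g :: nat \<times> nat \<Rightarrow> complex). T \<ge> 1 \<Longrightarrow> integrable (count_space UNIV) g \<Longrightarrow>
    integrable (count_space UNIV) (\<lambda>i. (norm (g i))\<^sup>2 * \<nu> i powr (\<delta>/2) * (\<nu> i + T * \<nu> i powr \<theta>)) \<Longrightarrow>
    set_integrable lborel {-T..T} (\<lambda>t. (norm (LINT i|count_space UNIV. g i * cis (- t * ln (\<nu> i))))\<^sup>2) \<and>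
    (LINT t:{-T..T}|lborel. (norm (LINT i|count_space UNIV. g i * cis (- t * ln (\<nu> i))))\<^sup>2)
      \<le> C * (LINT i|count_space UNIV. (norm (g i))\<^sup>2 * \<nu> i powr (\<delta>/2) * (\<nu> i + T * \<nu> i powr \<theta>))"
    using spaced_mean_value[OF sp nu1, of "\<delta>/2"] d by auto
  have d4: "\<delta> / 4 > 0" using d by simp
  obtain Ca where Ca: "Ca \<ge> 0" "\<And>j. a j \<le> Ca * n j powr (\<delta>/4)" using a_le[OF d4] by blast
  obtain Cb where Cb: "Cb \<ge> 0" "\<And>j. norm (b j) \<le> Cb * n j powr (\<delta>/4)" using b_le[OF d4] by blast
  define w where "w = (\<lambda>(j, k). n j powr (- (1 + \<delta>)) * n k powr (- (1 + \<delta>)))"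
  have wnu: "w jk = \<nu> jk powr (- (1 + \<delta>))" for jk
    by (simp add: w_def \<nu>_def split_beta powr_mult n_pos less_imp_le)
  have sn: "summable (\<lambda>j. norm (n j powr (- (1 + \<delta>))))" using summable_n[of "1 + \<delta>"] d by simp
  have wi: "integrable (count_space UNIV) w" unfolding w_def by (rule count_space_nat_prod(1)[OF sn sn])
  define W where "W = integral\<^sup>L (count_space UNIV) w"
  have W0: "W \<ge> 0" unfolding W_def w_def by (intro integral_nonneg_AE AE_I2) auto
  show ?thesis
  proof (rule that[of "C * ((Ca * Cb)\<^sup>2 * W)"])
    show "C * ((Ca * Cb)\<^sup>2 * W) \<ge> 0" using C(1) W0 by simp
    fix T X :: real assume T: "T \<ge> 1" and X: "X \<ge> 1"
    define g where "g jk = pair_coeff X jk * of_real (\<nu> jk powr (- (1 + \<delta>)))" for jk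
    have ge: "(case jk of (j, k) \<Rightarrow> pair_coeff X (j, k) * (nexp (Complex (1 + \<delta>) t) j * nexp (Complex (1 + \<delta>) t) k)) = g jk * cis (- t * ln (\<nu> jk))" for jk t
    proof (cases jk)
      case (Pair j k)
      have "cis (- t * ln (n j)) * cis (- t * ln (n k)) = cis (- t * ln (\<nu> jk))"
        using n_pos[of j] n_pos[of k] by (simp add: Pair \<nu>_def cis_mult ln_mult algebra_simps)
      moreover have "\<nu> jk powr (- (1 + \<delta>)) = n j powr (- (1 + \<delta>)) * n k powr (- (1 + \<delta>))"
        using wnu[of jk] by (simp add: w_def Pair)
      ultimately show ?thesis unfolding nexp_Complex g_def Pair by (simp add: mult_ac)
    qed
    have s1: "Re (Complex (1 + \<delta>) t) > 1" for t using d by simp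
    have gi: "integrable (count_space UNIV) g"
    proof -
      have "(\<lambda>(j, k). pair_coeff X (j, k) * (nexp (Complex (1 + \<delta>) 0) j * nexp (Complex (1 + \<delta>) 0) k)) = g"
      proof (rule ext)
        fix jk
        show "(case jk of (j, k) \<Rightarrow> pair_coeff X (j, k) * (nexp (Complex (1 + \<delta>) 0) j * nexp (Complex (1 + \<delta>) 0) k)) = g jk"
          using ge[where jk = jk and t = 0] by simp
      qed
      with mollified_identity(1)[OF s1[of 0] X] show ?thesis by simp
    qed
    have Hg: "F (Complex (1 + \<delta>) t) * mollifier X (Complex (1 + \<delta>) t) - 1 = (LINT jk|count_space UNIV. g jk * cis (- t * ln (\<nu> jk)))" for t
      unfolding mollified_identity(2)[OF s1 X] ge ..
    have gb: "norm (pair_coeff X jk) \<le> Ca * Cb * \<nu> jk powr (\<delta>/4)" for jk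
    proof (cases jk)
      case (Pair j k)
      have "norm (pair_coeff X jk) \<le> a j * norm (b k)" by (simp add: Pair pair_coeff_def norm_mult a_nonneg)
      also have "\<dots> \<le> (Ca * n j powr (\<delta>/4)) * (Cb * n k powr (\<delta>/4))"
        using Ca Cb a_nonneg by (intro mult_mono) auto
      also have "\<dots> = Ca * Cb * \<nu> jk powr (\<delta>/4)" using n_pos by (simp add: Pair \<nu>_def powr_mult less_imp_le)
      finally show ?thesis .
    qed
    have key: "(norm (g jk))\<^sup>2 * \<nu> jk powr (\<delta>/2) * (\<nu> jk + T * \<nu> jk powr \<theta>) \<le> (Ca * Cb)\<^sup>2 * (1 + T * X powr (\<theta> - 1)) * w jk" for jk
    proof (cases "\<nu> jk > X")
      case False
      then have "g jk = 0" by (auto simp: g_def pair_coeff_def \<nu>_def split: prod.splits)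
      then show ?thesis using T X by (simp add: wnu)
    next
      case True
      define x where "x = \<nu> jk"
      have x: "x \<ge> 1" "x > X" using True nu1 by (auto simp: x_def)
      have "(norm (g jk))\<^sup>2 \<le> (Ca * Cb * x powr (\<delta>/4) * x powr (- (1 + \<delta>)))\<^sup>2"
        using gb[of jk] by (intro power_mono) (auto simp: g_def x_def norm_mult intro!: mult_right_mono)
      also have "\<dots> = (Ca * Cb)\<^sup>2 * (x powr (\<delta>/4) * x powr (\<delta>/4) * (x powr (- (1 + \<delta>)) * x powr (- (1 + \<delta>))))"
        by (simp add: power2_eq_square)
      also have "x powr (\<delta>/4) * x powr (\<delta>/4) * (x powr (- (1 + \<delta>)) * x powr (- (1 + \<delta>))) = x powr (\<delta>/2 + - (2 + 2 * \<delta>))"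
        by (simp only: powr_add[symmetric]) (simp add: field_simps)
      finally have 1: "(norm (g jk))\<^sup>2 \<le> (Ca * Cb)\<^sup>2 * x powr (\<delta>/2 + - (2 + 2 * \<delta>))" .
      have xt: "x + T * x powr \<theta> = x * (1 + T * x powr (\<theta> - 1))"
        using x by (simp add: powr_diff distrib_left)
      have "x powr (\<theta> - 1) \<le> X powr (\<theta> - 1)" using x X theta by (intro powr_mono2') auto
      then have 2: "x + T * x powr \<theta> \<le> x powr 1 * (1 + T * X powr (\<theta> - 1))"
        unfolding xt using x T by (intro mult_mono) (auto intro!: mult_left_mono)
      have "(norm (g jk))\<^sup>2 * x powr (\<delta>/2) * (x + T * x powr \<theta>) \<le>
         ((Ca * Cb)\<^sup>2 * x powr (\<delta>/2 + - (2 + 2 * \<delta>))) * x powr (\<delta>/2) * (x powr 1 * (1 + T * X powr (\<theta> - 1)))"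
        using 1 2 x T by (intro mult_mono mult_right_mono mult_nonneg_nonneg) auto
      also have "\<dots> = (Ca * Cb)\<^sup>2 * (1 + T * X powr (\<theta> - 1)) * (x powr (\<delta>/2 + - (2 + 2 * \<delta>)) * x powr (\<delta>/2) * x powr 1)" by (simp only: mult_ac)
      also have "x powr (\<delta>/2 + - (2 + 2 * \<delta>)) * x powr (\<delta>/2) * x powr 1 = w jk"
        unfolding wnu x_def[symmetric] powr_add[symmetric] by (rule arg_cong[of _ _ "(powr) x"]) (simp add: field_simps)
      finally show ?thesis by (simp add: x_def)
    qed
    have gi2: "integrable (count_space UNIV) (\<lambda>i. (norm (g i))\<^sup>2 * \<nu> i powr (\<delta>/2) * (\<nu> i + T * \<nu> i powr \<theta>))"
    proof (rule Bochner_Integration.integrable_bound)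
      show "integrable (count_space UNIV) (\<lambda>jk. (Ca * Cb)\<^sup>2 * (1 + T * X powr (\<theta> - 1)) * w jk)"
        by (intro integrable_mult_right wi)
      show "AE jk in count_space UNIV. norm ((norm (g jk))\<^sup>2 * \<nu> jk powr (\<delta>/2) * (\<nu> jk + T * \<nu> jk powr \<theta>)) \<le> norm ((Ca * Cb)\<^sup>2 * (1 + T * X powr (\<theta> - 1)) * w jk)"
      proof (rule AE_I2)
        fix jk
        have "0 \<le> (norm (g jk))\<^sup>2 * \<nu> jk powr (\<delta>/2) * (\<nu> jk + T * \<nu> jk powr \<theta>)"
          using nu1[of jk] T by (intro mult_nonneg_nonneg add_nonneg_nonneg) auto
        then show "norm ((norm (g jk))\<^sup>2 * \<nu> jk powr (\<delta>/2) * (\<nu> jk + T * \<nu> jk powr \<theta>)) \<le> norm ((Ca * Cb)\<^sup>2 * (1 + T * X powr (\<theta> - 1)) * w jk)"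
          using key[of jk] unfolding real_norm_def by linarith
      qed
    qed simp
    have "(LINT i|count_space UNIV. (norm (g i))\<^sup>2 * \<nu> i powr (\<delta>/2) * (\<nu> i + T * \<nu> i powr \<theta>)) \<le> (LINT jk|count_space UNIV. (Ca * Cb)\<^sup>2 * (1 + T * X powr (\<theta> - 1)) * w jk)"
      by (intro integral_mono gi2 integrable_mult_right wi key)
    also have "\<dots> = (Ca * Cb)\<^sup>2 * (1 + T * X powr (\<theta> - 1)) * W" unfolding W_def by (rule integral_mult_right_zero)
    finally have "C * (LINT i|count_space UNIV. (norm (g i))\<^sup>2 * \<nu> i powr (\<delta>/2) * (\<nu> i + T * \<nu> i powr \<theta>)) \<le> C * ((Ca * Cb)\<^sup>2 * (1 + T * X powr (\<theta> - 1)) * W)"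
      using C(1) by (rule mult_left_mono)
    also have "\<dots> = C * ((Ca * Cb)\<^sup>2 * W) * (1 + T * X powr (\<theta> - 1))" by (simp only: mult_ac)
    finally show "set_integrable lborel {-T..T} (\<lambda>t. (norm (F (Complex (1 + \<delta>) t) * mollifier X (Complex (1 + \<delta>) t) - 1))\<^sup>2) \<and>
    (LINT t:{-T..T}|lborel. (norm (F (Complex (1 + \<delta>) t) * mollifier X (Complex (1 + \<delta>) t) - 1))\<^sup>2) \<le> C * ((Ca * Cb)\<^sup>2 * W) * (1 + T * X powr (\<theta> - 1))"
      using C(2)[OF T gi gi2] unfolding Hg by (auto intro: order_trans)
  qed
qed

text \<open>Up to x^(2 \<delta>), the weight x^(-2 \<sigma>) (x + T x^\<theta>) is (x^(1 - \<theta>)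
  + T)/x. Giving away N^(4 \<delta>) covers this loss, those of the coefficients and of the spacing,
  and leaves the summable factor x^(-1 - \<delta>). It is applied to a for F itself and to b for the
  mollifier.\<close>

lemma dirichlet_polynomial_mean_square:
  fixes c :: "nat \<Rightarrow> complex"
  assumes d: "\<delta> > 0" "\<delta> \<le> 1" and c: "\<And>\<epsilon>. \<epsilon> > 0 \<Longrightarrow> \<exists>C\<ge>0. \<forall>j. norm (c j) \<le> C * n j powr \<epsilon>"
  defines "\<sigma> \<equiv> (1 + \<theta>) / 2 - \<delta>"
  obtains C where "C \<ge> 0" "\<And>T N. T \<ge> 1 \<Longrightarrow> N \<ge> 1 \<Longrightarrow>
    set_integrable lborel {-T..T} (\<lambda>t. (norm (\<Sum>j | n j \<le> N. c j * nexp (Complex \<sigma> t) j))\<^sup>2) \<and>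
    (LINT t:{-T..T}|lborel. (norm (\<Sum>j | n j \<le> N. c j * nexp (Complex \<sigma> t) j))\<^sup>2) \<le> C * N powr (4 * \<delta>) * (N powr (1 - \<theta>) + T)"
proof -
  obtain C where C: "C \<ge> 0" "\<And>T (g :: nat \<Rightarrow> complex). T \<ge> 1 \<Longrightarrow> integrable (count_space UNIV) g \<Longrightarrow>
    integrable (count_space UNIV) (\<lambda>i. (norm (g i))\<^sup>2 * n i powr (\<delta>/2) * (n i + T * n i powr \<theta>)) \<Longrightarrow>
    set_integrable lborel {-T..T} (\<lambda>t. (norm (LINT i|count_space UNIV. g i * cis (- t * ln (n i))))\<^sup>2) \<and>
    (LINT t:{-T..T}|lborel. (norm (LINT i|count_space UNIV. g i * cis (- t * ln (n i))))\<^sup>2)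
      \<le> C * (LINT i|count_space UNIV. (norm (g i))\<^sup>2 * n i powr (\<delta>/2) * (n i + T * n i powr \<theta>))"
    using spaced_mean_value[OF spaced_n n_ge1, of "\<delta>/2"] d by auto
  have d4: "\<delta> / 4 > 0" using d by simp
  obtain Cc where Cc: "Cc \<ge> 0" "\<And>j. norm (c j) \<le> Cc * n j powr (\<delta>/4)" using c[OF d4] by blast
  define w where "w j = n j powr (- (1 + \<delta>))" for j
  have wi: "integrable (count_space UNIV) w"
    using summable_n[of "1 + \<delta>"] d by (simp add: integrable_count_space_nat_iff w_def)
  define W where "W = integral\<^sup>L (count_space UNIV) w"
  have W0: "W \<ge> 0" unfolding W_def w_def by (intro integral_nonneg_AE AE_I2) auto
  show ?thesis
  proof (rule that[of "C * (Cc\<^sup>2 * W)"])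
    show "C * (Cc\<^sup>2 * W) \<ge> 0" using C(1) W0 by simp
    fix T N :: real assume T: "T \<ge> 1" and N: "N \<ge> 1"
    define g where "g j = (if n j \<le> N then c j * of_real (n j powr (- \<sigma>)) else 0)" for j
    have fin: "finite {j. n j \<le> N}" by (rule n_finite)
    have ng: "summable (\<lambda>j. norm (g j))"
      by (rule summable_finite[OF fin]) (auto simp: g_def)
    have gi: "integrable (count_space UNIV) g" using ng by (simp add: integrable_count_space_nat_iff)
    have gt: "(\<Sum>j | n j \<le> N. c j * nexp (Complex \<sigma> t) j) = (LINT j|count_space UNIV. g j * cis (- t * ln (n j)))" for t
    proof -
      have gi': "integrable (count_space UNIV) (\<lambda>j. g j * cis (- t * ln (n j)))"
        using ng by (simp add: integrable_count_space_nat_iff norm_mult)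
      have "(LINT j|count_space UNIV. g j * cis (- t * ln (n j))) = (\<Sum>j. g j * cis (- t * ln (n j)))"
        by (rule integral_count_space_nat[OF gi'])
      also have "\<dots> = (\<Sum>j | n j \<le> N. g j * cis (- t * ln (n j)))"
        by (rule suminf_finite[OF fin]) (auto simp: g_def)
      also have "\<dots> = (\<Sum>j | n j \<le> N. c j * nexp (Complex \<sigma> t) j)"
        by (intro sum.cong) (auto simp: g_def nexp_Complex)
      finally show ?thesis ..
    qed
    define B where "B = N powr (4 * \<delta>) * (N powr (1 - \<theta>) + T)"
    have B0: "B \<ge> 0" unfolding B_def using T by (intro mult_nonneg_nonneg add_nonneg_nonneg) auto
    have key: "(norm (g j))\<^sup>2 * n j powr (\<delta>/2) * (n j + T * n j powr \<theta>) \<le> Cc\<^sup>2 * B * w j" for j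
    proof (cases "n j \<le> N")
      case False
      then show ?thesis using B0 by (simp add: g_def w_def)
    next
      case True
      define x where "x = n j"
      have x: "x \<ge> 1" "x \<le> N" using True n_ge1 by (auto simp: x_def)
      have "(norm (g j))\<^sup>2 \<le> (Cc * x powr (\<delta>/4) * x powr (- \<sigma>))\<^sup>2"
        using Cc(2)[of j] True by (intro power_mono) (auto simp: g_def x_def norm_mult intro!: mult_right_mono)
      also have "\<dots> = Cc\<^sup>2 * (x powr (\<delta>/4) * x powr (\<delta>/4) * (x powr (- \<sigma>) * x powr (- \<sigma>)))"
        by (simp add: power2_eq_square)
      also have "x powr (\<delta>/4) * x powr (\<delta>/4) * (x powr (- \<sigma>) * x powr (- \<sigma>)) = x powr (\<delta>/2 + (2 * \<delta> - 1 - \<theta>))"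
        unfolding powr_add[symmetric] by (rule arg_cong[of _ _ "(powr) x"]) (simp add: field_simps \<sigma>_def)
      finally have 1: "(norm (g j))\<^sup>2 \<le> Cc\<^sup>2 * x powr (\<delta>/2 + (2 * \<delta> - 1 - \<theta>))" .
      have "(norm (g j))\<^sup>2 * x powr (\<delta>/2) * (x powr 1 + T * x powr \<theta>) \<le>
         (Cc\<^sup>2 * x powr (\<delta>/2 + (2 * \<delta> - 1 - \<theta>))) * x powr (\<delta>/2) * (x powr 1 + T * x powr \<theta>)"
        using 1 x T by (intro mult_right_mono) auto
      also have "\<dots> = Cc\<^sup>2 * (x powr (\<delta>/2 + (2 * \<delta> - 1 - \<theta>)) * x powr (\<delta>/2) * x powr 1 + T * (x powr (\<delta>/2 + (2 * \<delta> - 1 - \<theta>)) * x powr (\<delta>/2) * x powr \<theta>))"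
      proof -
        have "A * y * z * (p + T * r) = A * (y * z * p + T * (y * z * r))" for A y z p r :: real
          by (simp add: algebra_simps)
        then show ?thesis .
      qed
      also have "x powr (\<delta>/2 + (2 * \<delta> - 1 - \<theta>)) * x powr (\<delta>/2) * x powr 1 = x powr (4 * \<delta> + (1 - \<theta>)) * w j"
        unfolding w_def x_def[symmetric] powr_add[symmetric] by (rule arg_cong[of _ _ "(powr) x"]) (simp add: field_simps)
      also have "x powr (\<delta>/2 + (2 * \<delta> - 1 - \<theta>)) * x powr (\<delta>/2) * x powr \<theta> = x powr (4 * \<delta>) * w j"
        unfolding w_def x_def[symmetric] powr_add[symmetric] by (rule arg_cong[of _ _ "(powr) x"]) (simp add: field_simps)
      also have "Cc\<^sup>2 * (x powr (4 * \<delta> + (1 - \<theta>)) * w j + T * (x powr (4 * \<delta>) * w j)) \<le>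
         Cc\<^sup>2 * (N powr (4 * \<delta> + (1 - \<theta>)) * w j + T * (N powr (4 * \<delta>) * w j))"
        using x d theta T by (intro mult_left_mono add_mono mult_right_mono powr_mono2) (auto simp: w_def)
      also have "\<dots> = Cc\<^sup>2 * B * w j" 
      proof -
        have "N powr (4 * \<delta> + (1 - \<theta>)) = N powr (4 * \<delta>) * N powr (1 - \<theta>)" by (rule powr_add)
        then show ?thesis unfolding B_def by (simp only: distrib_left distrib_right mult_ac)
      qed
      finally show ?thesis using x by (simp add: x_def)
    qed
    have gi2: "integrable (count_space UNIV) (\<lambda>i. (norm (g i))\<^sup>2 * n i powr (\<delta>/2) * (n i + T * n i powr \<theta>))"
      unfolding integrable_count_space_nat_iff by (rule summable_finite[OF fin]) (auto simp: g_def)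
    have "(LINT i|count_space UNIV. (norm (g i))\<^sup>2 * n i powr (\<delta>/2) * (n i + T * n i powr \<theta>)) \<le> (LINT j|count_space UNIV. Cc\<^sup>2 * B * w j)"
      by (intro integral_mono gi2 integrable_mult_right wi key)
    also have "\<dots> = Cc\<^sup>2 * B * W" unfolding W_def by (rule integral_mult_right_zero)
    finally have "C * (LINT i|count_space UNIV. (norm (g i))\<^sup>2 * n i powr (\<delta>/2) * (n i + T * n i powr \<theta>)) \<le> C * (Cc\<^sup>2 * B * W)"
      using C(1) by (rule mult_left_mono)
    also have "\<dots> = C * (Cc\<^sup>2 * W) * N powr (4 * \<delta>) * (N powr (1 - \<theta>) + T)" by (simp only: mult_ac B_def)
    finally show "set_integrable lborel {-T..T} (\<lambda>t. (norm (\<Sum>j | n j \<le> N. c j * nexp (Complex \<sigma> t) j))\<^sup>2) \<and>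
    (LINT t:{-T..T}|lborel. (norm (\<Sum>j | n j \<le> N. c j * nexp (Complex \<sigma> t) j))\<^sup>2) \<le> C * (Cc\<^sup>2 * W) * N powr (4 * \<delta>) * (N powr (1 - \<theta>) + T)"
      using C(2)[OF T gi gi2] unfolding gt by (auto intro: order_trans)
  qed
qed

end

section \<open>Mean squares of \<open>F\<close> and of the mollifier on the left line\<close>

lemma arctan_integral:
  assumes T: "T \<ge> 0"
  shows "set_integrable lborel {-T..T} (\<lambda>t. 1 / (1 + t\<^sup>2))"
    and "(LINT t:{-T..T}|lborel. 1 / (1 + t\<^sup>2)) \<le> pi"
proof -
  have "has_bochner_integral lborel (\<lambda>t. indicator {-T..T} t *\<^sub>R (1 / (1 + t\<^sup>2))) (arctan T - arctan (- T))"
  proof (rule has_bochner_integral_FTC_Icc)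
    fix t :: real
    have "(arctan has_field_derivative (1 / (1 + t\<^sup>2))) (at t within {-T..T})"
      by (auto intro!: derivative_eq_intros simp: divide_inverse)
    then show "(arctan has_vector_derivative 1 / (1 + t\<^sup>2)) (at t within {-T..T})"
      by (simp add: has_real_derivative_iff_has_vector_derivative)
    have "1 + t\<^sup>2 \<noteq> 0" for t :: real using zero_le_power2[of t] by linarith
    then show "continuous_on {-T..T} (\<lambda>t. 1 / (1 + t\<^sup>2))" by (intro continuous_intros) auto
  qed (use T in auto)
  then show "set_integrable lborel {-T..T} (\<lambda>t. 1 / (1 + t\<^sup>2))"
    and "(LINT t:{-T..T}|lborel. 1 / (1 + t\<^sup>2)) \<le> pi"
    using arctan_lbound[of T] arctan_ubound[of T]
    by (auto simp: has_bochner_integral_iff set_integrable_def set_lebesgue_integral_def arctan_minus)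
qed

lemma sum4_square_le: "(a + b + c + d :: real)\<^sup>2 \<le> 4 * (a\<^sup>2 + b\<^sup>2 + c\<^sup>2 + d\<^sup>2)"
proof -
  have "4 * (a\<^sup>2 + b\<^sup>2 + c\<^sup>2 + d\<^sup>2) - (a + b + c + d)\<^sup>2 = (a - b)\<^sup>2 + (a - c)\<^sup>2 + (a - d)\<^sup>2 + (b - c)\<^sup>2 + (b - d)\<^sup>2 + (c - d)\<^sup>2"
    by (simp add: power2_eq_square algebra_simps)
  also have "\<dots> \<ge> 0" by (intro add_nonneg_nonneg) auto
  finally show ?thesis by simp
qed

context dirichlet_pair
begin

lemma F_regular_off_1:
  assumes "Re s > \<theta>" "s \<noteq> 1" shows "F s = 0 \<longleftrightarrow> F_reg s = 0"
  using assms by (simp add: F_def)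

lemma continuous_on_vertical:
  assumes f: "continuous_on S f" and S: "\<And>t. t \<in> A \<Longrightarrow> Complex \<sigma> t \<in> S"
  shows "continuous_on A (\<lambda>t. f (Complex \<sigma> t) :: complex)"
proof -
  have "continuous_on A (\<lambda>t. Complex \<sigma> t)" unfolding Complex_eq by (intro continuous_intros)
  then show ?thesis by (rule continuous_on_compose2[OF f]) (use S in auto)
qed

text \<open>Heights below 1 are left out so that norm (s - 1) is at least 1 on the line; the pole
  would otherwise enter the mean square.\<close>

definition height_band :: "real \<Rightarrow> real set" where
  "height_band T = {t. 1 \<le> \<bar>t\<bar> \<and> \<bar>t\<bar> \<le> T}"

lemma height_band_sub: "height_band T \<subseteq> {-T..T}" by (auto simp: height_band_def)

lemma compact_height_band: "compact (height_band T)"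
proof -
  have "height_band T = {-T..T} \<inter> ({..-1} \<union> {1..})" by (auto simp: height_band_def)
  then show ?thesis by (simp add: compact_Int_closed closed_Un)
qed

lemma height_band_measurable [measurable]: "height_band T \<in> sets borel"
  using compact_height_band by (rule borel_compact)

lemma F_continuous_height_band:
  assumes s: "\<sigma> > \<theta>"
  shows "continuous_on (height_band T) (\<lambda>t. F (Complex \<sigma> t))"
  by (rule continuous_on_vertical[OF holomorphic_on_imp_continuous_on[OF F_holo]])
     (use s in \<open>auto simp: height_band_def complex_eq_iff\<close>)

text \<open>Writing the summatory function as main term plus remainder pairs P(U) with s * polar P s
  U. Their difference is small by \<open>polar_cancellation\<close>, whereas each of them alone
  would be too large left of Re s = 1.\<close>

lemma F_split:
  assumes s: "Re s > \<theta>" "s \<noteq> 1" and U: "U \<ge> 0"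
  shows "F s = partial_sum U s - of_real (remainder U) * exp (- s * of_real U)
     + (s * polar P s U - of_real (poly P U)) * exp ((1 - s) * of_real U) + s * tail U s"
proof -
  have "exp ((1 - s) * of_real U) = of_real (exp U) * exp (- s * of_real U)"
    by (simp add: exp_of_real[symmetric] exp_add[symmetric] algebra_simps)
  then have "of_real (summatory n a (exp U)) * exp (- s * of_real U) =
      of_real (remainder U) * exp (- s * of_real U) + of_real (poly P U) * exp ((1 - s) * of_real U)"
    by (simp add: remainder_def algebra_simps)
  then show ?thesis unfolding F_identity[OF s U] by (simp only: left_diff_distrib diff_diff_eq add_diff_eq diff_add_eq add_ac)
qed

text \<open>The four terms of \<open>F_split\<close> are squared separately: the partial sum by the
  mean value theorem, the remainder trivially, the polar term through its decay in t, the tail by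
  the Plancherel bound. U is chosen so that all are O(T E).\<close>

lemma F_mean_square:
  assumes d: "\<delta> > 0" "8 * \<delta> < 1 - \<theta>"
  defines "\<sigma> \<equiv> (1 + \<theta>) / 2 - \<delta>"
  obtains C where "C \<ge> 0" "\<And>T. T \<ge> 1 \<Longrightarrow>
    set_integrable lborel (height_band T) (\<lambda>t. (norm (F (Complex \<sigma> t)))\<^sup>2) \<and>
    (LINT t:height_band T|lborel. (norm (F (Complex \<sigma> t)))\<^sup>2) \<le> C * T powr (1 + 4 * \<delta> / (1 - \<theta>))"
proof -
  have th: "1 - \<theta> > 0" using theta by simp
  have d1: "\<delta> \<le> 1" using d theta by simp
  have \<sigma>: "\<sigma> > \<theta> + \<delta>" "\<sigma> > \<theta>" "\<sigma> > 0" "\<sigma> < 1" using d theta by (auto simp: \<sigma>_def field_simps)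
  obtain C1 where C1: "C1 \<ge> 0" "\<And>T N. T \<ge> 1 \<Longrightarrow> N \<ge> 1 \<Longrightarrow>
    set_integrable lborel {-T..T} (\<lambda>t. (norm (\<Sum>j | n j \<le> N. of_real (a j) * nexp (Complex \<sigma> t) j))\<^sup>2) \<and>
    (LINT t:{-T..T}|lborel. (norm (\<Sum>j | n j \<le> N. of_real (a j) * nexp (Complex \<sigma> t) j))\<^sup>2) \<le> C1 * N powr (4 * \<delta>) * (N powr (1 - \<theta>) + T)"
  proof -
    have "\<exists>C\<ge>0. \<forall>j. norm (complex_of_real (a j)) \<le> C * n j powr \<epsilon>" if e: "\<epsilon> > 0" for \<epsilon>
    proof -
      obtain C where "C \<ge> 0" "\<And>j. a j \<le> C * n j powr \<epsilon>" using a_le[OF e] by blast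
      then show ?thesis using a_nonneg by (intro exI[of _ C]) simp
    qed
    from dirichlet_polynomial_mean_square[OF d(1) d1, of "\<lambda>j. of_real (a j)", OF this] that show ?thesis
      unfolding \<sigma>_def by blast
  qed
  obtain Cr where Cr: "Cr \<ge> 0" "\<And>u. u \<ge> 0 \<Longrightarrow> \<bar>remainder u\<bar> \<le> Cr * exp ((\<theta> + \<delta>) * u)"
    using remainder_bound[OF d(1)] by blast
  obtain Cp where Cp: "Cp \<ge> 0" "\<And>u s. u \<ge> 0 \<Longrightarrow> norm (s - 1) \<ge> 1 \<Longrightarrow>
     norm (s * polar P s u - of_real (poly P u)) \<le> Cp * exp (\<delta> * u) / norm (s - 1)"
    using polar_cancellation[OF d(1), of P] by blast
  define K where "K = sqrt (2 * pi) / std_normal_density 1"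
  have K0: "K \<ge> 0" unfolding K_def by (intro divide_nonneg_nonneg) auto
  define k where "k = 1 - \<theta> - 4 * \<delta>"
  have k: "k > 0" "2 * (\<sigma> - (\<theta> + \<delta>)) = k" using d by (auto simp: k_def \<sigma>_def field_simps)
  define C where "C = 8 * C1 + 8 * Cr\<^sup>2 + 8 * Cp\<^sup>2 * pi + 16 * (K * (Cr\<^sup>2 / k))"
  show ?thesis
  proof (rule that[of C])
    show "C \<ge> 0" unfolding C_def using C1(1) K0 k by (intro add_nonneg_nonneg mult_nonneg_nonneg) auto
    fix T :: real assume T: "T \<ge> 1"
    \<comment> \<open>The length exp U = T^(1/(1 - \<theta>)) makes N^(1 - \<theta>) equal to T in
      the mean square of the partial sum.\<close>
    define U where "U = ln T / (1 - \<theta>)"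
    have U: "U \<ge> 0" using T th by (simp add: U_def)
    define E where "E = T powr (4 * \<delta> / (1 - \<theta>))"
    have E1: "E \<ge> 1" unfolding E_def using T d th by (intro ge_one_powr_ge_zero) auto
    have expU: "exp (x * U) = T powr (x / (1 - \<theta>))" for x using T by (simp add: U_def powr_def mult.commute)
    have e1: "exp (4 * \<delta> * U) = E" unfolding expU E_def ..
    have e2: "exp ((1 - \<theta>) * U) = T" using expU[of "1 - \<theta>"] th T by simp
    define D where "D t = (\<Sum>j | n j \<le> exp U. of_real (a j) * nexp (Complex \<sigma> t) j)" for t
    have N: "exp U powr (4 * \<delta>) = E" "exp U powr (1 - \<theta>) = T"
      using e1 e2 by (simp_all add: powr_def)
    have D: "set_integrable lborel {-T..T} (\<lambda>t. (norm (D t))\<^sup>2)"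
      "(LINT t:{-T..T}|lborel. (norm (D t))\<^sup>2) \<le> 2 * C1 * (T * E)"
      using C1(2)[OF T, of "exp U"] U unfolding D_def[symmetric] N by (simp_all add: mult_ac)
    define Tl where "Tl t = tail U (Complex \<sigma> t)" for t
    have Tl: "set_integrable lborel {-T..T} (\<lambda>t. (norm (Tl t))\<^sup>2)"
      "(LINT t:{-T..T}|lborel. (norm (Tl t))\<^sup>2) \<le> K * (Cr\<^sup>2 * exp (- k * U) / k)"
      using laplace_mean_square[OF remainder_measurable Cr(2) \<sigma>(1) U, of T] T
      unfolding Tl_def tail_def K_def k(2) by auto
    \<comment> \<open>The factor s in front of the tail costs T^2 in mean square; exp(-k U) = E/T
      brings this down to T E.\<close>
    have ek: "exp (- k * U) * T = E"
    proof -
      have "exp (- k * U) * exp ((1 - \<theta>) * U) = exp (4 * \<delta> * U)"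
        unfolding exp_add[symmetric] by (rule arg_cong[of _ _ exp]) (simp add: k_def algebra_simps)
      then show ?thesis unfolding e1 e2 .
    qed
    define G where "G t = 4 * (norm (D t))\<^sup>2 + 4 * Cr\<^sup>2 + 8 * Cp\<^sup>2 * (T * E) * (1 / (1 + t\<^sup>2)) + 16 * T\<^sup>2 * (norm (Tl t))\<^sup>2" for t
    have pt: "(norm (F (Complex \<sigma> t)))\<^sup>2 \<le> G t" if t: "t \<in> height_band T" for t
    proof -
      define s where "s = Complex \<sigma> t"
      have t1: "1 \<le> \<bar>t\<bar>" "\<bar>t\<bar> \<le> T" using t by (auto simp: height_band_def)
      have s: "Re s > \<theta>" "s \<noteq> 1" using \<sigma> t1 by (auto simp: s_def complex_eq_iff)
      have ns: "norm s \<le> 2 * T"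
        using cmod_le[of s] \<sigma> t1 by (simp add: s_def)
      \<comment> \<open>The gain 1/norm (s - 1) from the cancellation becomes 1/(1 + t^2) after
        squaring, whose integral is at most pi for every T.\<close>
      have ns2: "(norm (s - 1))\<^sup>2 \<ge> (1 + t\<^sup>2) / 2"
      proof -
        have "(norm (s - 1))\<^sup>2 = (\<sigma> - 1)\<^sup>2 + t\<^sup>2" by (simp add: s_def cmod_power2)
        moreover have "1 \<le> t\<^sup>2" using t1 one_le_power[of "\<bar>t\<bar>" 2] by simp
        moreover have "(1 + y) / 2 \<le> x" if "x = z + y" "1 \<le> y" "0 \<le> z" for x y z :: real
          using that by (simp add: field_simps)
        ultimately show ?thesis using zero_le_power2[of "\<sigma> - 1"] by blast
      qed
      have ns1: "norm (s - 1) \<ge> 1"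
        using abs_Im_le_cmod[of "s - 1"] t1 by (simp add: s_def)
      have ps: "partial_sum U s = D t" by (simp add: partial_sum_def D_def nexp_def s_def)
      have r: "norm (of_real (remainder U) * exp (- s * of_real U)) \<le> Cr"
      proof -
        have "norm (of_real (remainder U) * exp (- s * of_real U)) = \<bar>remainder U\<bar> * exp (- \<sigma> * U)"
          by (simp add: norm_mult norm_exp_eq_Re s_def)
        also have "\<dots> \<le> Cr * exp ((\<theta> + \<delta>) * U) * exp (- \<sigma> * U)" by (intro mult_right_mono Cr(2) U) auto
        also have "\<dots> = Cr * exp (- (\<sigma> - (\<theta> + \<delta>)) * U)" by (simp add: exp_add[symmetric] algebra_simps)
        also have "\<dots> \<le> Cr * 1" using Cr(1) \<sigma>(1) U by (intro mult_left_mono) (auto intro: mult_nonpos_nonneg)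
        finally show ?thesis by simp
      qed
      have p: "norm ((s * polar P s U - of_real (poly P U)) * exp ((1 - s) * of_real U)) \<le> Cp * exp (\<delta> * U) * exp ((1 - \<sigma>) * U) / norm (s - 1)"
      proof -
        have "norm ((s * polar P s U - of_real (poly P U)) * exp ((1 - s) * of_real U)) = norm (s * polar P s U - of_real (poly P U)) * exp ((1 - \<sigma>) * U)"
          by (simp add: norm_mult norm_exp_eq_Re s_def)
        also have "\<dots> \<le> Cp * exp (\<delta> * U) / norm (s - 1) * exp ((1 - \<sigma>) * U)"
          by (intro mult_right_mono Cp(2) U ns1) auto
        finally show ?thesis by simp
      qed
      have p2: "(Cp * exp (\<delta> * U) * exp ((1 - \<sigma>) * U) / norm (s - 1))\<^sup>2 \<le> 2 * Cp\<^sup>2 * (T * E) * (1 / (1 + t\<^sup>2))"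
      proof -
        have "(exp (\<delta> * U) * exp ((1 - \<sigma>) * U))\<^sup>2 = exp (2 * (\<delta> * U + (1 - \<sigma>) * U))"
          by (simp only: exp_add[symmetric] exp_double)
        also have "2 * (\<delta> * U + (1 - \<sigma>) * U) = (1 - \<theta>) * U + 4 * \<delta> * U"
          by (simp add: \<sigma>_def field_simps)
        also have "exp \<dots> = T * E" by (simp only: exp_add e1 e2)
        finally have sq: "(exp (\<delta> * U) * exp ((1 - \<sigma>) * U))\<^sup>2 = T * E" .
        have "(Cp * exp (\<delta> * U) * exp ((1 - \<sigma>) * U) / norm (s - 1))\<^sup>2 = Cp\<^sup>2 * (T * E) / (norm (s - 1))\<^sup>2"
          unfolding sq[symmetric] by (simp add: power_mult_distrib power_divide)
        also have "\<dots> \<le> Cp\<^sup>2 * (T * E) / ((1 + t\<^sup>2) / 2)"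
        proof (rule divide_left_mono[OF ns2])
          have pos: "(1 + t\<^sup>2) / 2 > 0" by (simp add: add_pos_nonneg)
          show "0 < (norm (s - 1))\<^sup>2 * ((1 + t\<^sup>2) / 2)"
            using pos ns2 by (intro mult_pos_pos) linarith+
          show "0 \<le> Cp\<^sup>2 * (T * E)" using T E1 by (intro mult_nonneg_nonneg) auto
        qed
        also have "\<dots> = 2 * Cp\<^sup>2 * (T * E) * (1 / (1 + t\<^sup>2))" by simp
        finally show ?thesis .
      qed
      have tl: "norm (s * tail U s) \<le> 2 * T * norm (Tl t)"
        unfolding norm_mult Tl_def s_def[symmetric] by (intro mult_right_mono ns) auto
      have "norm (F s) \<le> norm (D t) + norm (of_real (remainder U) * exp (- s * of_real U))
         + norm ((s * polar P s U - of_real (poly P U)) * exp ((1 - s) * of_real U)) + norm (s * tail U s)"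
        unfolding F_split[OF s U] ps by (intro norm_triangle_le add_mono norm_triangle_le_diff) auto
      also have "\<dots> \<le> norm (D t) + Cr + Cp * exp (\<delta> * U) * exp ((1 - \<sigma>) * U) / norm (s - 1) + 2 * T * norm (Tl t)"
        by (intro add_mono r p tl order_refl)
      finally have "(norm (F s))\<^sup>2 \<le> (norm (D t) + Cr + Cp * exp (\<delta> * U) * exp ((1 - \<sigma>) * U) / norm (s - 1) + 2 * T * norm (Tl t))\<^sup>2"
        by (intro power_mono) auto
      also have "\<dots> \<le> 4 * ((norm (D t))\<^sup>2 + Cr\<^sup>2 + (Cp * exp (\<delta> * U) * exp ((1 - \<sigma>) * U) / norm (s - 1))\<^sup>2 + (2 * T * norm (Tl t))\<^sup>2)"
        by (rule sum4_square_le)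
      also have "\<dots> \<le> 4 * ((norm (D t))\<^sup>2 + Cr\<^sup>2 + 2 * Cp\<^sup>2 * (T * E) * (1 / (1 + t\<^sup>2)) + (2 * T * norm (Tl t))\<^sup>2)"
        by (intro mult_left_mono add_mono p2 order_refl) auto
      also have "\<dots> = G t" by (simp add: G_def power_mult_distrib)
      finally show ?thesis unfolding s_def .
    qed
    have Fi: "set_integrable lborel (height_band T) (\<lambda>t. (norm (F (Complex \<sigma> t)))\<^sup>2)"
      unfolding set_integrable_def
      by (rule borel_integrable_compact[OF compact_height_band]) (intro continuous_intros F_continuous_height_band \<sigma>)
    have ci: "set_integrable lborel {-T..T} (\<lambda>t. c)" for c :: real
      by (rule borel_integrable_atLeastAtMost') (intro continuous_intros)
    have cI: "(LINT t:{-T..T}|lborel. c) = 2 * T * c" for c :: real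
      using T by (simp add: set_lebesgue_integral_def)
    note ai = arctan_integral[of T]
    have T0: "T \<ge> 0" using T by simp
    have Gi: "set_integrable lborel {-T..T} G" unfolding G_def
      by (intro set_integral_add set_integrable_mult_right ci D(1) Tl(1) ai(1) T0)
    have "(LINT t:height_band T|lborel. (norm (F (Complex \<sigma> t)))\<^sup>2) \<le> (LINT t:height_band T|lborel. G t)"
      by (rule set_integral_mono[OF Fi set_integrable_subset[OF Gi _ height_band_sub] pt]) auto
    also have "\<dots> \<le> (LINT t:{-T..T}|lborel. G t)"
      unfolding set_lebesgue_integral_def
    proof (rule integral_mono)
      show "integrable lborel (\<lambda>t. indicator (height_band T) t *\<^sub>R G t)"
        using set_integrable_subset[OF Gi _ height_band_sub] by (simp add: set_integrable_def)
      show "integrable lborel (\<lambda>t. indicator {-T..T} t *\<^sub>R G t)" using Gi by (simp add: set_integrable_def)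
      fix t :: real
      have "G t \<ge> 0" unfolding G_def using T E1 by (intro add_nonneg_nonneg mult_nonneg_nonneg) auto
      then show "indicator (height_band T) t *\<^sub>R G t \<le> indicator {-T..T} t *\<^sub>R G t"
        by (auto simp: indicator_def height_band_def)
    qed
    also have "\<dots> = 4 * (LINT t:{-T..T}|lborel. (norm (D t))\<^sup>2) + 2 * T * (4 * Cr\<^sup>2)
       + 8 * Cp\<^sup>2 * (T * E) * (LINT t:{-T..T}|lborel. 1 / (1 + t\<^sup>2)) + 16 * T\<^sup>2 * (LINT t:{-T..T}|lborel. (norm (Tl t))\<^sup>2)"
      unfolding G_def
      by (subst set_integral_add(2) | intro set_integral_add(1) set_integrable_mult_right ci D(1) Tl(1) ai(1) T0 | simp only: set_integral_mult_right cI)+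
    also have "\<dots> \<le> 4 * (2 * C1 * (T * E)) + 2 * T * (4 * Cr\<^sup>2) + 8 * Cp\<^sup>2 * (T * E) * pi + 16 * T\<^sup>2 * (K * (Cr\<^sup>2 * exp (- k * U) / k))"
      using T E1 by (intro add_mono mult_left_mono D(2) Tl(2) ai(2) T0 order_refl mult_nonneg_nonneg) auto
    also have "16 * T\<^sup>2 * (K * (Cr\<^sup>2 * exp (- k * U) / k)) = 16 * (K * (Cr\<^sup>2 / k)) * (T * E)"
      unfolding ek[symmetric] by (simp add: power2_eq_square)
    also have "2 * T * (4 * Cr\<^sup>2) \<le> 8 * Cr\<^sup>2 * (T * E)"
    proof -
      have "T * 1 \<le> T * E" using E1 T by (intro mult_left_mono) auto
      then have "8 * Cr\<^sup>2 * (T * 1) \<le> 8 * Cr\<^sup>2 * (T * E)" by (rule mult_left_mono) simp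
      then show ?thesis by (simp only: mult_ac mult_1_right)
    qed
    finally have "(LINT t:height_band T|lborel. (norm (F (Complex \<sigma> t)))\<^sup>2) \<le> C * (T * E)"
      by (simp add: C_def algebra_simps)
    also have "T * E = T powr (1 + 4 * \<delta> / (1 - \<theta>))" using T by (simp add: E_def powr_add)
    finally show "set_integrable lborel (height_band T) (\<lambda>t. (norm (F (Complex \<sigma> t)))\<^sup>2) \<and>
    (LINT t:height_band T|lborel. (norm (F (Complex \<sigma> t)))\<^sup>2) \<le> C * T powr (1 + 4 * \<delta> / (1 - \<theta>))" using Fi by simp
  qed
qed

lemma mollifier_mean_square:
  assumes d: "\<delta> > 0" "\<delta> \<le> 1"
  defines "\<sigma> \<equiv> (1 + \<theta>) / 2 - \<delta>"
  obtains C where "C \<ge> 0" "\<And>T. T \<ge> 1 \<Longrightarrow>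
    set_integrable lborel {-T..T} (\<lambda>t. (norm (mollifier (T powr (1 / (1 - \<theta>))) (Complex \<sigma> t)))\<^sup>2) \<and>
    (LINT t:{-T..T}|lborel. (norm (mollifier (T powr (1 / (1 - \<theta>))) (Complex \<sigma> t)))\<^sup>2) \<le> C * T powr (1 + 4 * \<delta> / (1 - \<theta>))"
proof -
  have th: "1 - \<theta> > 0" using theta by simp
  obtain C1 where C1: "C1 \<ge> 0" "\<And>T N. T \<ge> 1 \<Longrightarrow> N \<ge> 1 \<Longrightarrow>
    set_integrable lborel {-T..T} (\<lambda>t. (norm (\<Sum>j | n j \<le> N. b j * nexp (Complex \<sigma> t) j))\<^sup>2) \<and>
    (LINT t:{-T..T}|lborel. (norm (\<Sum>j | n j \<le> N. b j * nexp (Complex \<sigma> t) j))\<^sup>2) \<le> C1 * N powr (4 * \<delta>) * (N powr (1 - \<theta>) + T)"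
  proof -
    have "\<exists>C\<ge>0. \<forall>j. norm (b j) \<le> C * n j powr \<epsilon>" if e: "\<epsilon> > 0" for \<epsilon>
      using b_le[OF e] by metis
    from dirichlet_polynomial_mean_square[OF d, of b, OF this] that show ?thesis
      unfolding \<sigma>_def by blast
  qed
  show ?thesis
  proof (rule that[of "2 * C1"])
    show "2 * C1 \<ge> 0" using C1 by simp
    fix T :: real assume T: "T \<ge> 1"
    define N where "N = T powr (1 / (1 - \<theta>))"
    have N1: "N \<ge> 1" unfolding N_def using T th by (intro ge_one_powr_ge_zero) auto
    have e: "N powr (4 * \<delta>) = T powr (4 * \<delta> / (1 - \<theta>))" "N powr (1 - \<theta>) = T"
      using T th by (simp_all add: N_def powr_powr)
    have "C1 * N powr (4 * \<delta>) * (N powr (1 - \<theta>) + T) = 2 * C1 * T powr (1 + 4 * \<delta> / (1 - \<theta>))"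
      unfolding e using T by (simp add: powr_add)
    note eq = this
    show "set_integrable lborel {-T..T} (\<lambda>t. (norm (mollifier (T powr (1 / (1 - \<theta>))) (Complex \<sigma> t)))\<^sup>2) \<and>
    (LINT t:{-T..T}|lborel. (norm (mollifier (T powr (1 / (1 - \<theta>))) (Complex \<sigma> t)))\<^sup>2) \<le> 2 * C1 * T powr (1 + 4 * \<delta> / (1 - \<theta>))"
      using C1(2)[OF T N1] unfolding mollifier_def N_def[symmetric] eq .
  qed
qed

section \<open>Growth bounds, a lower bound far to the right, and zeros in short ranges of
  height\<close>

lemma F_reg_growth:
  assumes d: "\<delta> > 0"
  obtains C where "C \<ge> 0" "\<And>s. Re s \<ge> \<theta> + \<delta> \<Longrightarrow> norm (F_reg s) \<le> C * (1 + norm s) ^ (degree P + 2)"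
proof -
  have d2: "\<delta> / 2 > 0" using d by simp
  obtain C0 where C0: "C0 \<ge> 0" "\<And>s U. Re s > \<theta> + \<delta> / 2 \<Longrightarrow> U \<ge> 0 \<Longrightarrow>
      norm (tail U s) \<le> C0 * exp (- (Re s - (\<theta> + \<delta> / 2)) * U) / (Re s - (\<theta> + \<delta> / 2))"
    using tail_bound[OF d2] by blast
  define D where "D = degree P"
  define c where "c k = \<bar>poly ((pderiv ^^ k) P) 0\<bar>" for k
  define C where "C = (\<Sum>k\<le>D. c k) + C0 / (\<delta> / 2)"
  have C: "C \<ge> 0" unfolding C_def using C0(1) d by (intro add_nonneg_nonneg sum_nonneg divide_nonneg_nonneg) (auto simp: c_def)
  show ?thesis
  proof (rule that[OF C])
    fix s assume s: "Re s \<ge> \<theta> + \<delta>"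
    have L: "norm (laplace s) \<le> C0 / (\<delta> / 2)"
    proof -
      have "norm (laplace s) = norm (tail 0 s)" by (simp add: laplace_def tail_def)
      also have "\<dots> \<le> C0 / (Re s - (\<theta> + \<delta> / 2))" using C0(2)[of s 0] s d by simp
      also have "\<dots> \<le> C0 / (\<delta> / 2)" using C0(1) s d by (intro divide_left_mono) auto
      finally show ?thesis .
    qed
    have n1: "norm (s - 1) \<le> 1 + norm s" using norm_triangle_ineq4[of s 1] by simp
    have pw: "norm (s - 1) ^ k \<le> (1 + norm s) ^ (D + 1)" if "k \<le> D + 1" for k
    proof -
      have "norm (s - 1) ^ k \<le> (1 + norm s) ^ k" by (rule power_mono[OF n1]) auto
      also have "\<dots> \<le> (1 + norm s) ^ (D + 1)" using that by (intro power_increasing) auto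
      finally show ?thesis .
    qed
    have "norm ((\<Sum>k\<le>D. of_real (poly ((pderiv ^^ k) P) 0) * (s - 1) ^ (D - k)) + (s - 1) ^ (D + 1) * laplace s)
       \<le> (\<Sum>k\<le>D. c k * (1 + norm s) ^ (D + 1)) + (1 + norm s) ^ (D + 1) * (C0 / (\<delta> / 2))"
    proof (rule norm_triangle_mono)
      show "norm (\<Sum>k\<le>D. of_real (poly ((pderiv ^^ k) P) 0) * (s - 1) ^ (D - k)) \<le> (\<Sum>k\<le>D. c k * (1 + norm s) ^ (D + 1))"
      proof (rule sum_norm_le)
        fix k
        show "norm (of_real (poly ((pderiv ^^ k) P) 0) * (s - 1) ^ (D - k)) \<le> c k * (1 + norm s) ^ (D + 1)"
          unfolding norm_mult norm_power norm_of_real c_def by (intro mult_left_mono pw) auto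
      qed
      show "norm ((s - 1) ^ (D + 1) * laplace s) \<le> (1 + norm s) ^ (D + 1) * (C0 / (\<delta> / 2))"
        unfolding norm_mult norm_power by (intro mult_mono pw L) auto
    qed
    also have "\<dots> = C * (1 + norm s) ^ (D + 1)" by (simp add: C_def sum_distrib_right distrib_right mult.commute)
    finally have B: "norm ((\<Sum>k\<le>D. of_real (poly ((pderiv ^^ k) P) 0) * (s - 1) ^ (D - k)) + (s - 1) ^ (D + 1) * laplace s) \<le> C * (1 + norm s) ^ (D + 1)" .
    have "norm (F_reg s) \<le> (1 + norm s) * (C * (1 + norm s) ^ (D + 1))"
      unfolding F_reg_def D_def[symmetric] norm_mult by (intro mult_mono B) auto
    then show "norm (F_reg s) \<le> C * (1 + norm s) ^ (degree P + 2)" by (simp add: D_def mult_ac)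
  qed
qed

text \<open>On Re s \<ge> 2 all mollifiers are bounded by one constant B, while F M tends to 1;
  hence norm (F s) is at least 1/B. It is used at the centre of the disc in
  \<open>local_zero_count\<close>.\<close>

lemma F_lower_bound:
  obtains m where "m > 0" "\<And>s. Re s \<ge> 2 \<Longrightarrow> norm (F s) \<ge> m"
proof -
  define B where "B = (\<Sum>k. norm (b k) * n k powr (- 2))"
  have sm: "summable (\<lambda>k. norm (b k) * n k powr (- 2))" by (rule b_summable) simp
  have Mb: "norm (mollifier X s) \<le> B" if s: "Re s \<ge> 2" for X s
  proof -
    have "norm (mollifier X s) \<le> (\<Sum>k | n k \<le> X. norm (b k) * n k powr (- 2))" unfolding mollifier_def
    proof (rule sum_norm_le)
      fix k
      show "norm (b k * nexp s k) \<le> norm (b k) * n k powr (- 2)"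
        unfolding norm_mult norm_nexp using s n_ge1[of k] by (intro mult_left_mono powr_mono) auto
    qed
    also have "\<dots> \<le> B" unfolding B_def by (rule sum_le_suminf[OF sm n_finite]) auto
    finally show ?thesis .
  qed
  have key: "1 \<le> norm (F s) * B" if s: "Re s \<ge> 2" for s
  proof (rule LIMSEQ_le_const2)
    show "(\<lambda>i. norm (F s * mollifier (1 + real i) s)) \<longlonglongrightarrow> 1"
      using tendsto_norm[OF mollified_tendsto[of s]] s by simp
    show "\<exists>N. \<forall>i\<ge>N. norm (F s * mollifier (1 + real i) s) \<le> norm (F s) * B"
      unfolding norm_mult using Mb[OF s] by (intro exI[of _ 0]) (auto intro: mult_left_mono)
  qed
  have B: "B > 0"
  proof (rule ccontr)
    assume "\<not> B > 0"
    then have "norm (F 2) * B \<le> 0" by (intro mult_nonneg_nonpos) auto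
    then show False using key[of 2] by simp
  qed
  show ?thesis
  proof (rule that[of "1 / B"])
    show "1 / B > 0" using B by simp
    fix s assume "Re s \<ge> 2"
    from key[OF this] B show "norm (F s) \<ge> 1 / B" by (simp add: field_simps)
  qed
qed

text \<open>A crude bound, needed only on the horizontal sides of rectangles. The exponent 3 is 1
  for the coefficients plus 2 to leave the summable weight n_k^(-2).\<close>

lemma mollifier_growth:
  obtains C where "C \<ge> 0" "\<And>s X. Re s \<ge> 0 \<Longrightarrow> X \<ge> 1 \<Longrightarrow> norm (mollifier X s) \<le> C * X powr 3"
proof -
  obtain Cb where Cb: "Cb \<ge> 0" "\<And>j. norm (b j) \<le> Cb * n j powr 1" using b_le[of 1] by auto
  have sm: "summable (\<lambda>k. n k powr (- 2))" by (rule summable_n) simp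
  define S where "S = (\<Sum>k. n k powr (- 2))"
  have S: "S \<ge> 0" unfolding S_def by (rule suminf_nonneg[OF sm]) auto
  show ?thesis
  proof (rule that[of "Cb * S"])
    show "Cb * S \<ge> 0" using Cb S by simp
    fix s :: complex and X :: real assume s: "Re s \<ge> 0" and X: "X \<ge> 1"
    have "norm (mollifier X s) \<le> (\<Sum>k | n k \<le> X. Cb * X powr 3 * n k powr (- 2))" unfolding mollifier_def
    proof (rule sum_norm_le)
      fix k assume "k \<in> {k. n k \<le> X}"
      then have k: "n k \<le> X" by simp
      have "norm (b k * nexp s k) \<le> (Cb * n k powr 1) * n k powr 0"
        unfolding norm_mult norm_nexp using s n_ge1[of k] Cb(1) by (intro mult_mono Cb(2) powr_mono) auto
      also have "\<dots> = Cb * (n k powr 3 * n k powr (- 2))"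
        using n_pos[of k] unfolding powr_add[symmetric] by simp
      also have "\<dots> \<le> Cb * (X powr 3 * n k powr (- 2))"
        using k n_pos[of k] Cb(1) by (intro mult_left_mono mult_right_mono powr_mono2) auto
      finally show "norm (b k * nexp s k) \<le> Cb * X powr 3 * n k powr (- 2)" by simp
    qed
    also have "\<dots> = Cb * X powr 3 * (\<Sum>k | n k \<le> X. n k powr (- 2))" by (simp add: sum_distrib_left)
    also have "\<dots> \<le> Cb * X powr 3 * S"
      unfolding S_def using Cb(1) by (intro mult_left_mono sum_le_suminf[OF sm n_finite]) auto
    finally show "norm (mollifier X s) \<le> Cb * S * X powr 3" by (simp add: mult_ac)
  qed
qed

text \<open>A single disc has to contain a box of height about ln T without crossing Re s = \<theta>
  + e. Its centre is moved to distance about (ln T)^2/e, where the circle is nearly a vertical line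
  over that height. Then ln (R/r) is only about e/c, but Jensen's bound is still a power of ln
  T.\<close>

lemma local_zero_count:
  assumes kap: "\<kappa> > 0"
  obtains T0 where "T0 \<ge> 3" "\<And>T t Z. T \<ge> T0 \<Longrightarrow> \<bar>t\<bar> \<le> 2 * T \<Longrightarrow> finite Z \<Longrightarrow>
     Z \<subseteq> {\<rho>. (1 + \<theta>) / 2 \<le> Re \<rho> \<and> Re \<rho> \<le> 1 \<and> \<bar>Im \<rho> - t\<bar> \<le> ln T + 2} \<Longrightarrow>
     real (\<Sum>\<rho>\<in>Z. nat (zorder F_reg \<rho>)) \<le> T powr \<kappa>"
proof -
  \<comment> \<open>The interval from \<theta> to (1 + \<theta>)/2 is split into four steps: the
    domain reaches to \<theta> + e, the circles of radius R and r to \<theta> + 2 e and \<theta> + 3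
    e, and the zeros lie at or beyond \<theta> + 4 e.\<close>
  define e where "e = (1 - \<theta>) / 8"
  have e: "e > 0" "e \<le> 1 / 8" "\<theta> + 4 * e = (1 + \<theta>) / 2" using theta by (auto simp: e_def field_simps)
  obtain C where C: "C \<ge> 0" "\<And>s. Re s \<ge> \<theta> + e \<Longrightarrow> norm (F_reg s) \<le> C * (1 + norm s) ^ (degree P + 2)"
    using F_reg_growth[OF e(1)] by blast
  obtain m where m: "m > 0" "\<And>s. Re s \<ge> 2 \<Longrightarrow> norm (F s) \<ge> m" using F_lower_bound by blast
  define d where "d = degree P + 2"
  define A where "A = (C + 1) / m"
  have A: "A > 0" using C m by (simp add: A_def)
  define c where "c T = 3 + (ln T + 2)\<^sup>2 / e" for T :: real
  define Q where "Q T = c T / e * (ln A + real d * ln (1 + 2 * c T + 2 * T))" for T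
  \<comment> \<open>Since c is of order (ln T)^2 and the remaining factor of order ln T, Q grows
    like (ln T)^3 and falls below any positive power of T.\<close>
  have "eventually (\<lambda>T. Q T \<le> T powr \<kappa>) at_top"
    unfolding Q_def c_def using e(1) kap A by real_asymp
  then obtain T1 where T1: "\<And>T. T \<ge> T1 \<Longrightarrow> Q T \<le> T powr \<kappa>" by (auto simp: eventually_at_top_linorder)
  show ?thesis
  proof (rule that[of "max 3 T1"])
    fix T t :: real and Z :: "complex set"
    assume T: "T \<ge> max 3 T1" and t: "\<bar>t\<bar> \<le> 2 * T" and Z: "finite Z"
      "Z \<subseteq> {\<rho>. (1 + \<theta>) / 2 \<le> Re \<rho> \<and> Re \<rho> \<le> 1 \<and> \<bar>Im \<rho> - t\<bar> \<le> ln T + 2}"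
    define U where "U = ln T + 2"
    have U: "U \<ge> 2" using T by (simp add: U_def)
    define cc where "cc = c T"
    have cc: "cc = 3 + U\<^sup>2 / e" by (simp add: cc_def c_def U_def)
    have cc3: "cc \<ge> 3" using e by (simp add: cc)
    define z0 where "z0 = Complex cc t"
    define R' where "R' = cc - (\<theta> + e)"
    define R where "R = cc - (\<theta> + 2 * e)"
    define r where "r = cc - (\<theta> + 3 * e)"
    have r1: "r \<ge> 1 + U\<^sup>2 / e" using e theta by (simp add: r_def cc)
    have r0: "r > 0" using r1 e by (smt (verit) divide_nonneg_pos zero_le_power2)
    have rR: "r < R" "R < R'" using e by (auto simp: r_def R_def R'_def)
    have ballsub: "ball z0 R' \<subseteq> {s. Re s > \<theta> + e}"
    proof
      fix z assume "z \<in> ball z0 R'"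
      then have "norm (z - z0) < R'" by (simp add: dist_norm norm_minus_commute)
      then have "\<bar>Re (z - z0)\<bar> < R'" using abs_Re_le_cmod[of "z - z0"] by linarith
      then show "z \<in> {s. Re s > \<theta> + e}" by (simp add: z0_def R'_def abs_less_iff)
    qed
    have holo: "F_reg holomorphic_on ball z0 R'"
      by (rule holomorphic_on_subset[OF F_reg_holo]) (use ballsub e in force)
    have low: "norm (F_reg z0) \<ge> m"
    proof -
      have z1: "z0 \<noteq> 1" using cc3 by (auto simp: z0_def complex_eq_iff)
      have "norm (z0 - 1) \<ge> 1" using abs_Re_le_cmod[of "z0 - 1"] cc3 by (simp add: z0_def)
      then have p1: "norm (z0 - 1) ^ (degree P + 1) \<ge> 1" by (rule one_le_power)
      have "F_reg z0 = F z0 * (z0 - 1) ^ (degree P + 1)" using z1 by (simp add: F_def)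
      then have "norm (F_reg z0) = norm (F z0) * norm (z0 - 1) ^ (degree P + 1)" by (simp only: norm_mult norm_power)
      moreover have "m * 1 \<le> norm (F z0) * norm (z0 - 1) ^ (degree P + 1)"
        using m(1) m(2)[of z0] cc3 p1 by (intro mult_mono) (auto simp: z0_def)
      ultimately show ?thesis by simp
    qed
    define M where "M = (C + 1) * (1 + 2 * cc + 2 * T) ^ d"
    have Mb: "norm (F_reg z) \<le> M" if z: "dist z0 z = R" for z
    proof -
      have "z \<in> ball z0 R'" using z rR by simp
      then have "Re z \<ge> \<theta> + e" using ballsub by force
      then have "norm (F_reg z) \<le> C * (1 + norm z) ^ d" using C(2) by (simp add: d_def)
      also have "\<dots> \<le> (C + 1) * (1 + 2 * cc + 2 * T) ^ d"
      proof (intro mult_mono power_mono)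
        have "norm z \<le> norm z0 + norm (z - z0)" using norm_triangle_ineq[of z0 "z - z0"] by simp
        also have "norm z0 \<le> cc + 2 * T" using cmod_le[of z0] cc3 t by (simp add: z0_def)
        also have "norm (z - z0) \<le> cc" using z e theta by (simp add: dist_norm norm_minus_commute R_def)
        finally show "1 + norm z \<le> 1 + 2 * cc + 2 * T" by simp
      qed (use C in auto)
      finally show ?thesis by (simp add: M_def)
    qed
    have Zr: "Z \<subseteq> cball z0 r"
    proof
      fix \<rho> assume "\<rho> \<in> Z"
      then have \<rho>: "\<theta> + 4 * e \<le> Re \<rho>" "Re \<rho> \<le> 1" "\<bar>Im \<rho> - t\<bar> \<le> U" using Z(2) e by (auto simp: U_def)
      have 1: "(cc - Re \<rho>)\<^sup>2 \<le> (r - e)\<^sup>2" using \<rho> cc3 by (intro power_mono) (auto simp: r_def)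
      have 2: "(Im \<rho> - t)\<^sup>2 \<le> U\<^sup>2" using \<rho>(3) U by (simp add: abs_le_square_iff[symmetric])
      have "U\<^sup>2 / e \<le> r - 1" using r1 by simp
      then have "U\<^sup>2 \<le> e * (r - 1)" using e by (simp add: field_simps)
      \<comment> \<open>This is the geometric condition for the box to fit: (r - e)^2 + U^2 is at
        most r^2 exactly when U^2 is at most e (2 r - e).\<close>
      also have "\<dots> \<le> e * (2 * r - e)" using e r0 by (intro mult_left_mono) auto
      finally have 3: "U\<^sup>2 \<le> e * (2 * r - e)" .
      have "(norm (z0 - \<rho>))\<^sup>2 = (cc - Re \<rho>)\<^sup>2 + (Im \<rho> - t)\<^sup>2"
        by (simp add: cmod_power2 z0_def power2_commute)
      also have "\<dots> \<le> (r - e)\<^sup>2 + e * (2 * r - e)" using 1 2 3 by linarith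
      also have "\<dots> = r\<^sup>2" by (simp add: power2_eq_square algebra_simps)
      finally have "norm (z0 - \<rho>) \<le> r" using r0 by (simp add: power2_le_iff_abs_le)
      then show "\<rho> \<in> cball z0 r" by (simp add: dist_norm)
    qed
    have nz: "F_reg z0 \<noteq> 0" using low m(1) by auto
    define N where "N = (\<Sum>\<rho>\<in>Z. nat (zorder F_reg \<rho>))"
    have "(R / r) ^ N * norm (F_reg z0) \<le> M"
      unfolding N_def by (rule jensen_bound[OF r0 rR holo nz Mb Z(1) Zr])
    then have "(R / r) ^ N * m \<le> M"
      using r0 rR by (intro order_trans[OF mult_left_mono[OF low, of "(R / r) ^ N"]]) auto
    then have "(R / r) ^ N \<le> A * (1 + 2 * cc + 2 * T) ^ d" using m by (simp add: A_def M_def field_simps)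
    moreover have "(R / r) ^ N > 0" using r0 rR by simp
    ultimately have "ln ((R / r) ^ N) \<le> ln (A * (1 + 2 * cc + 2 * T) ^ d)" by (subst ln_le_cancel_iff) auto
    moreover have "ln ((R / r) ^ N) = real N * ln (R / r)" using r0 rR by (simp add: ln_realpow)
    moreover have "ln (A * (1 + 2 * cc + 2 * T) ^ d) = ln A + real d * ln (1 + 2 * cc + 2 * T)"
      using A cc3 T by (subst ln_mult) (auto simp: ln_realpow)
    ultimately have 1: "real N * ln (R / r) \<le> ln A + real d * ln (1 + 2 * cc + 2 * T)" by simp
    have "ln (r / R) \<le> r / R - 1" using r0 rR by (intro ln_le_minus_one) auto
    moreover have "ln (r / R) = - ln (R / r)" using r0 rR by (simp add: ln_div)
    ultimately have "1 - r / R \<le> ln (R / r)" by simp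
    moreover have "1 - r / R = e / R" using r0 rR by (simp add: field_simps) (simp add: R_def r_def)
    moreover have "e / cc \<le> e / R" using r0 rR e theta cc3 by (intro divide_left_mono) (auto simp: R_def)
    ultimately have "e / cc \<le> ln (R / r)" by simp
    then have "real N * (e / cc) \<le> ln A + real d * ln (1 + 2 * cc + 2 * T)"
      using 1 mult_left_mono[of "e / cc" "ln (R / r)" "real N"] by simp
    then have "real N \<le> Q T" using e cc3 by (simp add: Q_def cc_def[symmetric] field_simps)
    then show "real (\<Sum>\<rho>\<in>Z. nat (zorder F_reg \<rho>)) \<le> T powr \<kappa>"
      using T1[of T] T by (simp add: N_def)
  qed simp
qed

end

section \<open>Zero detection\<close>

lemma vertical_integral_bound:
  fixes f :: "complex \<Rightarrow> complex" and g :: "real \<Rightarrow> real"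
  assumes ab: "a < b" and f: "f contour_integrable_on linepath (Complex c a) (Complex c b)"
    and g: "set_integrable lborel {a..b} g" and le: "\<And>t. a \<le> t \<Longrightarrow> t \<le> b \<Longrightarrow> norm (f (Complex c t)) \<le> g t"
  shows "norm (contour_integral (linepath (Complex c a) (Complex c b)) f) \<le> (LINT t:{a..b}|lborel. g t)"
proof -
  let ?I = "contour_integral (linepath (Complex c a) (Complex c b)) f"
  have "(f has_contour_integral ?I) (linepath (Complex c a) (Complex c b))"
    using f by (rule has_contour_integral_integral)
  then have h: "((\<lambda>t. f (Complex c t)) has_integral (- \<i> * ?I)) {a..b}"
    using has_contour_integral_linepath_same_Re_iff[of "Complex c a" c "Complex c b" a b f ?I] ab by simp
  have "norm ?I = norm (integral {a..b} (\<lambda>t. f (Complex c t)))"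
    using integral_unique[OF h] by (simp add: norm_mult)
  also have "\<dots> \<le> integral {a..b} g"
    using h set_borel_integral_eq_integral(1)[OF g] le by (intro integral_norm_bound_integral) auto
  also have "\<dots> = (LINT t:{a..b}|lborel. g t)" by (rule set_borel_integral_eq_integral(2)[OF g, symmetric])
  finally show ?thesis .
qed

text \<open>Cauchy's formula with the vertical sides kept as integrals, for use with mean values,
  and the horizontal sides bounded by a supremum. On each side norm (s - \<rho>) is at least the
  distance from \<rho> to the line containing that side.\<close>

lemma rectangle_cauchy_bound:
  fixes h :: "complex \<Rightarrow> complex"
  assumes x: "x1 < Re \<rho>" "Re \<rho> < x2" and U: "U > 0"
    and holo: "h holomorphic_on cbox (Complex x1 (Im \<rho> - U)) (Complex x2 (Im \<rho> + U))"
    and g1: "set_integrable lborel {Im \<rho> - U..Im \<rho> + U} g1" and g2: "set_integrable lborel {Im \<rho> - U..Im \<rho> + U} g2"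
    and b1: "\<And>t. Im \<rho> - U \<le> t \<Longrightarrow> t \<le> Im \<rho> + U \<Longrightarrow> norm (h (Complex x1 t)) / (Re \<rho> - x1) \<le> g1 t"
    and b2: "\<And>t. Im \<rho> - U \<le> t \<Longrightarrow> t \<le> Im \<rho> + U \<Longrightarrow> norm (h (Complex x2 t)) / (x2 - Re \<rho>) \<le> g2 t"
    and b3: "\<And>\<sigma> t. x1 \<le> \<sigma> \<Longrightarrow> \<sigma> \<le> x2 \<Longrightarrow> \<bar>t - Im \<rho>\<bar> = U \<Longrightarrow> norm (h (Complex \<sigma> t)) \<le> B"
  shows "2 * pi * norm (h \<rho>) \<le> (LINT t:{Im \<rho> - U..Im \<rho> + U}|lborel. g1 t) + (LINT t:{Im \<rho> - U..Im \<rho> + U}|lborel. g2 t)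
     + 2 * (B / U * (x2 - x1))"
proof -
  define y1 y2 where "y1 = Im \<rho> - U" and "y2 = Im \<rho> + U"
  note yd = y1_def[symmetric] y2_def[symmetric]
  have y: "y1 < Im \<rho>" "Im \<rho> < y2" using U by (auto simp: y1_def y2_def)
  let ?a = "Complex x1 y1" and ?b = "Complex x2 y1" and ?c = "Complex x2 y2" and ?d = "Complex x1 y2"
  let ?S = "cbox ?a ?c"
  define f where "f w = h w / (w - \<rho>)" for w
  have rin: "\<rho> \<in> box ?a ?c" using x y by (simp add: in_box_complex_iff)
  have path: "path_image (rectpath ?a ?c) \<subseteq> ?S - {\<rho>}"
    using path_image_rectpath_subset_cbox[of ?a ?c] path_image_rectpath_inter_box[of ?a ?c] rin x y by auto
  have H: "(f has_contour_integral (2 * pi * \<i> * winding_number (rectpath ?a ?c) \<rho> * h \<rho>)) (rectpath ?a ?c)"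
    unfolding f_def
    by (rule Cauchy_integral_formula_convex_simple[where S = ?S])
       (use holo rin path yd in \<open>auto simp: interior_cbox\<close>)
  have cf: "continuous_on (?S - {\<rho>}) f" unfolding f_def
    by (intro continuous_intros continuous_on_subset[OF holomorphic_on_imp_continuous_on[OF holo[unfolded yd]]]) auto
  have seg: "closed_segment ?a ?b \<subseteq> ?S - {\<rho>}" "closed_segment ?b ?c \<subseteq> ?S - {\<rho>}" "closed_segment ?c ?d \<subseteq> ?S - {\<rho>}" "closed_segment ?d ?a \<subseteq> ?S - {\<rho>}"
    using path by (auto simp: rectpath_def Let_def path_image_join)
  have ci: "f contour_integrable_on linepath u v" if "closed_segment u v \<subseteq> ?S - {\<rho>}" for u v
    by (rule contour_integrable_continuous_linepath) (rule continuous_on_subset[OF cf that])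
  have int: "f contour_integrable_on linepath ?a ?b" "f contour_integrable_on linepath ?b ?c" "f contour_integrable_on linepath ?c ?d" "f contour_integrable_on linepath ?d ?a"
    by (intro ci seg)+
  have sum: "contour_integral (rectpath ?a ?c) f = contour_integral (linepath ?a ?b) f + contour_integral (linepath ?b ?c) f
      + contour_integral (linepath ?c ?d) f + contour_integral (linepath ?d ?a) f"
    unfolding rectpath_def Let_def using int by (simp add: valid_path_join)
  have "contour_integral (rectpath ?a ?c) f = 2 * pi * \<i> * winding_number (rectpath ?a ?c) \<rho> * h \<rho>"
    by (rule contour_integral_unique[OF H])
  also have "winding_number (rectpath ?a ?c) \<rho> = 1" by (rule winding_number_rectpath[OF rin])
  finally have "2 * pi * norm (h \<rho>) = norm (contour_integral (rectpath ?a ?c) f)" by (simp add: norm_mult)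
  also have "\<dots> \<le> norm (contour_integral (linepath ?a ?b) f) + norm (contour_integral (linepath ?b ?c) f)
      + norm (contour_integral (linepath ?c ?d) f) + norm (contour_integral (linepath ?d ?a) f)"
    unfolding sum by (intro norm_triangle_le add_right_mono norm_triangle_le) simp
  finally have main: "2 * pi * norm (h \<rho>) \<le> norm (contour_integral (linepath ?a ?b) f) + norm (contour_integral (linepath ?b ?c) f)
      + norm (contour_integral (linepath ?c ?d) f) + norm (contour_integral (linepath ?d ?a) f)" .
  have B0: "B \<ge> 0" using order_trans[OF norm_ge_zero b3[of x1 y2]] x U by (simp add: y2_def)
  have hor: "norm (contour_integral (linepath u v) f) \<le> B / U * (x2 - x1)"
    if uv: "u = Complex x y \<and> v = Complex x' y" "{x, x'} = {x1, x2}" "\<bar>y - Im \<rho>\<bar> = U" "f contour_integrable_on linepath u v" for u v x x' y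
  proof -
    have xs: "x1 \<le> x" "x \<le> x2" "x1 \<le> x'" "x' \<le> x2" "\<bar>x' - x\<bar> = x2 - x1"
      using uv(2) assms(1,2) by (auto simp: doubleton_eq_iff)
    have "norm (contour_integral (linepath u v) f) \<le> B / U * norm (v - u)"
    proof (rule contour_integral_bound_linepath[OF uv(4)])
      fix w assume w: "w \<in> closed_segment u v"
      have "Im w = y" "Re w \<in> closed_segment x x'"
        using w uv(1) by (auto simp: closed_segment_same_Im)
      then have wx: "Im w = y" "x1 \<le> Re w" "Re w \<le> x2"
        using xs by (auto simp: closed_segment_eq_real_ivl split: if_splits)
      have "norm (h (Complex (Re w) (Im w))) \<le> B" using wx uv(3) by (intro b3) auto
      then have "norm (h w) \<le> B" by (simp only: complex_surj)
      moreover have "U \<le> norm (w - \<rho>)" using abs_Im_le_cmod[of "w - \<rho>"] wx uv(3) by simp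
      ultimately show "norm (f w) \<le> B / U" unfolding f_def norm_divide using U B0 by (intro frac_le) auto
    qed (use B0 U in auto)
    moreover have "norm (v - u) = x2 - x1" using uv(1) xs(5) by (simp add: cmod_def)
    ultimately show ?thesis by simp
  qed
  have "norm (contour_integral (linepath ?a ?b) f) \<le> B / U * (x2 - x1)"
    by (rule hor[where x = x1 and x' = x2 and y = y1]) (use int U in \<open>auto simp: y1_def\<close>)
  moreover have "norm (contour_integral (linepath ?c ?d) f) \<le> B / U * (x2 - x1)"
    by (rule hor[where x = x2 and x' = x1 and y = y2]) (use int U in \<open>auto simp: y2_def\<close>)
  moreover have "norm (contour_integral (linepath ?b ?c) f) \<le> (LINT t:{y1..y2}|lborel. g2 t)"
  proof (rule vertical_integral_bound)
    fix t assume t: "y1 \<le> t" "t \<le> y2"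
    have "x2 - Re \<rho> \<le> norm (Complex x2 t - \<rho>)" using abs_Re_le_cmod[of "Complex x2 t - \<rho>"] x by simp
    then have "norm (f (Complex x2 t)) \<le> norm (h (Complex x2 t)) / (x2 - Re \<rho>)"
      unfolding f_def norm_divide using x by (intro divide_left_mono) (auto intro!: mult_pos_pos)
    then show "norm (f (Complex x2 t)) \<le> g2 t" using b2[of t] t by (simp add: y1_def y2_def)
  qed (use y int g2 yd in auto)
  moreover have "norm (contour_integral (linepath ?d ?a) f) \<le> (LINT t:{y1..y2}|lborel. g1 t)"
  proof -
    have "norm (contour_integral (linepath ?d ?a) f) = norm (contour_integral (linepath ?a ?d) f)"
      using contour_integral_reverse_linepath[of ?a ?d f] cf seg(4)
      by (metis closed_segment_commute continuous_on_subset norm_minus_cancel)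
    also have "\<dots> \<le> (LINT t:{y1..y2}|lborel. g1 t)"
    proof (rule vertical_integral_bound)
      show "f contour_integrable_on linepath ?a ?d" using ci[of ?a ?d] seg(4) by (simp add: closed_segment_commute)
      fix t assume t: "y1 \<le> t" "t \<le> y2"
      have "Re \<rho> - x1 \<le> norm (Complex x1 t - \<rho>)" using abs_Re_le_cmod[of "Complex x1 t - \<rho>"] x by simp
      then have "norm (f (Complex x1 t)) \<le> norm (h (Complex x1 t)) / (Re \<rho> - x1)"
        unfolding f_def norm_divide using x by (intro divide_left_mono) (auto intro!: mult_pos_pos)
      then show "norm (f (Complex x1 t)) \<le> g1 t" using b1[of t] t by (simp add: y1_def y2_def)
    qed (use y g1 yd in auto)
    finally show ?thesis .
  qed
  ultimately show ?thesis using main unfolding yd by linarith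
qed

text \<open>The kernel equals 1 at \<rho>, so h has modulus 1 there and the two vertical integrals
  cannot both be small. On the left, \<phi> already dominates the first power of H by mean-square
  quantities; on the right the first power has to be traded for the square. The result is linear in
  both integrals and can be summed over zeros.\<close>

lemma zero_detection:
  fixes H :: "complex \<Rightarrow> complex"
  assumes x: "x1 + \<delta> \<le> Re \<rho>" "Re \<rho> + \<delta> \<le> x2" "0 \<le> x1" "x2 \<le> 2" and d: "\<delta> > 0" and U: "U \<ge> 1" and Y: "Y \<ge> 1"
    and holo: "H holomorphic_on cbox (Complex x1 (Im \<rho> - U)) (Complex x2 (Im \<rho> + U))"
    and H\<rho>: "H \<rho> = -1"
    and i1: "set_integrable lborel {Im \<rho> - U..Im \<rho> + U} \<phi>" and i2: "set_integrable lborel {Im \<rho> - U..Im \<rho> + U} \<psi>"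
    and b1: "\<And>t. norm (H (Complex x1 t)) \<le> \<phi> t" and b2: "\<And>t. (norm (H (Complex x2 t)))\<^sup>2 = \<psi> t"
    and V: "\<And>s. x1 \<le> Re s \<Longrightarrow> Re s \<le> x2 \<Longrightarrow> \<bar>Im s - Im \<rho>\<bar> = U \<Longrightarrow> norm (H s) \<le> V"
    and small: "V * Y\<^sup>2 * exp (4 - U\<^sup>2) \<le> 1"
  shows "1 \<le> (exp 4 / \<delta> * Y powr (x1 - Re \<rho>)) * (LINT t:{Im \<rho> - U..Im \<rho> + U}|lborel. \<phi> t)
     + U * (exp 4 / \<delta> * Y powr (x2 - Re \<rho>))\<^sup>2 / 2 * (LINT t:{Im \<rho> - U..Im \<rho> + U}|lborel. \<psi> t)"
proof -
  define h where "h s = H s * (exp ((s - \<rho>) * of_real (ln Y)) * exp ((s - \<rho>)\<^sup>2))" for s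
  define I where "I = {Im \<rho> - U..Im \<rho> + U}"
  have nk: "norm (exp ((s - \<rho>) * of_real (ln Y)) * exp ((s - \<rho>)\<^sup>2)) = Y powr (Re s - Re \<rho>) * exp ((Re s - Re \<rho>)\<^sup>2 - (Im s - Im \<rho>)\<^sup>2)" for s
    using Y by (simp add: norm_mult norm_exp_eq_Re powr_def power2_eq_square)
  have nb: "exp ((\<sigma> - Re \<rho>)\<^sup>2 - y\<^sup>2) \<le> exp (4 - y\<^sup>2)" if "x1 \<le> \<sigma>" "\<sigma> \<le> x2" for \<sigma> y
  proof -
    have "\<bar>\<sigma> - Re \<rho>\<bar> \<le> 2" using that x d by linarith
    then have "\<bar>\<sigma> - Re \<rho>\<bar>\<^sup>2 \<le> 2\<^sup>2" by (intro power_mono) auto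
    then show ?thesis by simp
  qed
  have e4: "exp ((\<sigma> - Re \<rho>)\<^sup>2 - y\<^sup>2) \<le> exp 4" if "x1 \<le> \<sigma>" "\<sigma> \<le> x2" for \<sigma> y
    by (rule order_trans[OF nb[OF that]]) simp
  define K1 where "K1 = exp 4 / \<delta> * Y powr (x1 - Re \<rho>)"
  define K2 where "K2 = exp 4 / \<delta> * Y powr (x2 - Re \<rho>)"
  have K: "K1 > 0" "K2 > 0" using d Y by (auto simp: K1_def K2_def)
  have h1: "norm (h (Complex x1 t)) / (Re \<rho> - x1) \<le> K1 * \<phi> t" for t
  proof -
    have "norm (h (Complex x1 t)) \<le> \<phi> t * (Y powr (x1 - Re \<rho>) * exp 4)"
      unfolding h_def norm_mult[of "H _"] nk using e4[of x1 "t - Im \<rho>"] x d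
      by (intro mult_mono b1) (auto intro: order_trans[OF norm_ge_zero b1])
    then have "norm (h (Complex x1 t)) / (Re \<rho> - x1) \<le> \<phi> t * (Y powr (x1 - Re \<rho>) * exp 4) / \<delta>"
      using x d order_trans[OF norm_ge_zero b1[of t]] by (intro frac_le) auto
    then show ?thesis by (simp add: K1_def mult_ac)
  qed
  have h2: "norm (h (Complex x2 t)) / (x2 - Re \<rho>) \<le> U * K2\<^sup>2 / 2 * \<psi> t + 1 / (2 * U)" for t
  proof -
    have "norm (h (Complex x2 t)) \<le> norm (H (Complex x2 t)) * (Y powr (x2 - Re \<rho>) * exp 4)"
      unfolding h_def norm_mult[of "H _"] nk using e4[of x2 "t - Im \<rho>"] x d
      by (intro mult_mono) auto
    then have "norm (h (Complex x2 t)) / (x2 - Re \<rho>) \<le> norm (H (Complex x2 t)) * (Y powr (x2 - Re \<rho>) * exp 4) / \<delta>"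
      using x d by (intro frac_le) auto
    also have "\<dots> = K2 * norm (H (Complex x2 t))" by (simp add: K2_def mult_ac)
    \<comment> \<open>Arithmetic-geometric mean weighted by U: the constant 1/(2 U) integrates to
      exactly 1 over a window of length 2 U.\<close>
    also have "\<dots> \<le> U * (K2 * norm (H (Complex x2 t)))\<^sup>2 / 2 + 1 / (2 * U)"
    proof -
      define z where "z = K2 * norm (H (Complex x2 t))"
      have "0 \<le> (U * z - 1)\<^sup>2 / (2 * U)" using U by simp
      also have "\<dots> = U * z\<^sup>2 / 2 + 1 / (2 * U) - z"
        using U by (simp add: power2_eq_square field_simps)
      finally show ?thesis by (simp add: z_def)
    qed
    also have "\<dots> = U * K2\<^sup>2 / 2 * \<psi> t + 1 / (2 * U)" using b2[of t] by (simp add: power_mult_distrib)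
    finally show ?thesis .
  qed
  have h3: "norm (h (Complex \<sigma> t)) \<le> V * (Y\<^sup>2 * exp (4 - U\<^sup>2))" if "x1 \<le> \<sigma>" "\<sigma> \<le> x2" "\<bar>t - Im \<rho>\<bar> = U" for \<sigma> t
  proof -
    have "(t - Im \<rho>)\<^sup>2 = U\<^sup>2" using that(3) by (metis power2_abs)
    moreover have "Y powr (\<sigma> - Re \<rho>) \<le> Y powr 2" using that x d Y by (intro powr_mono) auto
    ultimately show ?thesis
      unfolding h_def norm_mult[of "H _"] nk using nb[of \<sigma> "t - Im \<rho>"] that Y V[of "Complex \<sigma> t"]
      by (intro mult_mono) (auto intro: order_trans[OF norm_ge_zero])
  qed
  have hh: "h holomorphic_on cbox (Complex x1 (Im \<rho> - U)) (Complex x2 (Im \<rho> + U))"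
    unfolding h_def by (intro holomorphic_intros holo)
  have U0: "U > 0" using U by simp
  have ic: "set_integrable lborel I (\<lambda>t. c)" for c :: real unfolding I_def
    by (rule borel_integrable_atLeastAtMost') (intro continuous_intros)
  have Ic: "(LINT t:I|lborel. c) = 2 * U * c" for c :: real
    using U by (simp add: set_lebesgue_integral_def I_def)
  have g1: "set_integrable lborel I (\<lambda>t. K1 * \<phi> t)" using i1 unfolding I_def by (intro set_integrable_mult_right) auto
  have g2': "set_integrable lborel I (\<lambda>t. U * K2\<^sup>2 / 2 * \<psi> t)" using i2 unfolding I_def by (intro set_integrable_mult_right) auto
  have g2: "set_integrable lborel I (\<lambda>t. U * K2\<^sup>2 / 2 * \<psi> t + 1 / (2 * U))" by (intro set_integral_add(1) g2' ic)
  have xx: "x1 < Re \<rho>" "Re \<rho> < x2" using x d by auto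
  have "2 * pi * norm (h \<rho>) \<le> (LINT t:I|lborel. K1 * \<phi> t) + (LINT t:I|lborel. U * K2\<^sup>2 / 2 * \<psi> t + 1 / (2 * U))
     + 2 * (V * (Y\<^sup>2 * exp (4 - U\<^sup>2)) / U * (x2 - x1))"
    unfolding I_def by (rule rectangle_cauchy_bound[OF xx U0 hh g1[unfolded I_def] g2[unfolded I_def] h1 h2 h3])
  also have "(LINT t:I|lborel. U * K2\<^sup>2 / 2 * \<psi> t + 1 / (2 * U)) = U * K2\<^sup>2 / 2 * (LINT t:I|lborel. \<psi> t) + 1"
    using U by (subst set_integral_add(2)[OF g2' ic]) (simp only: set_integral_mult_right Ic, simp)
  also have "(LINT t:I|lborel. K1 * \<phi> t) = K1 * (LINT t:I|lborel. \<phi> t)" by (simp only: set_integral_mult_right)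
  \<comment> \<open>By \<open>small\<close> and U \<ge> 1 each horizontal side contributes at most
    x2 - x1 \<le> 2.\<close>
  also have "2 * (V * (Y\<^sup>2 * exp (4 - U\<^sup>2)) / U * (x2 - x1)) \<le> 4"
  proof -
    have "V \<ge> 0" using order_trans[OF norm_ge_zero V[of "Complex x1 (Im \<rho> + U)"]] x d U by simp
    then have "V * (Y\<^sup>2 * exp (4 - U\<^sup>2)) / U * (x2 - x1) \<le> 1 / 1 * 2"
      using small U x d by (intro mult_mono frac_le) (auto simp: mult_ac intro!: divide_nonneg_pos)
    then show ?thesis by simp
  qed
  finally have "2 * pi * norm (h \<rho>) \<le> K1 * (LINT t:I|lborel. \<phi> t) + (U * K2\<^sup>2 / 2 * (LINT t:I|lborel. \<psi> t) + 1) + 4" by simp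
  moreover have "norm (h \<rho>) = 1" by (simp add: h_def H\<rho>)
  \<comment> \<open>The left side exceeds 6, while the weighted mean costs 1 and the horizontal
    sides cost 4; more than 1 is left for the two vertical integrals.\<close>
  moreover have "pi > 3" using pi_gt3 by simp
  ultimately show ?thesis unfolding I_def K1_def K2_def by simp
qed

text \<open>Interchange sum and integral: each zero contributes at least 1 over its own window, and
  a point t is covered with total multiplicity at most B. Here \<Phi> must not depend on the
  zero.\<close>

lemma weighted_count:
  fixes w :: "'z \<Rightarrow> nat" and \<Phi> :: "real \<Rightarrow> real"
  assumes Z: "finite Z" and nn: "\<And>t. \<Phi> t \<ge> 0" and i: "set_integrable lborel A \<Phi>" and A: "A \<in> sets borel"
    and I: "\<And>z. z \<in> Z \<Longrightarrow> I z \<subseteq> A" "\<And>z. z \<in> Z \<Longrightarrow> I z \<in> sets borel"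
    and one: "\<And>z. z \<in> Z \<Longrightarrow> 1 \<le> (LINT t:I z|lborel. \<Phi> t)"
    and cnt: "\<And>t. t \<in> A \<Longrightarrow> real (\<Sum>z\<in>{z\<in>Z. t \<in> I z}. w z) \<le> B"
  shows "real (\<Sum>z\<in>Z. w z) \<le> B * (LINT t:A|lborel. \<Phi> t)"
proof -
  have iz: "integrable lborel (\<lambda>t. indicator (I z) t *\<^sub>R \<Phi> t)" if "z \<in> Z" for z
    using set_integrable_subset[OF i _ I(1)[OF that]] I(2)[OF that] by (simp add: set_integrable_def)
  have "real (\<Sum>z\<in>Z. w z) = (\<Sum>z\<in>Z. real (w z) * 1)" by simp
  also have "\<dots> \<le> (\<Sum>z\<in>Z. real (w z) * (LINT t:I z|lborel. \<Phi> t))"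
    by (intro sum_mono mult_left_mono one) auto
  also have "\<dots> = (LINT t|lborel. (\<Sum>z\<in>Z. real (w z) * (indicator (I z) t *\<^sub>R \<Phi> t)))"
    unfolding set_lebesgue_integral_def
    using iz by (subst Bochner_Integration.integral_sum) (auto intro!: integrable_mult_right)
  also have "\<dots> \<le> (LINT t|lborel. B * (indicator A t *\<^sub>R \<Phi> t))"
  proof (rule integral_mono)
    show "integrable lborel (\<lambda>t. \<Sum>z\<in>Z. real (w z) * (indicator (I z) t *\<^sub>R \<Phi> t))"
      using iz by (intro Bochner_Integration.integrable_sum integrable_mult_right)
    show "integrable lborel (\<lambda>t. B * (indicator A t *\<^sub>R \<Phi> t))"
      using i unfolding set_integrable_def by (rule integrable_mult_right)
    fix t :: real
    have "(\<Sum>z\<in>Z. real (w z) * (indicator (I z) t *\<^sub>R \<Phi> t)) = (\<Sum>z\<in>Z. if t \<in> I z then real (w z) * \<Phi> t else 0)"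
      by (intro sum.cong) auto
    also have "\<dots> = (\<Sum>z\<in>{z\<in>Z. t \<in> I z}. real (w z) * \<Phi> t)" by (rule sum.inter_filter[symmetric, OF Z])
    also have "\<dots> = real (\<Sum>z\<in>{z\<in>Z. t \<in> I z}. w z) * \<Phi> t" by (simp add: sum_distrib_right)
    also have "\<dots> \<le> B * (indicator A t *\<^sub>R \<Phi> t)"
    proof (cases "t \<in> A")
      case True
      then show ?thesis using mult_right_mono[OF cnt[OF True] nn[of t]] by simp
    next
      case False
      then have "{z\<in>Z. t \<in> I z} = {}" using I(1) by auto
      then have "(\<Sum>z\<in>{z\<in>Z. t \<in> I z}. w z) = 0" by (simp only: sum.empty)
      then show ?thesis using False by simp
    qed
    finally show "(\<Sum>z\<in>Z. real (w z) * (indicator (I z) t *\<^sub>R \<Phi> t)) \<le> B * (indicator A t *\<^sub>R \<Phi> t)" .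
  qed
  also have "\<dots> = B * (LINT t:A|lborel. \<Phi> t)" unfolding set_lebesgue_integral_def by (rule integral_mult_right_zero)
  finally show ?thesis .
qed

section \<open>The zero density estimate\<close>

context dirichlet_pair
begin

section \<open>Pole, zeros and multiplicities of the continuation\<close>

lemma F_reg_1: "F_reg 1 \<noteq> 0"
proof -
  define D where "D = degree P"
  \<comment> \<open>At s = 1 only k = D survives, as \<open>0 ^ 0 = 1\<close>; the constant left
    over is D! times the leading coefficient of P, and the Laplace term carries a factor s -
    1.\<close>
  have "(\<Sum>k\<le>D. of_real (poly ((pderiv ^^ k) P) 0) * (1 - 1) ^ (D - k)) = (\<Sum>k\<in>{D}. of_real (poly ((pderiv ^^ k) P) 0) :: complex)"
    by (rule sum.mono_neutral_cong_right) auto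
  then have "F_reg 1 = of_real (poly ((pderiv ^^ D) P) 0)" by (simp add: F_reg_def D_def)
  moreover have "poly ((pderiv ^^ D) P) 0 = pochhammer 1 D * lead_coeff P"
    by (simp add: poly_0_coeff_0 coeff_higher_pderiv D_def)
  moreover have "pochhammer (1 :: real) D \<noteq> 0" by (simp add: pochhammer_fact[symmetric])
  ultimately show ?thesis using P_nonzero by simp
qed

lemma halfplane: "open {s. Re s > \<theta>}" "connected {s. Re s > \<theta>}" "1 \<in> {s. Re s > \<theta>}"
  using theta by (auto intro: open_halfspace_Re_gt convex_connected convex_halfspace_Re_gt)

lemma F_pole: "is_pole F 1" "zorder F 1 = - int (degree P + 1)"
proof -
  have "isCont F_reg 1"
    using F_reg_holo halfplane by (meson continuous_on_eq_continuous_at holomorphic_on_imp_continuous_on)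
  moreover have "filterlim (\<lambda>s. (s - 1) ^ (degree P + 1) :: complex) (at 0) (at 1)"
  proof -
    have "((\<lambda>s. (s - 1) ^ (degree P + 1)) \<longlongrightarrow> (1 - 1 :: complex) ^ (degree P + 1)) (at 1)" by (intro tendsto_intros)
    then show ?thesis by (auto simp: filterlim_at eventually_at_filter)
  qed
  ultimately show "is_pole F 1" unfolding F_def[abs_def] using F_reg_1 by (rule is_pole_divide)
  show "zorder F 1 = - int (degree P + 1)"
    by (rule zorder_eqI[OF halfplane(1,3) F_reg_holo F_reg_1]) (simp only: F_def power_int_minus power_int_of_nat divide_inverse)
qed

lemma F_meromorphic: "F meromorphic_on {s. Re s > \<theta>}"
proof -
  have "F_reg analytic_on {s. Re s > \<theta>}" using F_reg_holo halfplane(1) by (simp add: analytic_on_open)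
  then show ?thesis unfolding F_def[abs_def]
    by (intro meromorphic_on_divide analytic_on_imp_meromorphic_on analytic_intros)
qed

text \<open>Away from 1 the quotient F / F_reg is analytic and nonzero. Additivity of orders needs
  F_reg to be not identically zero near \<rho>, which follows from its value at 1 by
  connectedness.\<close>

lemma zorder_F:
  assumes s: "Re \<rho> > \<theta>" "\<rho> \<noteq> 1"
  shows "zorder F \<rho> = zorder F_reg \<rho>"
proof -
  let ?g = "\<lambda>s. 1 / (s - 1) ^ (degree P + 1) :: complex"
  have Fa: "F_reg analytic_on {\<rho>}" using F_reg_holo halfplane(1) s(1) by (intro holomorphic_on_imp_analytic_at) auto
  have ga: "?g analytic_on {\<rho>}" using s(2) by (intro analytic_intros) auto
  have "\<forall>\<^sub>F w in at \<rho>. F_reg w \<noteq> 0 \<and> w \<in> {s. Re s > \<theta>}"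
    by (rule non_zero_neighbour_alt[OF F_reg_holo halfplane(1,2) _ halfplane(3) F_reg_1]) (use s in auto)
  moreover have "\<forall>\<^sub>F w in at \<rho>. w \<noteq> 1" using s(2) by (simp add: eventually_neq_at_within)
  ultimately have ev: "\<forall>\<^sub>F w in at \<rho>. F_reg w * ?g w \<noteq> 0" by eventually_elim auto
  have "F = (\<lambda>s. F_reg s * ?g s)" by (simp add: F_def fun_eq_iff)
  then have "zorder F \<rho> = zorder F_reg \<rho> + zorder ?g \<rho>"
    using zorder_times_analytic[OF Fa ga ev] by simp
  also have "zorder ?g \<rho> = 0" by (rule zorder_eq_0I[OF ga]) (use s(2) in auto)
  finally show ?thesis by simp
qed

text \<open>The analyticity condition removes the junk zero of \<open>F\<close> at the pole, and
  nonvanishing for Re s > 1 closes the region on the right. Zeros can then be handled through the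
  holomorphic \<open>F_reg\<close>.\<close>

lemma zeros_in_F:
  assumes al: "\<alpha> > \<theta>"
  shows "zeros_in F \<alpha> T = {\<rho>. F_reg \<rho> = 0 \<and> \<alpha> \<le> Re \<rho> \<and> Re \<rho> \<le> 1 \<and> \<bar>Im \<rho>\<bar> \<le> T}"
proof -
  have "F analytic_on {\<rho>} \<and> F \<rho> = 0 \<longleftrightarrow> F_reg \<rho> = 0 \<and> Re \<rho> \<le> 1" if "Re \<rho> \<ge> \<alpha>" for \<rho>
  proof (cases "\<rho> = 1")
    case True
    then show ?thesis using F_pole(1) F_reg_1 analytic_at_imp_no_pole by auto
  next
    case False
    have "open ({s. Re s > \<theta>} - {1})" using halfplane(1) by (intro open_Diff) auto
    then have "F analytic_on {\<rho>}"
      using F_holo False that al by (intro holomorphic_on_imp_analytic_at[of F "{s. Re s > \<theta>} - {1}"]) auto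
    moreover have "Re \<rho> \<le> 1" if "F \<rho> = 0" using F_nonzero[of \<rho>] that by force
    ultimately show ?thesis using F_regular_off_1[of \<rho>] False that al by auto
  qed
  then show ?thesis unfolding zeros_in_def by auto
qed

lemma finite_zeros_in_F:
  assumes al: "\<alpha> > \<theta>"
  shows "finite (zeros_in F \<alpha> T)"
proof -
  let ?K = "cbox (Complex \<alpha> (- T)) (Complex 1 T)"
  have eq: "zeros_in F \<alpha> T = {\<rho>\<in>?K. F_reg \<rho> = 0}" unfolding zeros_in_F[OF al] by (auto simp: in_cbox_complex_iff abs_le_iff)
  show ?thesis
  proof (cases "F_reg constant_on {s. Re s > \<theta>}")
    case True
    then obtain c where c: "\<And>s. Re s > \<theta> \<Longrightarrow> F_reg s = c" by (auto simp: constant_on_def)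
    have "F_reg s \<noteq> 0" if "s \<in> ?K" for s using c[of s] c[of 1] F_reg_1 that al theta by (auto simp: in_cbox_complex_iff)
    then have "{\<rho>\<in>?K. F_reg \<rho> = 0} = {}" by blast
    then show ?thesis unfolding eq by (simp only: finite.emptyI)
  next
    case False
    show ?thesis unfolding eq
      by (rule holomorphic_compact_finite_zeros[OF F_reg_holo halfplane(1,2) compact_cbox _ False])
         (use al in \<open>auto simp: in_cbox_complex_iff\<close>)
  qed
qed

lemma zero_count_F:
  assumes al: "\<alpha> > \<theta>"
  shows "zero_count F \<alpha> T = (\<Sum>\<rho>\<in>zeros_in F \<alpha> T. nat (zorder F_reg \<rho>))"
  unfolding zero_count_def
proof (intro sum.cong refl)
  fix \<rho> assume "\<rho> \<in> zeros_in F \<alpha> T"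
  then have "F_reg \<rho> = 0" "Re \<rho> > \<theta>" using al by (auto simp: zeros_in_F[OF al])
  then have "\<rho> \<noteq> 1" using F_reg_1 by auto
  then show "nat (zorder F \<rho>) = nat (zorder F_reg \<rho>)" using zorder_F[of \<rho>] \<open>Re \<rho> > \<theta>\<close> by simp
qed

section \<open>Crude growth, choice of parameters and the final count\<close>

lemma mollifier_holo: "mollifier X holomorphic_on A"
  unfolding mollifier_def nexp_def by (intro holomorphic_intros)

lemma mollified_growth:
  assumes d: "\<delta> > 0"
  obtains A where "A > 0" "\<And>s X T. T \<ge> 1 \<Longrightarrow> X \<ge> 1 \<Longrightarrow> \<theta> + \<delta> \<le> Re s \<Longrightarrow> norm s \<le> 2 + 2 * T \<Longrightarrow> 1 \<le> \<bar>Im s\<bar> \<Longrightarrow>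
     norm (F s * mollifier X s - 1) \<le> A * (3 + 2 * T) ^ (degree P + 2) * X powr 3 + 1"
proof -
  obtain Cg where Cg: "Cg \<ge> 0" "\<And>s. Re s \<ge> \<theta> + \<delta> \<Longrightarrow> norm (F_reg s) \<le> Cg * (1 + norm s) ^ (degree P + 2)"
    using F_reg_growth[OF d] by blast
  obtain Cm where Cm: "Cm \<ge> 0" "\<And>s X. Re s \<ge> 0 \<Longrightarrow> X \<ge> 1 \<Longrightarrow> norm (mollifier X s) \<le> Cm * X powr 3"
    using mollifier_growth by blast
  show ?thesis
  proof (rule that[of "Cg * Cm + 1"])
    show "Cg * Cm + 1 > 0" using Cg(1) Cm(1) by (simp add: add_nonneg_pos)
    fix s :: complex and X T :: real
    assume T: "T \<ge> 1" and X: "X \<ge> 1" and s: "\<theta> + \<delta> \<le> Re s" "norm s \<le> 2 + 2 * T" "1 \<le> \<bar>Im s\<bar>"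
    have "1 \<le> norm (s - 1)" using abs_Im_le_cmod[of "s - 1"] s(3) by simp
    then have p: "1 \<le> norm (s - 1) ^ (degree P + 1)" by (rule one_le_power)
    have "norm (F s) = norm (F_reg s) / norm (s - 1) ^ (degree P + 1)" by (simp only: F_def norm_divide norm_power)
    also have "\<dots> \<le> norm (F_reg s) / 1" using p by (intro divide_left_mono) auto
    also have "\<dots> \<le> Cg * (1 + norm s) ^ (degree P + 2)" using Cg(2)[OF s(1)] by simp
    also have "\<dots> \<le> Cg * (3 + 2 * T) ^ (degree P + 2)" using s(2) Cg(1) by (intro mult_left_mono power_mono) auto
    finally have "norm (F s) * norm (mollifier X s) \<le> (Cg * (3 + 2 * T) ^ (degree P + 2)) * (Cm * X powr 3)"
      using Cm(2)[of s X] X s(1) theta d Cg(1) T by (intro mult_mono) auto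
    also have "\<dots> = (Cg * Cm) * ((3 + 2 * T) ^ (degree P + 2) * X powr 3)" by (simp only: mult_ac)
    also have "\<dots> \<le> (Cg * Cm + 1) * ((3 + 2 * T) ^ (degree P + 2) * X powr 3)" using T by (intro mult_right_mono) auto
    finally have "norm (F s * mollifier X s) \<le> (Cg * Cm + 1) * (3 + 2 * T) ^ (degree P + 2) * X powr 3"
      by (simp only: norm_mult mult.assoc)
    then show "norm (F s * mollifier X s - 1) \<le> (Cg * Cm + 1) * (3 + 2 * T) ^ (degree P + 2) * X powr 3 + 1"
      using norm_triangle_ineq4[of "F s * mollifier X s" 1] by simp
  qed
qed

text \<open>Zeros of height at least ln T + 1 are detected by \<open>zero_detection\<close> and
  summed with \<open>weighted_count\<close>; the others lie in one short box. All losses are powers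
  of T with exponents \<kappa> or e, in total at most 3 \<epsilon>/4, so the bound is uniform in
  \<alpha>.\<close>

lemma zero_density_large:
  assumes eps: "\<epsilon> > 0"
  obtains C T0 where "C \<ge> 0" "T0 \<ge> 3" "\<And>\<alpha> T. T \<ge> T0 \<Longrightarrow> (1 + \<theta>) / 2 \<le> \<alpha> \<Longrightarrow> \<alpha> \<le> 1 \<Longrightarrow>
     real (zero_count F \<alpha> T) \<le> C * T powr (4 * (1 - \<alpha>) / (3 - 2 * \<alpha> - \<theta>) + \<epsilon>)"
proof -
  have th: "1 - \<theta> > 0" using theta by simp
  define \<kappa> where "\<kappa> = \<epsilon> / 4"
  have kap: "\<kappa> > 0" using eps by (simp add: \<kappa>_def)
  define m where "m = min 1 \<epsilon>"
  have m: "m > 0" "m \<le> 1" "m \<le> \<epsilon>" using eps by (auto simp: m_def)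
  \<comment> \<open>Chosen so that the mean-square loss e = 4 \<delta>/(1 - \<theta>) equals m/4,
    which is at most \<epsilon>/4.\<close>
  define \<delta> where "\<delta> = m * (1 - \<theta>) / 16"
  have md: "m * (1 - \<theta>) \<le> 1 - \<theta>" "m * (1 - \<theta>) > 0" using m th by (auto simp: mult_left_le_one_le)
  have d: "\<delta> > 0" "16 * \<delta> \<le> 1 - \<theta>" using md by (auto simp: \<delta>_def)
  have d': "\<delta> \<le> 1" "8 * \<delta> < 1 - \<theta>" using d th theta by linarith+
  define e where "e = 4 * \<delta> / (1 - \<theta>)"
  have em: "e = m / 4"
  proof -
    have *: "4 * (m * z / 16) / z = m / 4" if "z \<noteq> 0" for z :: real using that by simp
    show ?thesis unfolding e_def \<delta>_def by (rule *) (use th in simp)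
  qed
  have e: "e > 0" "e \<le> 1" "e \<le> \<kappa>" using m by (auto simp: em \<kappa>_def)
  define x1 where "x1 = (1 + \<theta>) / 2 - \<delta>"
  define x2 where "x2 = 1 + \<delta>"
  have x: "\<theta> + (1 - \<theta>) / 4 \<le> x1" "x1 > \<theta>" "0 \<le> x1" "x1 \<le> x2" "x2 \<le> 2"
    using d d' theta by (auto simp: x1_def x2_def field_simps)
  obtain CH where CH: "CH \<ge> 0" "\<And>T X. T \<ge> 1 \<Longrightarrow> X \<ge> 1 \<Longrightarrow>
    set_integrable lborel {-T..T} (\<lambda>t. (norm (F (Complex x2 t) * mollifier X (Complex x2 t) - 1))\<^sup>2) \<and>
    (LINT t:{-T..T}|lborel. (norm (F (Complex x2 t) * mollifier X (Complex x2 t) - 1))\<^sup>2) \<le> CH * (1 + T * X powr (\<theta> - 1))"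
    using mollified_mean_square[OF d(1) d'(1)] unfolding x2_def by blast
  obtain CF where CF: "CF \<ge> 0" "\<And>T. T \<ge> 1 \<Longrightarrow>
    set_integrable lborel (height_band T) (\<lambda>t. (norm (F (Complex x1 t)))\<^sup>2) \<and>
    (LINT t:height_band T|lborel. (norm (F (Complex x1 t)))\<^sup>2) \<le> CF * T powr (1 + e)"
    using F_mean_square[OF d(1) d'(2)] unfolding x1_def e_def by blast
  obtain CM where CM: "CM \<ge> 0" "\<And>T. T \<ge> 1 \<Longrightarrow>
    set_integrable lborel {-T..T} (\<lambda>t. (norm (mollifier (T powr (1 / (1 - \<theta>))) (Complex x1 t)))\<^sup>2) \<and>
    (LINT t:{-T..T}|lborel. (norm (mollifier (T powr (1 / (1 - \<theta>))) (Complex x1 t)))\<^sup>2) \<le> CM * T powr (1 + e)"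
    using mollifier_mean_square[OF d(1) d'(1)] unfolding x1_def e_def by blast
  obtain T1 where T1: "T1 \<ge> 3" "\<And>T t Z. T \<ge> T1 \<Longrightarrow> \<bar>t\<bar> \<le> 2 * T \<Longrightarrow> finite Z \<Longrightarrow>
     Z \<subseteq> {\<rho>. (1 + \<theta>) / 2 \<le> Re \<rho> \<and> Re \<rho> \<le> 1 \<and> \<bar>Im \<rho> - t\<bar> \<le> ln T + 2} \<Longrightarrow>
     real (\<Sum>\<rho>\<in>Z. nat (zorder F_reg \<rho>)) \<le> T powr \<kappa>"
    using local_zero_count[OF kap] by blast
  have th4: "(1 - \<theta>) / 4 > 0" using th by simp
  obtain A where A: "A > 0" "\<And>s X T. T \<ge> 1 \<Longrightarrow> X \<ge> 1 \<Longrightarrow> \<theta> + (1 - \<theta>) / 4 \<le> Re s \<Longrightarrow> norm s \<le> 2 + 2 * T \<Longrightarrow> 1 \<le> \<bar>Im s\<bar> \<Longrightarrow>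
     norm (F s * mollifier X s - 1) \<le> A * (3 + 2 * T) ^ (degree P + 2) * X powr 3 + 1"
    using mollified_growth[OF th4] by blast
  \<comment> \<open>Exponents for the horizontal sides: the cube of X is (2 T)^k1, and the square of
    Y is at most T^k2 because D is at least 1 - \<theta>. They do not depend on \<alpha>, so one
    threshold T2 serves all \<alpha>.\<close>
  define k1 where "k1 = 3 / (1 - \<theta>)"
  define k2 where "k2 = 4 / (1 - \<theta>)"
  define g where "g = degree P + 2"
  have "eventually (\<lambda>T. (A * (3 + 2 * T) ^ g * (2 * T) powr k1 + 1) * T powr k2 * exp (4 - (ln T)\<^sup>2) \<le> 1) at_top"
    using A(1) by real_asymp
  then obtain T2 where T2: "\<And>T. T \<ge> T2 \<Longrightarrow> (A * (3 + 2 * T) ^ g * (2 * T) powr k1 + 1) * T powr k2 * exp (4 - (ln T)\<^sup>2) \<le> 1"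
    by (auto simp: eventually_at_top_linorder)
  have "eventually (\<lambda>T. ln T \<le> T powr \<kappa>) at_top" using kap by real_asymp
  then obtain T3 where T3: "\<And>T. T \<ge> T3 \<Longrightarrow> ln T \<le> T powr \<kappa>" by (auto simp: eventually_at_top_linorder)
  define C4 where "C4 = 4 + 2 * CF + 2 * CM"
  define C5 where "C5 = exp 4 / \<delta> * C4"
  define C6 where "C6 = (exp 4 / \<delta>)\<^sup>2 * CH"
  have C456: "C4 \<ge> 0" "C5 \<ge> 0" "C6 \<ge> 0" using CF(1) CM(1) CH(1) d(1) by (auto simp: C4_def C5_def C6_def)
  show ?thesis
  proof (rule that[of "1 + C5 + C6" "max T1 (max T2 T3)"])
    show "1 + C5 + C6 \<ge> 0" using C456 by simp
    show "max T1 (max T2 T3) \<ge> 3" using T1(1) by simp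
    fix \<alpha> T :: real
    assume T: "T \<ge> max T1 (max T2 T3)" and al: "(1 + \<theta>) / 2 \<le> \<alpha>" "\<alpha> \<le> 1"
    have TT: "T \<ge> 3" "T \<ge> T1" "T \<ge> T2" "T \<ge> T3" using T T1(1) by auto
    have al\<theta>: "\<alpha> > \<theta>" using al theta by (simp add: field_simps)
    \<comment> \<open>This length balances two needs: exp(-U^2) = T^(-ln T) beats every power of T
      on the horizontal sides, and windows of length 2 U overlap at most T^\<kappa> times.\<close>
    define U where "U = ln T"
    have U: "U \<ge> 1" "U \<le> T" "U \<le> T powr \<kappa>"
    proof -
      have "exp 1 \<le> T" using exp_le TT(1) by linarith
      then show "U \<ge> 1" using TT(1) by (simp add: U_def ln_ge_iff)
      show "U \<le> T" using TT(1) ln_le_minus_one[of T] by (simp add: U_def)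
      show "U \<le> T powr \<kappa>" using T3[OF TT(4)] by (simp add: U_def)
    qed
    define D where "D = 3 - 2 * \<alpha> - \<theta>"
    have D: "D \<ge> 1 - \<theta>" "D > 0" using al th by (auto simp: D_def)
    define Y where "Y = T powr (2 / D)"
    have Y: "Y \<ge> 1" unfolding Y_def using TT(1) D by (intro ge_one_powr_ge_zero) auto
    have Ypow: "Y powr z = T powr (2 * z / D)" for z by (simp add: Y_def powr_powr)
    \<comment> \<open>Matched to the height 2 T of the band below: 2 T times X^(\<theta> - 1) is
      exactly 1, so the right-hand mean square is bounded, and the mollifier estimate applies at
      height 2 T.\<close>
    define X where "X = (2 * T) powr (1 / (1 - \<theta>))"
    have T2': "2 * T \<ge> 1" using TT by simp
    have X: "X \<ge> 1" unfolding X_def using T2' th by (intro ge_one_powr_ge_zero) auto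
    define E where "E = 4 * (1 - \<alpha>) / D"
    have E: "E \<ge> 0" using al D by (simp add: E_def)
    define H where "H s = F s * mollifier X s - 1" for s
    define \<phi> where "\<phi> t = 1 + ((norm (F (Complex x1 t)))\<^sup>2 + (norm (mollifier X (Complex x1 t)))\<^sup>2) / 2" for t
    define \<psi> where "\<psi> t = (norm (H (Complex x2 t)))\<^sup>2" for t
    define A1 where "A1 = exp 4 / \<delta> * Y powr (x1 - \<alpha>)"
    define A2 where "A2 = U * (exp 4 / \<delta> * Y powr (x2 - \<alpha>))\<^sup>2 / 2"
    have A12: "A1 \<ge> 0" "A2 \<ge> 0" using d(1) U(1) by (auto simp: A1_def A2_def)
    define \<Phi> where "\<Phi> t = A1 * \<phi> t + A2 * \<psi> t" for t
    have nn: "\<phi> t \<ge> 0" "\<psi> t \<ge> 0" "\<Phi> t \<ge> 0" for t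
      unfolding \<Phi>_def \<phi>_def \<psi>_def using A12 by (auto intro!: add_nonneg_nonneg mult_nonneg_nonneg divide_nonneg_nonneg)
    \<comment> \<open>Windows about zeros of height at most T stick out by U \<le> T, hence the
      doubled height.\<close>
    let ?An = "height_band (2 * T)"
    have sub: "?An \<subseteq> {-(2 * T)..2 * T}" by (rule height_band_sub)
    have mono_an: "set_integrable lborel ?An f \<and> (LINT t:?An|lborel. f t) \<le> (LINT t:{-(2*T)..2*T}|lborel. f t)"
      if f: "set_integrable lborel {-(2*T)..2*T} f" and f0: "\<And>t. f t \<ge> 0" for f :: "real \<Rightarrow> real"
    proof
      show i: "set_integrable lborel ?An f" by (rule set_integrable_subset[OF f _ sub]) simp
      show "(LINT t:?An|lborel. f t) \<le> (LINT t:{-(2*T)..2*T}|lborel. f t)"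
        unfolding set_lebesgue_integral_def
        by (rule integral_mono) (use i f f0 sub in \<open>auto simp: set_integrable_def indicator_def\<close>)
    qed
    have i1: "set_integrable lborel {-(2*T)..2*T} (\<lambda>t. 1 :: real)"
      by (rule borel_integrable_atLeastAtMost') (intro continuous_intros)
    have I1: "(LINT t:?An|lborel. (1::real)) \<le> 4 * T" and i1': "set_integrable lborel ?An (\<lambda>t. 1 :: real)"
      using mono_an[OF i1] TT(1) by (auto simp: set_lebesgue_integral_def)
    have IF: "set_integrable lborel ?An (\<lambda>t. (norm (F (Complex x1 t)))\<^sup>2)" "(LINT t:?An|lborel. (norm (F (Complex x1 t)))\<^sup>2) \<le> CF * (2 * T) powr (1 + e)"
      using CF(2)[OF T2'] by auto
    have IM: "set_integrable lborel ?An (\<lambda>t. (norm (mollifier X (Complex x1 t)))\<^sup>2)" "(LINT t:?An|lborel. (norm (mollifier X (Complex x1 t)))\<^sup>2) \<le> CM * (2 * T) powr (1 + e)"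
      using CM(2)[OF T2'] mono_an[of "\<lambda>t. (norm (mollifier X (Complex x1 t)))\<^sup>2"] unfolding X_def[symmetric] by auto
    have I\<psi>: "set_integrable lborel ?An \<psi>" "(LINT t:?An|lborel. \<psi> t) \<le> 2 * CH"
    proof -
      have "X powr (\<theta> - 1) = (2 * T) powr (-1)" unfolding X_def powr_powr
        using th by (intro arg_cong[of _ _ "(powr) (2 * T)"]) (simp add: field_simps)
      also have "\<dots> = 1 / (2 * T)" using T2' by (simp only: powr_minus_divide powr_one)
      finally have "2 * T * X powr (\<theta> - 1) = 1" using TT by (simp only:) simp
      then show "set_integrable lborel ?An \<psi>" "(LINT t:?An|lborel. \<psi> t) \<le> 2 * CH"
        using CH(2)[OF T2' X] mono_an[of \<psi>] nn(2) unfolding \<psi>_def[abs_def] H_def by auto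
    qed
    have i\<phi>: "set_integrable lborel ?An \<phi>" unfolding \<phi>_def
      by (intro set_integral_add(1) set_integrable_divide i1' IF(1) IM(1))
    have I\<phi>: "(LINT t:?An|lborel. \<phi> t) \<le> C4 * T powr (1 + e)"
    proof -
      have "(2 * T) powr (1 + e) = 2 powr (1 + e) * T powr (1 + e)" using TT by (simp add: powr_mult)
      also have "\<dots> \<le> 2 powr 2 * T powr (1 + e)" using e by (intro mult_right_mono powr_mono) auto
      finally have 2: "(2 * T) powr (1 + e) \<le> 4 * T powr (1 + e)" by simp
      have "T powr 1 \<le> T powr (1 + e)" using TT(1) e by (intro powr_mono) auto
      then have 3: "T \<le> T powr (1 + e)" using TT(1) by simp
      have "(LINT t:?An|lborel. \<phi> t) = (LINT t:?An|lborel. 1) + ((LINT t:?An|lborel. (norm (F (Complex x1 t)))\<^sup>2) + (LINT t:?An|lborel. (norm (mollifier X (Complex x1 t)))\<^sup>2)) / 2"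
        unfolding \<phi>_def
        by (subst set_integral_add(2)[OF i1' set_integrable_divide[OF set_integral_add(1)[OF IF(1) IM(1)]]],
            subst set_integral_divide_zero, subst set_integral_add(2)[OF IF(1) IM(1)]) (rule refl)
      also have "\<dots> \<le> 4 * T powr (1 + e) + (CF * (4 * T powr (1 + e)) + CM * (4 * T powr (1 + e))) / 2"
      proof (intro add_mono divide_right_mono)
        show "(LINT t:?An|lborel. (1::real)) \<le> 4 * T powr (1 + e)" using I1 3 by linarith
        show "(LINT t:?An|lborel. (norm (F (Complex x1 t)))\<^sup>2) \<le> CF * (4 * T powr (1 + e))"
          by (rule order_trans[OF IF(2) mult_left_mono[OF 2 CF(1)]])
        show "(LINT t:?An|lborel. (norm (mollifier X (Complex x1 t)))\<^sup>2) \<le> CM * (4 * T powr (1 + e))"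
          by (rule order_trans[OF IM(2) mult_left_mono[OF 2 CM(1)]])
      qed simp
      also have "\<dots> = C4 * T powr (1 + e)" by (simp add: C4_def algebra_simps)
      finally show ?thesis .
    qed
    have i\<Phi>: "set_integrable lborel ?An \<Phi>" unfolding \<Phi>_def
      by (intro set_integral_add(1) set_integrable_mult_right i\<phi> I\<psi>(1))
    have I\<Phi>: "(LINT t:S|lborel. \<Phi> t) = A1 * (LINT t:S|lborel. \<phi> t) + A2 * (LINT t:S|lborel. \<psi> t)"
      if "S \<subseteq> ?An" "S \<in> sets lborel" for S
      using set_integrable_subset[OF i\<phi> that(2,1)] set_integrable_subset[OF I\<psi>(1) that(2,1)] unfolding \<Phi>_def
      by (subst set_integral_add(2)) (auto intro: set_integrable_mult_right)
    define Z where "Z = zeros_in F \<alpha> T"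
    \<comment> \<open>The window about such a zero may reach heights below 1, close to the pole. All
      of them lie in one box about height 0, where \<open>local_zero_count\<close> suffices.\<close>
    define Z0 where "Z0 = {\<rho>\<in>Z. \<bar>Im \<rho>\<bar> < U + 1}"
    define Z1 where "Z1 = {\<rho>\<in>Z. \<bar>Im \<rho>\<bar> \<ge> U + 1}"
    define w where "w \<rho> = nat (zorder F_reg \<rho>)" for \<rho>
    have Zfin: "finite Z" unfolding Z_def by (rule finite_zeros_in_F[OF al\<theta>])
    have Zp: "F_reg \<rho> = 0 \<and> \<alpha> \<le> Re \<rho> \<and> Re \<rho> \<le> 1 \<and> \<bar>Im \<rho>\<bar> \<le> T" if "\<rho> \<in> Z" for \<rho>
      using that unfolding Z_def zeros_in_F[OF al\<theta>] by simp
    have "real (\<Sum>\<rho>\<in>Z0. w \<rho>) \<le> T powr \<kappa>" unfolding w_def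
    proof (rule T1(2)[OF TT(2), where t = 0])
      show "finite Z0" using Zfin by (simp add: Z0_def)
      show "Z0 \<subseteq> {\<rho>. (1 + \<theta>) / 2 \<le> Re \<rho> \<and> Re \<rho> \<le> 1 \<and> \<bar>Im \<rho> - 0\<bar> \<le> ln T + 2}"
        using Zp al(1) by (fastforce simp: Z0_def U_def)
    qed (use TT in auto)
    also have "T powr \<kappa> \<le> T powr (E + \<epsilon>)" using TT(1) E eps by (intro powr_mono) (auto simp: \<kappa>_def)
    finally have low: "real (\<Sum>\<rho>\<in>Z0. w \<rho>) \<le> T powr (E + \<epsilon>)" .
    have "real (\<Sum>\<rho>\<in>Z1. w \<rho>) \<le> T powr \<kappa> * (LINT t:?An|lborel. \<Phi> t)"
    proof (rule weighted_count[where I = "\<lambda>\<rho>. {Im \<rho> - U..Im \<rho> + U}"])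
      show "finite Z1" using Zfin by (simp add: Z1_def)
      show "{Im \<rho> - U..Im \<rho> + U} \<subseteq> ?An" if "\<rho> \<in> Z1" for \<rho>
        using that Zp[of \<rho>] U(2) by (auto simp: Z1_def height_band_def)
      fix t assume t: "t \<in> ?An"
      show "real (\<Sum>\<rho>\<in>{\<rho>\<in>Z1. t \<in> {Im \<rho> - U..Im \<rho> + U}}. w \<rho>) \<le> T powr \<kappa>" unfolding w_def
      proof (rule T1(2)[OF TT(2), where t = t])
        show "\<bar>t\<bar> \<le> 2 * T" using t by (simp add: height_band_def)
        show "finite {\<rho>\<in>Z1. t \<in> {Im \<rho> - U..Im \<rho> + U}}" using Zfin by (simp add: Z1_def)
        show "{\<rho>\<in>Z1. t \<in> {Im \<rho> - U..Im \<rho> + U}} \<subseteq> {\<rho>. (1 + \<theta>) / 2 \<le> Re \<rho> \<and> Re \<rho> \<le> 1 \<and> \<bar>Im \<rho> - t\<bar> \<le> ln T + 2}"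
          using Zp al(1) by (fastforce simp: Z1_def U_def abs_le_iff)
      qed
    next
      fix \<rho> assume \<rho>: "\<rho> \<in> Z1"
      then have \<rho>p: "F_reg \<rho> = 0" "\<alpha> \<le> Re \<rho>" "Re \<rho> \<le> 1" "\<bar>Im \<rho>\<bar> \<le> T" "\<bar>Im \<rho>\<bar> \<ge> U + 1" using Zp[of \<rho>] by (auto simp: Z1_def)
      let ?I = "{Im \<rho> - U..Im \<rho> + U}"
      have Isub: "?I \<subseteq> ?An" using \<rho>p U(2) by (auto simp: height_band_def)
      have im: "1 \<le> \<bar>y\<bar>" if "\<bar>y - Im \<rho>\<bar> \<le> U" for y using that \<rho>p(5) by linarith
      have FM: "norm (H (Complex x1 t)) \<le> \<phi> t" for t
      proof -
        have "norm (H (Complex x1 t)) \<le> norm (F (Complex x1 t)) * norm (mollifier X (Complex x1 t)) + 1"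
          unfolding H_def using norm_triangle_ineq4[of "F (Complex x1 t) * mollifier X (Complex x1 t)" 1] by (simp add: norm_mult)
        also have "\<dots> \<le> \<phi> t"
          using sum_squares_bound[of "norm (F (Complex x1 t))" "norm (mollifier X (Complex x1 t))"] by (simp add: \<phi>_def)
        finally show ?thesis .
      qed
      have F\<rho>: "F \<rho> = 0" using \<rho>p(1) by (simp add: F_def)
      define V where "V = A * (3 + 2 * T) ^ g * (2 * T) powr k1 + 1"
      have V0: "V \<ge> 0" unfolding V_def using A(1) TT(1) by (intro add_nonneg_nonneg mult_nonneg_nonneg) auto
      have X3: "X powr 3 = (2 * T) powr k1" by (simp add: X_def powr_powr k1_def)
      have "1 \<le> (exp 4 / \<delta> * Y powr (x1 - Re \<rho>)) * (LINT t:?I|lborel. \<phi> t)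
         + U * (exp 4 / \<delta> * Y powr (x2 - Re \<rho>))\<^sup>2 / 2 * (LINT t:?I|lborel. \<psi> t)"
      proof (rule zero_detection[where H = H and V = V])
        show "H holomorphic_on cbox (Complex x1 (Im \<rho> - U)) (Complex x2 (Im \<rho> + U))"
          unfolding H_def
        proof (intro holomorphic_intros mollifier_holo holomorphic_on_subset[OF F_holo] subsetI)
          fix s assume "s \<in> cbox (Complex x1 (Im \<rho> - U)) (Complex x2 (Im \<rho> + U))"
          then have "x1 \<le> Re s" "\<bar>Im s - Im \<rho>\<bar> \<le> U" by (auto simp: in_cbox_complex_iff abs_le_iff)
          then show "s \<in> {s. Re s > \<theta>} - {1}" using x(2) im[of "Im s"] by auto
        qed
        show "H \<rho> = -1" by (simp add: H_def F\<rho>)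
        show "set_integrable lborel ?I \<phi>" by (rule set_integrable_subset[OF i\<phi> _ Isub]) simp
        show "set_integrable lborel ?I \<psi>" by (rule set_integrable_subset[OF I\<psi>(1) _ Isub]) simp
        show "norm (H (Complex x1 t)) \<le> \<phi> t" for t by (rule FM)
        show "(norm (H (Complex x2 t)))\<^sup>2 = \<psi> t" for t by (simp add: \<psi>_def)
        show "norm (H s) \<le> V" if s: "x1 \<le> Re s" "Re s \<le> x2" "\<bar>Im s - Im \<rho>\<bar> = U" for s
        proof -
          have "\<bar>Im s\<bar> \<le> 2 * T" using s(3) \<rho>p(4) U(2) by linarith
          then have "norm s \<le> 2 + 2 * T" using cmod_le[of s] s x by linarith
          then show ?thesis
            unfolding H_def V_def g_def X3[symmetric] using s x im[of "Im s"] TT(1) X by (intro A(2)) auto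
        qed
        show "V * Y\<^sup>2 * exp (4 - U\<^sup>2) \<le> 1"
        proof -
          have "Y\<^sup>2 = Y powr 2" using Y by simp
          also have "\<dots> = T powr (4 / D)" by (simp add: Ypow)
          also have "\<dots> \<le> T powr k2" unfolding k2_def using D th TT(1) by (intro powr_mono divide_left_mono) auto
          finally have "V * Y\<^sup>2 * exp (4 - U\<^sup>2) \<le> V * T powr k2 * exp (4 - U\<^sup>2)"
            using V0 by (intro mult_right_mono mult_left_mono) auto
          also have "\<dots> \<le> 1" unfolding V_def U_def by (rule T2[OF TT(3)])
          finally show ?thesis .
        qed
      qed (use x d(1) U(1) Y \<rho>p al in \<open>auto simp: x1_def x2_def\<close>)
      also have "\<dots> \<le> A1 * (LINT t:?I|lborel. \<phi> t) + A2 * (LINT t:?I|lborel. \<psi> t)"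
      proof (intro add_mono mult_right_mono)
        \<comment> \<open>Since Y \<ge> 1 and Re \<rho> \<ge> \<alpha>, the factors taken at
          \<alpha> serve every zero, which makes \<Phi> the same function for all of them.\<close>
        have Ym: "Y powr (z - Re \<rho>) \<le> Y powr (z - \<alpha>)" for z using Y \<rho>p(2) by (intro powr_mono) auto
        show "exp 4 / \<delta> * Y powr (x1 - Re \<rho>) \<le> A1" unfolding A1_def using d(1) by (intro mult_left_mono Ym) auto
        show "U * (exp 4 / \<delta> * Y powr (x2 - Re \<rho>))\<^sup>2 / 2 \<le> A2" unfolding A2_def
          using d(1) U(1) by (intro divide_right_mono mult_left_mono power_mono Ym) auto
        show "0 \<le> (LINT t:?I|lborel. \<phi> t)" "0 \<le> (LINT t:?I|lborel. \<psi> t)"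
          unfolding set_lebesgue_integral_def using nn by (auto intro!: integral_nonneg_AE)
      qed
      also have "\<dots> = (LINT t:?I|lborel. \<Phi> t)" by (rule I\<Phi>[OF Isub, symmetric]) simp
      finally show "1 \<le> (LINT t:?I|lborel. \<Phi> t)" .
    qed (use nn i\<Phi> in auto)
    also have "(LINT t:?An|lborel. \<Phi> t) \<le> A1 * (C4 * T powr (1 + e)) + A2 * (2 * CH)"
      unfolding I\<Phi>[OF order_refl, simplified] by (intro add_mono mult_left_mono I\<phi> I\<psi>(2) A12)
    also have "A1 * (C4 * T powr (1 + e)) \<le> C5 * T powr (E + e + \<kappa>)"
    proof -
      \<comment> \<open>This is where Y pays off on the left: D + 2 (x1 - \<alpha>) = 4 (1 -
        \<alpha>) - 2 \<delta>, so the exponent of T Y^(x1 - \<alpha>) does not exceed E.\<close>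
      have "1 + 2 * (x1 - \<alpha>) / D \<le> E"
      proof -
        have "1 + 2 * (x1 - \<alpha>) / D = (D + 2 * (x1 - \<alpha>)) / D" using D by (simp add: field_simps)
        also have "\<dots> \<le> 4 * (1 - \<alpha>) / D" 
        proof (rule divide_right_mono)
          have "2 * x1 = 1 + \<theta> - 2 * \<delta>" by (simp add: x1_def field_simps)
          then show "D + 2 * (x1 - \<alpha>) \<le> 4 * (1 - \<alpha>)" using d(1) unfolding D_def right_diff_distrib by linarith
        qed (use D in simp)
        finally show ?thesis by (simp add: E_def)
      qed
      then have le: "2 * (x1 - \<alpha>) / D + (1 + e) \<le> E + e + \<kappa>" using kap by linarith
      have "A1 * (C4 * T powr (1 + e)) = C5 * (T powr (2 * (x1 - \<alpha>) / D) * T powr (1 + e))"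
        by (simp add: A1_def C5_def Ypow)
      also have "\<dots> = C5 * T powr (2 * (x1 - \<alpha>) / D + (1 + e))" by (simp only: powr_add)
      also have "\<dots> \<le> C5 * T powr (E + e + \<kappa>)" using C456 le TT(1) by (intro mult_left_mono powr_mono) auto
      finally show ?thesis .
    qed
    also have "A2 * (2 * CH) \<le> C6 * T powr (E + e + \<kappa>)"
    proof -
      \<comment> \<open>On the right the exponent of Y^(2 (x2 - \<alpha>)) is E plus the cost 4
        \<delta>/D of moving to Re s = 1 + \<delta>; the lower bound D \<ge> 1 - \<theta> makes this
        cost at most e.\<close>
      have "4 * \<delta> / D \<le> e" unfolding e_def using d(1) D th by (intro divide_left_mono) auto
      moreover have "2 * (2 * (x2 - \<alpha>) / D) = E + 4 * \<delta> / D" by (simp add: E_def x2_def add_divide_distrib[symmetric])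
      ultimately have le: "2 * (2 * (x2 - \<alpha>) / D) \<le> E + e" by linarith
      have "A2 * (2 * CH) = C6 * (U * (T powr (2 * (x2 - \<alpha>) / D) * T powr (2 * (x2 - \<alpha>) / D)))"
        unfolding A2_def C6_def Ypow power2_eq_square by simp
      also have "T powr (2 * (x2 - \<alpha>) / D) * T powr (2 * (x2 - \<alpha>) / D) = T powr (2 * (2 * (x2 - \<alpha>) / D))"
        unfolding powr_add[symmetric] by simp
      also have "C6 * (U * T powr (2 * (2 * (x2 - \<alpha>) / D))) \<le> C6 * (T powr \<kappa> * T powr (E + e))"
        using C456 U le TT(1) by (intro mult_left_mono mult_mono powr_mono) auto
      also have "T powr \<kappa> * T powr (E + e) = T powr (E + e + \<kappa>)" unfolding powr_add[symmetric] by (simp add: add_ac)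
      finally show ?thesis .
    qed
    finally have "real (\<Sum>\<rho>\<in>Z1. w \<rho>) \<le> T powr \<kappa> * (C5 * T powr (E + e + \<kappa>) + C6 * T powr (E + e + \<kappa>))"
      by (simp add: mult_left_mono)
    also have "\<dots> = (C5 + C6) * T powr (\<kappa> + (E + e + \<kappa>))"
      unfolding powr_add[of T \<kappa>] by (simp add: algebra_simps)
    also have "\<dots> \<le> (C5 + C6) * T powr (E + \<epsilon>)"
      using C456 TT(1) e(3) eps by (intro mult_left_mono powr_mono) (auto simp: \<kappa>_def)
    finally have high: "real (\<Sum>\<rho>\<in>Z1. w \<rho>) \<le> (C5 + C6) * T powr (E + \<epsilon>)" .
    have "Z = Z0 \<union> Z1" "Z0 \<inter> Z1 = {}" by (auto simp: Z0_def Z1_def)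
    moreover have "finite Z0" "finite Z1" using Zfin by (auto simp: Z0_def Z1_def)
    ultimately have "(\<Sum>\<rho>\<in>Z. w \<rho>) = (\<Sum>\<rho>\<in>Z0. w \<rho>) + (\<Sum>\<rho>\<in>Z1. w \<rho>)" by (simp add: sum.union_disjoint)
    then have "real (zero_count F \<alpha> T) = real (\<Sum>\<rho>\<in>Z0. w \<rho>) + real (\<Sum>\<rho>\<in>Z1. w \<rho>)"
      unfolding zero_count_F[OF al\<theta>] Z_def[symmetric] w_def[symmetric] by simp
    also have "\<dots> \<le> T powr (E + \<epsilon>) + (C5 + C6) * T powr (E + \<epsilon>)" by (rule add_mono[OF low high])
    also have "\<dots> = (1 + C5 + C6) * T powr (E + \<epsilon>)" by (simp add: algebra_simps)
    finally show "real (zero_count F \<alpha> T) \<le> (1 + C5 + C6) * T powr (4 * (1 - \<alpha>) / (3 - 2 * \<alpha> - \<theta>) + \<epsilon>)"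
      by (simp add: E_def D_def)
  qed
qed

lemma zero_density:
  assumes eps: "\<epsilon> > 0"
  shows "\<exists>C. \<forall>\<alpha> \<ge> (1 + \<theta>) / 2. \<forall>T \<ge> 2. finite (zeros_in F \<alpha> T) \<and>
      real (zero_count F \<alpha> T) \<le> C * T powr (4 * (1 - \<alpha>) / (3 - 2 * \<alpha> - \<theta>) + \<epsilon>)"
proof -
  obtain C T0 where C: "C \<ge> 0" "T0 \<ge> 3" "\<And>\<alpha> T. T \<ge> T0 \<Longrightarrow> (1 + \<theta>) / 2 \<le> \<alpha> \<Longrightarrow> \<alpha> \<le> 1 \<Longrightarrow>
     real (zero_count F \<alpha> T) \<le> C * T powr (4 * (1 - \<alpha>) / (3 - 2 * \<alpha> - \<theta>) + \<epsilon>)"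
    using zero_density_large[OF eps] by blast
  define \<sigma>0 where "\<sigma>0 = (1 + \<theta>) / 2"
  have s0: "\<sigma>0 > \<theta>" using theta by (simp add: \<sigma>0_def field_simps)
  define K where "K = real (zero_count F \<sigma>0 T0)"
  have K: "K \<ge> 0" by (simp add: K_def)
  show ?thesis
  proof (intro exI[of _ "C + K"] allI impI conjI)
    fix \<alpha> T :: real assume al: "\<alpha> \<ge> (1 + \<theta>) / 2" and T: "T \<ge> 2"
    have al\<theta>: "\<alpha> > \<theta>" using al s0 by (simp add: \<sigma>0_def)
    show "finite (zeros_in F \<alpha> T)" by (rule finite_zeros_in_F[OF al\<theta>])
    let ?E = "4 * (1 - \<alpha>) / (3 - 2 * \<alpha> - \<theta>) + \<epsilon>"
    show "real (zero_count F \<alpha> T) \<le> (C + K) * T powr ?E"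
    proof (cases "\<alpha> \<le> 1")
      case False
      \<comment> \<open>For \<alpha> > 1 the denominator of the exponent may vanish or be negative;
        the count is 0, so any nonnegative right-hand side will do.\<close>
      then have "zeros_in F \<alpha> T = {}" unfolding zeros_in_F[OF al\<theta>] by auto
      then show ?thesis using C(1) K by (simp add: zero_count_def)
    next
      case a1: True
      show ?thesis
      proof (cases "T \<ge> T0")
        case True
        have "real (zero_count F \<alpha> T) \<le> C * T powr ?E" by (rule C(3)[OF True al a1])
        also have "\<dots> \<le> (C + K) * T powr ?E" using K by (intro mult_right_mono) auto
        finally show ?thesis .
      next
        case False
        \<comment> \<open>Below the threshold T0 every zero counted lies in one fixed finite set,
          and the exponent is nonnegative, so the constant K covers these T.\<close>
        have "zeros_in F \<alpha> T \<subseteq> zeros_in F \<sigma>0 T0"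
          unfolding zeros_in_F[OF al\<theta>] zeros_in_F[OF s0] using al False by (auto simp: \<sigma>0_def)
        then have "zero_count F \<alpha> T \<le> zero_count F \<sigma>0 T0"
          unfolding zero_count_def by (intro sum_mono2 finite_zeros_in_F s0) auto
        then have "real (zero_count F \<alpha> T) \<le> K * 1" by (simp add: K_def)
        also have "\<dots> \<le> (C + K) * T powr ?E"
        proof (intro mult_mono)
          have "4 * (1 - \<alpha>) / (3 - 2 * \<alpha> - \<theta>) \<ge> 0" using a1 theta by (intro divide_nonneg_nonneg) auto
          then show "1 \<le> T powr ?E" using T eps by (intro ge_one_powr_ge_zero) auto
        qed (use C(1) K in auto)
        finally show ?thesis .
      qed
    qed
  qed
qed

end

theorem theorem1p3:
  fixes p n a :: "nat \<Rightarrow> real" and b :: "nat \<Rightarrow> complex"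
    and \<theta> q :: real and P :: "real poly" and d :: nat
  assumes "beurling_integers p n"
    and "0 \<le> \<theta>" and "\<theta> < 1"
    and "\<And>\<epsilon>. \<epsilon> > 0 \<Longrightarrow>
      (\<lambda>x::real. real (counting n (x + x powr \<theta>)) - real (counting n (x - x powr \<theta>)))
        \<in> O(\<lambda>x. x powr (\<theta> + \<epsilon>))"
    and "a 0 = 1" and "b 0 = 1"
    and "formal_inverse n (\<lambda>j. complex_of_real (a j)) b"
    and "\<And>j. 0 \<le> a j"
    and "\<And>\<epsilon>. \<epsilon> > 0 \<Longrightarrow> a \<in> O(\<lambda>j. n j powr \<epsilon>)"
    and "\<And>\<epsilon>. \<epsilon> > 0 \<Longrightarrow> (\<lambda>j. norm (b j)) \<in> O(\<lambda>j. n j powr \<epsilon>)"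
    and "P \<noteq> 0" and "degree P = d"
    and "(\<lambda>x. summatory n a x - x * poly P (ln x)) \<in> O(\<lambda>x. x powr \<theta> * ln x powr q)"
  shows "\<exists>F :: complex \<Rightarrow> complex.
    (\<forall>s. Re s > 1 \<longrightarrow>
      (\<lambda>j. complex_of_real (a j) / complex_of_real (n j) powr s) sums F s) \<and>
    F meromorphic_on {s. Re s > \<theta>} \<and>
    F holomorphic_on ({s. Re s > \<theta>} - {1}) \<and>
    is_pole F 1 \<and> zorder F 1 = - int (d + 1) \<and>
    (\<forall>\<epsilon>>0. \<exists>C. \<forall>\<alpha> \<ge> (1 + \<theta>) / 2. \<forall>T \<ge> 2.
      finite (zeros_in F \<alpha> T) \<and>
      real (zero_count F \<alpha> T) \<le> C * T powr (4 * (1 - \<alpha>) / (3 - 2 * \<alpha> - \<theta>) + \<epsilon>))"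
proof -
  interpret dirichlet_pair p n \<theta> a b q P
    by unfold_locales (fact assms)+
  have series: "(\<lambda>j. complex_of_real (a j) / complex_of_real (n j) powr s) sums F s" if "Re s > 1" for s
    using F_sums[OF that] by (simp add: nexp_powr)
  show ?thesis
    using series F_meromorphic F_holo F_pole zero_density \<open>degree P = d\<close>
    by (intro exI[of _ F]) auto
qed

end
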